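(* Let $\mathcal{N}\subseteq\mathbb{V}^{m\times n}$ be a nonempty open set, let $g:\mathbb{R}^m\to\mathbb{R}^m$ be absolutely symmetric on an open set $\hat\sigma_{\mathcal{N}}\subseteq\mathbb{R}^m$ containing $\{\sigma(X)\mid X\in\mathcal{N}\}$, and let $G:\mathcal{N}\to\mathbb{V}^{m\times n}$ be the spectral operator with respect to $g$. Let $\overline{X}\in\mathcal{N}$ and let $0<\rho\le1$. Then: (i) if $g$ is locally Lipschitz continuous near $\sigma(\overline{X})$ and $\rho$-order B-differentiable at $\sigma(\overline{X})$, then $G$ is $\rho$-order B-differentiable at $\overline{X}$; (ii) if $G$ is $\rho$-order B-differentiable at $\overline{X}$, then $g$ is $\rho$-order B-differentiable at $\sigma(\overline{X})$.
   Context: Fix $m\le n$. $\mathbb{V}^{m\times n}$ denotes either $\mathbb{R}^{m\times n}$ or $\mathbb{C}^{m\times n}$, viewed as a real Euclidean space with inner product $\langle X,Y\rangle=\mathrm{Re}(\mathrm{trace}(X^{*}Y))$ and induced norm, where $X^{*}$ is the (conjugate) transpose. $\mathbb{O}^p$ is the set of $p\times p$ orthogonal (real case) or unitary (complex case) matrices. $\sigma(Z)\in\mathbb{R}^m$ is the vector of singular values $\sigma_1(Z)\ge\cdots\ge\sigma_m(Z)\ge0$ of $Z\in\mathbb{V}^{m\times n}$; $\mathrm{Diag}(x)$ is the diagonal matrix with diagonal $x$; $\mathbb{O}^{m,n}(Z)$ is the set of pairs $(U,V)\in\mathbb{O}^m\times\mathbb{O}^n$ with $Z=U[\mathrm{Diag}(\sigma(Z))\quad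 0]V^{*}$. A signed permutation matrix is a square matrix with exactly one nonzero entry in each row and each column, that entry being $\pm1$. The mapping $g:\mathbb{R}^m\to\mathbb{R}^m$ is absolutely symmetric on a set $D$ if $g(Qx)=Qg(x)$ for every $x\in D$ and every $m\times m$ signed permutation matrix $Q$. The spectral operator $G$ with respect to $g$ is $G(X)=U[\mathrm{Diag}(g(\sigma(X)))\quad 0]V^{*}$ for $X\in\mathcal{N}$, where $(U,V)\in\mathbb{O}^{m,n}(X)$ (the value does not depend on the choice of $(U,V)$). Let $F:\mathcal{O}\to\mathcal{Z}'$ with $\mathcal{O}$ open in $\mathcal{Z}$, where $\mathcal{Z},\mathcal{Z}'$ are finite dimensional real Euclidean spaces, and let $\rho>0$. $F$ is $\rho$-order B(ouligand)-differentiable at $z\in\mathcal{O}$ if the directional derivative $F'(z;h)=\lim_{t\downarrow0}\frac{F(z+th)-F(z)}{t}$ exists for every $h\in\mathcal{Z}$ and, as $h\to0$, $F(z+h)-F(z)-F'(z;h)=O(\|h\|^{1+\rho})$. A function is locally Lipschitz continuous near a point if it is Lipschitz continuous on some neighborhood of that point. *)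

theory Defs
  imports
    "HOL-Analysis.Analysis"
    "HOL-Library.Landau_Symbols"
    "Jordan_Normal_Form.Conjugate"
begin

type_synonym ('a, 'm, 'n) matrix = "(('a, 'n) vec, 'm) vec"

text \<open>
  Rows are indexed by \<open>'m\<close>, columns by \<open>'n\<close>; the type is \<open>'a ^ 'n ^ 'm\<close>. The entries will be \<^typ>\<open>real\<close>
  or \<^typ>\<open>complex\<close>. Index types carry a linear order, so that "the k-th row" and "singular values in
  decreasing order" make sense.
  The norm of \<open>('a, 'm, 'n) matrix\<close> is the Frobenius norm; see \<open>inner_eq_trace_real\<close> and
  \<open>inner_eq_trace_complex\<close> below.
\<close>

definition conj_transpose :: "('a::conjugate, 'm::finite, 'n::finite) matrix \<Rightarrow> ('a, 'n, 'm) matrix" where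
  "conj_transpose A = (\<chi> i j. conjugate (A $ j $ i))"

definition unitary_matrix :: "('a::conjugatable_field, 'p::finite, 'p) matrix \<Rightarrow> bool" where
  "unitary_matrix U \<longleftrightarrow>
     conj_transpose U ** U = mat 1 \<and> U ** conj_transpose U = mat 1"

lemma unitary_matrix_real: "unitary_matrix (U :: (real, 'p::finite, 'p) matrix) \<longleftrightarrow> orthogonal_matrix U"
  by (simp add: unitary_matrix_def orthogonal_matrix_def conj_transpose_def transpose_def)

lemma inner_eq_trace_real:
  fixes X Y :: "(real, 'm::finite, 'n::finite) matrix"
  shows "X \<bullet> Y = trace (conj_transpose X ** Y)"
  unfolding inner_vec_def trace_def conj_transpose_def matrix_matrix_mult_def
  by (simp, rule sum.swap)

lemma inner_eq_trace_complex:
  fixes X Y :: "(complex, 'm::finite, 'n::finite) matrix"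
  shows "X \<bullet> Y = Re (trace (conj_transpose X ** Y))"
  unfolding inner_vec_def trace_def conj_transpose_def matrix_matrix_mult_def
  by (simp add: inner_complex_def, rule sum.swap)

definition index_pos :: "'i::{finite,linorder} \<Rightarrow> nat" where
  "index_pos i = card {..<i}"

text \<open>
  The block matrix \<open>[Diag(x) 0]\<close>: row and column index types differ, so "on the diagonal" means
  that the row and the column have the same position in their respective index orders.
\<close>
definition diag_zero ::
  "(real, 'm::{finite,linorder}) vec \<Rightarrow> ('a::real_normed_field, 'm, 'n::{finite,linorder}) matrix" where
  "diag_zero x = (\<chi> i j. if index_pos i = index_pos j then of_real (x $ i) else 0)"

text \<open>
  The unique decreasing nonnegative vector \<open>s\<close> occurring in a singular value decomposition
  \<open>Z = U [Diag(s) 0] V\<^sup>*\<close>. Only meaningful if \<open>CARD('m) \<le> CARD('n)\<close>.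
\<close>
definition singular_values ::
  "('a::{real_normed_field,conjugatable_field}, 'm::{finite,linorder}, 'n::{finite,linorder}) matrix \<Rightarrow> (real, 'm) vec" where
  "singular_values Z =
     (THE s. (\<forall>i j. i \<le> j \<longrightarrow> s $ j \<le> s $ i) \<and> (\<forall>i. 0 \<le> s $ i) \<and>
        (\<exists>U V. unitary_matrix U \<and> unitary_matrix V \<and>
           Z = U ** diag_zero s ** conj_transpose V))"

definition svd_pairs ::
  "('a::{real_normed_field,conjugatable_field}, 'm::{finite,linorder}, 'n::{finite,linorder}) matrix
    \<Rightarrow> (('a, 'm, 'm) matrix \<times> ('a, 'n, 'n) matrix) set" where
  "svd_pairs Z =
     {(U, V). unitary_matrix U \<and> unitary_matrix V \<and>
        Z = U ** diag_zero (singular_values Z) ** conj_transpose V}"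

definition signed_permutation_matrix :: "(real, 'm::finite, 'm) matrix \<Rightarrow> bool" where
  "signed_permutation_matrix Q \<longleftrightarrow>
     (\<forall>i. \<exists>!j. Q $ i $ j \<noteq> 0) \<and> (\<forall>j. \<exists>!i. Q $ i $ j \<noteq> 0) \<and>
     (\<forall>i j. Q $ i $ j \<noteq> 0 \<longrightarrow> Q $ i $ j = 1 \<or> Q $ i $ j = - 1)"

definition absolutely_symmetric_on ::
  "(real, 'm::finite) vec set \<Rightarrow> ((real, 'm) vec \<Rightarrow> (real, 'm) vec) \<Rightarrow> bool" where
  "absolutely_symmetric_on D g \<longleftrightarrow>
     (\<forall>x\<in>D. \<forall>Q. signed_permutation_matrix Q \<longrightarrow> g (Q *v x) = Q *v g x)"

text \<open>\<open>G\<close> is a total function; its values outside \<open>N\<close> are unconstrained.\<close>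
definition spectral_operator_on ::
  "('a::{real_normed_field,conjugatable_field}, 'm::{finite,linorder}, 'n::{finite,linorder}) matrix set
    \<Rightarrow> ((real, 'm) vec \<Rightarrow> (real, 'm) vec) \<Rightarrow> (('a, 'm, 'n) matrix \<Rightarrow> ('a, 'm, 'n) matrix) \<Rightarrow> bool" where
  "spectral_operator_on N g G \<longleftrightarrow>
     (\<forall>X\<in>N. \<forall>(U, V)\<in>svd_pairs X.
        G X = U ** diag_zero (g (singular_values X)) ** conj_transpose V)"

text \<open>
  Both notions below are local at \<open>z\<close>, so for a map defined only on an open set containing \<open>z\<close> the
  values of a total extension outside that set are irrelevant.
\<close>
definition has_directional_derivative ::
  "('a::euclidean_space \<Rightarrow> 'b::euclidean_space) \<Rightarrow> 'a \<Rightarrow> 'a \<Rightarrow> 'b \<Rightarrow> bool" where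
  "has_directional_derivative F z h d \<longleftrightarrow>
     ((\<lambda>t. (F (z + t *\<^sub>R h) - F z) /\<^sub>R t) \<longlongrightarrow> d) (at_right 0)"

definition B_differentiable_order_at ::
  "real \<Rightarrow> ('a::euclidean_space \<Rightarrow> 'b::euclidean_space) \<Rightarrow> 'a \<Rightarrow> bool" where
  "B_differentiable_order_at \<rho> F z \<longleftrightarrow>
     (\<exists>F'. (\<forall>h. has_directional_derivative F z h (F' h)) \<and>
        (\<lambda>h. norm (F (z + h) - F z - F' h)) \<in> O[at 0](\<lambda>h. norm h powr (1 + \<rho>)))"

definition locally_lipschitz_near ::
  "('a::metric_space \<Rightarrow> 'b::metric_space) \<Rightarrow> 'a \<Rightarrow> bool" where
  "locally_lipschitz_near f x \<longleftrightarrow> (\<exists>U L. open U \<and> x \<in> U \<and> L-lipschitz_on U f)"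

end

theory Submission
  imports Defs
begin

text \<open>
Write \<open>U [x] V\<^sup>*\<close> for the matrix with left factor \<open>U\<close>, right factor \<open>V\<close> and, in the middle, the
rectangular matrix with the real vector \<open>x\<close> on the diagonal and zeros elsewhere; \<open>U\<close> and \<open>V\<close> are unitary throughout, and \<open>X = U\<^sub>0 [\<sigma>] V\<^sub>0\<^sup>*\<close> is a singular value decomposition of the point of interest.

The whole argument rests on one identity (\<open>recompose_distance_mixture\<close>). Given two pairs of unitary factors there are
weights \<open>w\<^sub>Q \<ge> 0\<close> with sum \<open>1\<close>, indexed by the signed permutation matrices \<open>Q\<close>, such that, for all real vectors \<open>a\<close>, \<open>b\<close>,

\<open>\<parallel>U [a] V\<^sup>* - U' [b] V'\<^sup>*\<parallel>\<^sup>2 = \<Sum>\<^sub>Q w\<^sub>Q \<parallel>a - Q b\<parallel>\<^sup>2\<close>.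

The reason is that the inner product \<open>\<langle>U [a] V\<^sup>*, U' [b] V'\<^sup>*\<rangle>\<close> is \<open>\<langle>a, R b\<rangle>\<close> for a matrix \<open>R\<close> whose rows and columns have
absolute sum at most \<open>1\<close>, and a signed version of Birkhoff's theorem (\<open>abs_substochastic_in_hull\<close>) writes \<open>R\<close> as
a mixture of signed permutation matrices. As the weights do not depend on \<open>a\<close> and \<open>b\<close>, the identity
turns equivariance of a vector map into estimates for the matrix map. It gives uniqueness of singular values, the
equation \<open>G (U [x] V\<^sup>*) = U [g x] V\<^sup>*\<close> for decompositions that are neither sorted nor nonnegative, and, for every \<open>H\<close>,
a decomposition \<open>X + H = U [s] V\<^sup>*\<close> with \<open>\<parallel>s - \<sigma>\<parallel> \<le> \<parallel>H\<parallel>\<close>.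

For the passage from \<open>g\<close> to \<open>G\<close> let \<open>\<phi>\<close> be the directional derivative of \<open>g\<close> at \<open>\<sigma>\<close>. It is positively homogeneous,
Lipschitz, and commutes with the signed permutations that fix \<open>\<sigma>\<close>. With \<open>X + H = U [s] V\<^sup>*\<close> as above,

\<open>G (X + H) = U [g \<sigma>] V\<^sup>* + U [\<phi> (s - \<sigma>)] V\<^sup>* + O(\<parallel>H\<parallel> powr (1 + \<rho>))\<close>,

and the two terms are expanded separately.

The first term has frozen values: \<open>g \<sigma>\<close> is a vector that agrees wherever \<open>\<sigma>\<close> agrees and vanishes wherever \<open>\<sigma>\<close> vanishes.
Choose an odd polynomial \<open>p\<close> that touches the value \<open>g \<sigma> $ i\<close> to second order at \<open>\<sigma> $ i\<close>, for each \<open>i\<close>. Odd polynomials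
lift to matrices through \<open>X X\<^sup>* X\<close>, so \<open>U [p s] V\<^sup>*\<close> is a polynomial in \<open>X + H\<close> and its adjoint. Hence
\<open>U [g \<sigma>] V\<^sup>* = U\<^sub>0 [g \<sigma>] V\<^sub>0\<^sup>* + L H + O(\<parallel>H\<parallel>\<^sup>2)\<close> with \<open>L\<close> linear (\<open>frozen_values_expansion\<close>), although \<open>U\<close> and \<open>V\<close>
need not depend continuously on \<open>H\<close>.

For the second term use the same expansion with \<open>\<sigma>\<close> in place of \<open>g \<sigma>\<close>. It yields a linear map \<open>P\<close> with
\<open>U [s - \<sigma>] V\<^sup>* = P H + O(\<parallel>H\<parallel>\<^sup>2)\<close>, and a compactness argument shows \<open>P H = U' [x] V'\<^sup>*\<close> for some
decomposition \<open>X = U' [\<sigma>] V'\<^sup>*\<close> of the same base point (\<open>normal_part_decomposition\<close>). Now compare \<open>U [\<phi> (s - \<sigma>)] V\<^sup>*\<close>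
with \<open>U' [\<phi> x] V'\<^sup>*\<close> through the mixture. The \<open>Q\<close> that fix \<open>\<sigma>\<close> commute with \<open>\<phi>\<close>, and the Lipschitz bound
reduces them to \<open>\<parallel>U [s - \<sigma>] V\<^sup>* - U' [x] V'\<^sup>*\<parallel> = O(\<parallel>H\<parallel>\<^sup>2)\<close>. The other \<open>Q\<close> move \<open>\<sigma>\<close> by a fixed amount, and
\<open>\<parallel>H\<parallel>\<^sup>2\<close> is the mixture of the numbers \<open>\<parallel>s - Q \<sigma>\<parallel>\<^sup>2\<close>, so that their total weight is \<open>O(\<parallel>H\<parallel>\<^sup>2)\<close>. Therefore the second term is
\<open>U' [\<phi> x] V'\<^sup>* + O(\<parallel>H\<parallel>\<^sup>2)\<close>, and its leading part, chosen on the unit sphere and extended by homogeneity, is the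
second part of the directional derivative of \<open>G\<close>.

The passage from \<open>G\<close> to \<open>g\<close> restricts \<open>G\<close> to the affine space of the matrices \<open>U\<^sub>0 [\<sigma> + h] V\<^sub>0\<^sup>*\<close>, on which it acts as \<open>g\<close>.
\<close>

section \<open>Real and complex scalars\<close>

text \<open>
A common roof for \<^typ>\<open>real\<close> and \<^typ>\<open>complex\<close>, so that each argument is given once. The axiom makes
multiplication by \<open>conjugate a\<close> the adjoint of multiplication by \<open>a\<close> for the real inner product. This fixes the conjugates
of the reals and, as the norm is multiplicative, the value of \<open>conjugate a * a\<close>.
\<close>

class rc_field = real_normed_field + conjugatable_field + euclidean_space +
  assumes inner_mult_left_conj: "inner (a * b) c = inner b (conjugate a * c)"

instance real :: rc_field by standard simp
instance complex :: rc_field by standard (simp add: inner_complex_def algebra_simps)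

lemma conjugate_of_real [simp]: "conjugate (of_real r) = (of_real r :: 'a::rc_field)"
proof -
  have "inner (conjugate (of_real r) - of_real r) c = 0" for c :: 'a
  proof -
    have "inner (conjugate (of_real r)) c = inner 1 (of_real r * c)"
      using inner_mult_left_conj[of "conjugate (of_real r)" 1 c] by simp
    also have "\<dots> = inner (of_real r) c"
      using inner_scaleR_left[of r 1 c] by (simp add: of_real_def)
    finally show ?thesis by (simp add: inner_diff_left)
  qed
  from this[of "conjugate (of_real r) - of_real r"] show ?thesis by simp
qed

lemma conjugate_1 [simp]: "conjugate 1 = (1 :: 'a::rc_field)"
  using conjugate_of_real[of 1] by simp

lemma conjugate_scaleR [simp]: "conjugate (r *\<^sub>R a) = r *\<^sub>R conjugate a" for a :: "'a::rc_field"
  by (simp add: scaleR_conv_of_real conjugate_dist_mul)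

text \<open>
Polarise \<open>\<parallel>a b\<parallel>\<^sup>2 = \<parallel>a\<parallel>\<^sup>2 \<parallel>b\<parallel>\<^sup>2\<close> in \<open>b\<close>.
\<close>

lemma conjugate_mult_self: "conjugate a * a = of_real ((norm a)\<^sup>2)" for a :: "'a::rc_field"
proof -
  have sq: "inner (a * b) (a * b) = (norm a)\<^sup>2 * inner b b" for b
    by (simp add: power2_norm_eq_inner[symmetric] norm_mult power_mult_distrib)
  have pol: "inner (a * b) (a * c) = (norm a)\<^sup>2 * inner b c" for b c
    using sq[of "b + c"] sq[of b] sq[of c]
    by (simp add: distrib_left inner_add_left inner_add_right inner_commute)
  have "inner b (conjugate a * a - of_real ((norm a)\<^sup>2)) = 0" for b
    using pol[of b 1] by (simp add: inner_mult_left_conj inner_diff_right)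
      (metis inner_scaleR_right scaleR_conv_of_real mult.right_neutral of_real_power)
  from this[of "conjugate a * a - of_real ((norm a)\<^sup>2)"] show ?thesis by simp
qed

lemma norm_conjugate [simp]: "norm (conjugate a) = norm a" for a :: "'a::rc_field"
proof (cases "a = 0")
  case False
  have "norm (conjugate a) * norm a = norm a * norm a"
    using arg_cong[OF conjugate_mult_self[of a], of norm]
    by (simp add: norm_mult power2_eq_square)
  with False show ?thesis by simp
qed simp

lemma inner_conjugate: "inner (conjugate a) (conjugate b) = inner a b" for a b :: "'a::rc_field"
  by (metis inner_commute inner_mult_left_conj mult.commute mult.right_neutral)

lemma inner_conjugate_left: "inner (conjugate a) b = inner a (conjugate b)" for a b :: "'a::rc_field"
  by (metis inner_conjugate conjugate_id)

section \<open>Unitary matrices\<close>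

lemma conj_transpose_nth [simp]: "conj_transpose A $ i $ j = conjugate (A $ j $ i)"
  by (simp add: conj_transpose_def)

lemma matrix_mult_nth: "(A ** B) $ i $ j = (\<Sum>k\<in>UNIV. A $ i $ k * B $ k $ j)"
  by (simp add: matrix_matrix_mult_def)

lemma conj_transpose_conj_transpose [simp]: "conj_transpose (conj_transpose A) = A"
  by (simp add: vec_eq_iff)

lemma conj_transpose_mult:
  "conj_transpose (A ** B) = conj_transpose B ** conj_transpose A"
  for A :: "('a::conjugatable_field, 'm::finite, 'k::finite) matrix"
  by (simp add: vec_eq_iff matrix_mult_nth sum_conjugate conjugate_dist_mul mult.commute)

lemma conj_transpose_add: "conj_transpose (A + B) = conj_transpose A + conj_transpose B"
  for A :: "('a::conjugatable_field, 'm::finite, 'k::finite) matrix"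
  by (simp add: vec_eq_iff conjugate_dist_add)

lemma conj_transpose_scaleR: "conj_transpose (r *\<^sub>R A) = r *\<^sub>R conj_transpose A"
  for A :: "('a::rc_field, 'm::finite, 'k::finite) matrix"
  by (simp add: vec_eq_iff)

lemma conj_transpose_mat_1 [simp]: "conj_transpose (mat 1) = (mat 1 :: ('a::rc_field, 'm::finite, 'm) matrix)"
  by (simp add: vec_eq_iff mat_def)

lemma inner_matrix_nth: "inner A B = (\<Sum>i\<in>UNIV. \<Sum>j\<in>UNIV. inner (A $ i $ j) (B $ i $ j))"
  by (simp add: inner_vec_def)

lemma inner_conj_transpose: "inner (conj_transpose A) (conj_transpose B) = inner A B"
  for A :: "('a::rc_field, 'm::finite, 'k::finite) matrix"
  unfolding inner_matrix_nth by (simp add: inner_conjugate) (rule sum.swap)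

lemma inner_mult_left: "inner (A ** B) C = inner B (conj_transpose A ** C)"
  for A :: "('a::rc_field, 'm::finite, 'k::finite) matrix" and B :: "('a, 'k, 'n::finite) matrix"
proof -
  have "inner (A ** B) C = (\<Sum>i\<in>UNIV. \<Sum>j\<in>UNIV. \<Sum>k\<in>UNIV. inner (B $ k $ j) (conjugate (A $ i $ k) * C $ i $ j))"
    by (simp add: inner_matrix_nth matrix_mult_nth inner_sum_left inner_mult_left_conj)
  also have "\<dots> = (\<Sum>i\<in>UNIV. \<Sum>k\<in>UNIV. \<Sum>j\<in>UNIV. inner (B $ k $ j) (conjugate (A $ i $ k) * C $ i $ j))"
    by (intro sum.cong refl) (rule sum.swap)
  also have "\<dots> = (\<Sum>k\<in>UNIV. \<Sum>i\<in>UNIV. \<Sum>j\<in>UNIV. inner (B $ k $ j) (conjugate (A $ i $ k) * C $ i $ j))"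
    by (rule sum.swap)
  also have "\<dots> = (\<Sum>k\<in>UNIV. \<Sum>j\<in>UNIV. \<Sum>i\<in>UNIV. inner (B $ k $ j) (conjugate (A $ i $ k) * C $ i $ j))"
    by (intro sum.cong refl) (rule sum.swap)
  also have "\<dots> = inner B (conj_transpose A ** C)"
    by (simp add: inner_matrix_nth matrix_mult_nth inner_sum_right)
  finally show ?thesis .
qed

lemma inner_mult_right: "inner (A ** B) C = inner A (C ** conj_transpose B)"
  for A :: "('a::rc_field, 'm::finite, 'k::finite) matrix" and B :: "('a, 'k, 'n::finite) matrix"
proof -
  have "inner (A ** B) C = inner (conj_transpose B ** conj_transpose A) (conj_transpose C)"
    by (metis inner_conj_transpose conj_transpose_mult)
  also have "\<dots> = inner (conj_transpose A) (B ** conj_transpose C)"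
    by (simp add: inner_mult_left)
  also have "\<dots> = inner A (C ** conj_transpose B)"
    by (metis inner_conj_transpose conj_transpose_mult conj_transpose_conj_transpose)
  finally show ?thesis .
qed

lemma unitary_matrix_conj_transpose [simp]: "unitary_matrix (conj_transpose U) = unitary_matrix U"
  by (auto simp: unitary_matrix_def)

lemma unitary_matrix_1 [simp]: "unitary_matrix (mat 1 :: ('a::rc_field, 'm::finite, 'm) matrix)"
  by (simp add: unitary_matrix_def)

lemma unitary_matrix_mult:
  assumes "unitary_matrix U" "unitary_matrix V" shows "unitary_matrix (U ** V)"
  using assms unfolding unitary_matrix_def conj_transpose_mult
  by (metis matrix_mul_assoc matrix_mul_lid)

lemma unitary_cancel:
  assumes "unitary_matrix U"
  shows "conj_transpose U ** (U ** A) = A" "U ** (conj_transpose U ** A) = A"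
    "(B ** U) ** conj_transpose U = B" "(B ** conj_transpose U) ** U = B"
  using assms unfolding unitary_matrix_def
  by (metis matrix_mul_assoc matrix_mul_lid matrix_mul_rid)+

lemma inner_unitary_left:
  fixes U :: "('a::rc_field, 'm::finite, 'm) matrix"
  assumes "unitary_matrix U" shows "inner (U ** A) (U ** B) = inner A B"
  by (simp add: inner_mult_left unitary_cancel assms)

lemma inner_unitary_right:
  fixes V :: "('a::rc_field, 'm::finite, 'm) matrix"
  assumes "unitary_matrix V" shows "inner (A ** V) (B ** V) = inner A B"
  by (simp add: inner_mult_right unitary_cancel assms)

lemma norm_unitary_left:
  fixes U :: "('a::rc_field, 'm::finite, 'm) matrix"
  assumes "unitary_matrix U" shows "norm (U ** A) = norm A"
  by (simp add: norm_eq_sqrt_inner inner_unitary_left assms)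

lemma bounded_bilinear_matrix_mult:
  "bounded_bilinear ((**) :: ('a::rc_field, 'm::finite, 'k::finite) matrix \<Rightarrow> ('a, 'k, 'n::finite) matrix \<Rightarrow> _)"
proof -
  have "bilinear ((**) :: ('a, 'm, 'k) matrix \<Rightarrow> ('a, 'k, 'n) matrix \<Rightarrow> _)"
    unfolding bilinear_def
    by (auto intro!: linearI simp: vec_eq_iff matrix_mult_nth algebra_simps sum.distrib scaleR_sum_right)
  then show ?thesis by (simp add: bilinear_conv_bounded_bilinear)
qed

lemma bounded_linear_conj_transpose:
  "bounded_linear (conj_transpose :: ('a::rc_field, 'm::finite, 'n::finite) matrix \<Rightarrow> _)"
  by (intro linear_conv_bounded_linear[THEN iffD1] linearI)
     (simp_all add: conj_transpose_add conj_transpose_scaleR)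

lemma compact_unitary_matrices:
  "compact {U :: ('a::rc_field, 'm::finite, 'm) matrix. unitary_matrix U}"
proof -
  have ct: "continuous_on UNIV (\<lambda>U :: ('a, 'm, 'm) matrix. conj_transpose U)"
    using bounded_linear_conj_transpose linear_continuous_on by blast
  have "closed {U :: ('a, 'm, 'm) matrix. unitary_matrix U}"
    unfolding unitary_matrix_def
    by (intro closed_Collect_conj closed_Collect_eq
          bounded_bilinear.continuous_on[OF bounded_bilinear_matrix_mult] ct continuous_intros)
  moreover have "norm U \<le> norm (mat 1 :: ('a, 'm, 'm) matrix)" if "unitary_matrix U" for U :: "('a, 'm, 'm) matrix"
    using norm_unitary_left[OF that, of "mat 1"] by simp
  then have "bounded {U :: ('a, 'm, 'm) matrix. unitary_matrix U}"
    by (auto simp: bounded_iff)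
  ultimately show ?thesis by (simp add: compact_eq_bounded_closed)
qed

section \<open>A signed version of Birkhoff's theorem\<close>

text \<open>
Gaussian elimination: an equation with a nonzero coefficient at \<open>f0\<close> is solved for that unknown, and one equation
and one unknown disappear.
\<close>

lemma homogeneous_system_nontrivial:
  fixes c :: "'e \<Rightarrow> 'f \<Rightarrow> real"
  assumes "finite E" "finite F" "card E < card F"
  shows "\<exists>D. (\<exists>f\<in>F. D f \<noteq> 0) \<and> (\<forall>f. f \<notin> F \<longrightarrow> D f = 0) \<and> (\<forall>e\<in>E. (\<Sum>f\<in>F. c e f * D f) = 0)"
  using assms
proof (induction E arbitrary: F c rule: finite_induct)
  case empty
  then obtain f where "f \<in> F" by fastforce
  then show ?case by (intro exI[of _ "\<lambda>x. if x = f then 1 else 0"]) auto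
next
  case (insert e E)
  show ?case
  proof (cases "\<forall>f\<in>F. c e f = 0")
    case True
    obtain D where "\<exists>f\<in>F. D f \<noteq> 0" "\<forall>f. f \<notin> F \<longrightarrow> D f = 0" "\<forall>e\<in>E. (\<Sum>f\<in>F. c e f * D f) = 0"
      using insert.IH[of F c] insert.prems insert.hyps by fastforce
    with True show ?thesis by (intro exI[of _ D]) auto
  next
    case False
    then obtain f0 where f0: "f0 \<in> F" "c e f0 \<noteq> 0" by blast
    define F' where "F' = F - {f0}"
    define c' where "c' = (\<lambda>e' f. c e' f - c e' f0 * c e f / c e f0)"
    have F': "finite F'" "f0 \<notin> F'" "F = insert f0 F'" using f0 insert.prems by (auto simp: F'_def)
    then have "card E < card F'" using insert.prems insert.hyps by simp
    then obtain D where D: "\<exists>f\<in>F'. D f \<noteq> 0" "\<forall>f. f \<notin> F' \<longrightarrow> D f = 0" "\<forall>e'\<in>E. (\<Sum>f\<in>F'. c' e' f * D f) = 0"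
      using insert.IH[of F' c'] F' by blast
    define D' where "D' = D(f0 := - (\<Sum>f\<in>F'. c e f * D f) / c e f0)"
    have sumF: "(\<Sum>f\<in>F. c e' f * D' f) = c e' f0 * D' f0 + (\<Sum>f\<in>F'. c e' f * D f)" for e'
    proof -
      have "(\<Sum>f\<in>F'. c e' f * D' f) = (\<Sum>f\<in>F'. c e' f * D f)"
        using F'(2) by (intro sum.cong) (auto simp: D'_def)
      then show ?thesis using F' by simp
    qed
    have "(\<Sum>f\<in>F. c e' f * D' f) = (\<Sum>f\<in>F'. c' e' f * D f)" for e'
      unfolding sumF c'_def using f0
      by (simp add: D'_def left_diff_distrib sum_subtractf sum_distrib_left sum_divide_distrib mult.assoc)
    moreover have "(\<Sum>f\<in>F. c e f * D' f) = 0"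
      unfolding sumF using f0 by (simp add: D'_def)
    moreover have "\<exists>f\<in>F. D' f \<noteq> 0" using D(1) F' by (auto simp: D'_def)
    moreover have "\<forall>f. f \<notin> F \<longrightarrow> D' f = 0" using D(2) F' by (auto simp: D'_def)
    ultimately show ?thesis using D(3) by (intro exI[of _ D']) auto
  qed
qed

lemma small_scaling:
  fixes a b :: "'x \<Rightarrow> real"
  assumes "finite A" "\<And>x. x \<in> A \<Longrightarrow> 0 < b x"
  shows "\<exists>\<epsilon>>0. \<forall>x\<in>A. \<epsilon> * \<bar>a x\<bar> \<le> b x"
proof -
  define s where "s = 1 + (\<Sum>x\<in>A. \<bar>a x\<bar> / b x)"
  have nn: "0 \<le> \<bar>a x\<bar> / b x" if "x \<in> A" for x using assms(2)[OF that] by simp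
  have s: "s > 0" using sum_nonneg[of A "\<lambda>x. \<bar>a x\<bar> / b x"] nn by (simp add: s_def)
  have "inverse s * \<bar>a x\<bar> \<le> b x" if x: "x \<in> A" for x
  proof -
    have "\<bar>a x\<bar> / b x \<le> s"
      using member_le_sum[of x A "\<lambda>x. \<bar>a x\<bar> / b x"] assms(1) x nn by (simp add: s_def)
    then show ?thesis using assms(2)[OF x] s by (simp add: field_simps)
  qed
  with s show ?thesis by (intro exI[of _ "inverse s"]) auto
qed

text \<open>
If all the other entries are integers, their absolute values leave only \<open>0\<close> or \<open>1\<close> for \<open>\<bar>a j0\<bar>\<close>.
\<close>

lemma tight_line_two_fractional:
  fixes a :: "'k::finite \<Rightarrow> real"
  assumes "(\<Sum>j\<in>UNIV. \<bar>a j\<bar>) = 1" "a j0 \<notin> {-1, 0, 1}"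
  shows "2 \<le> card {j. a j \<notin> {-1, 0, 1}}"
proof (rule ccontr)
  assume "\<not> 2 \<le> card {j. a j \<notin> {-1, 0, 1}}"
  then have "card {j. a j \<notin> {-1, 0, 1}} \<le> Suc 0" by simp
  then have only: "a k \<in> {-1, 0, 1}" if "k \<noteq> j0" for k
    using that assms(2) by (subst (asm) card_le_Suc0_iff_eq) auto
  show False
  proof (cases "\<exists>k. k \<noteq> j0 \<and> a k \<noteq> 0")
    case True
    then obtain k where k: "k \<noteq> j0" "a k \<noteq> 0" by blast
    have "\<bar>a k\<bar> + \<bar>a j0\<bar> = (\<Sum>j\<in>{k, j0}. \<bar>a j\<bar>)" using k by simp
    also have "\<dots> \<le> (\<Sum>j\<in>UNIV. \<bar>a j\<bar>)" by (rule sum_mono2) auto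
    finally show False using only[OF k(1)] k assms by auto
  next
    case False
    then have "(\<Sum>j\<in>UNIV. \<bar>a j\<bar>) = (\<Sum>j\<in>{j0}. \<bar>a j\<bar>)" by (intro sum.mono_neutral_right) auto
    with assms show False by auto
  qed
qed

text \<open>
Double counting. The case of equality leaves no room for elements of \<open>F\<close> outside the fibres over \<open>I\<close>.
\<close>

lemma fibres_card_ge_2:
  assumes "finite F" "finite I" "\<And>i. i \<in> I \<Longrightarrow> 2 \<le> card {f \<in> F. p f = i}"
  shows "2 * card I \<le> card F" "2 * card I = card F \<Longrightarrow> p ` F \<subseteq> I"
proof -
  have eq: "(\<Sum>i\<in>I. card {f \<in> F. p f = i}) = card {f \<in> F. p f \<in> I}"
  proof -
    have "(\<Sum>i\<in>I. sum (\<lambda>_. 1::nat) {x \<in> {f \<in> F. p f \<in> I}. p x = i}) = sum (\<lambda>_. 1) {f \<in> F. p f \<in> I}"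
      by (rule sum.group) (use assms in auto)
    moreover have "{x \<in> {f \<in> F. p f \<in> I}. p x = i} = {f \<in> F. p f = i}" if "i \<in> I" for i using that by auto
    ultimately show ?thesis by simp
  qed
  have "2 * card I \<le> (\<Sum>i\<in>I. card {f \<in> F. p f = i})"
    using sum_mono[of I "\<lambda>_. 2" "\<lambda>i. card {f \<in> F. p f = i}"] assms(3) by simp
  with eq have le: "2 * card I \<le> card {f \<in> F. p f \<in> I}" by simp
  have le': "card {f \<in> F. p f \<in> I} \<le> card F" using assms(1) by (intro card_mono) auto
  from le le' show "2 * card I \<le> card F" by simp
  assume "2 * card I = card F"
  with le le' have "card {f \<in> F. p f \<in> I} = card F" by simp
  then have "{f \<in> F. p f \<in> I} = F" using assms(1) by (intro card_subset_eq) auto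
  then show "p ` F \<subseteq> I" by auto
qed

text \<open>
This provides the direction in which a matrix that has fractional entries can be moved: \<open>F\<close> is the set of positions of
these entries, and \<open>I\<close> and \<open>J\<close> are the lines whose sums must not change. There are at most as many equations as unknowns.
If there are equally many, every element of \<open>F\<close> lies on two of the given lines; then the row sums and the column sums
have the same total, so that one equation follows from the others and can be dropped.
\<close>

lemma fibre_sums_kernel:
  assumes fin: "finite F" "finite I" "finite J" and ne: "F \<noteq> {}"
    and I: "\<And>i. i \<in> I \<Longrightarrow> 2 \<le> card {f \<in> F. p f = i}"
    and J: "\<And>j. j \<in> J \<Longrightarrow> 2 \<le> card {f \<in> F. q f = j}"
  shows "\<exists>D :: 'f \<Rightarrow> real. (\<exists>f\<in>F. D f \<noteq> 0) \<and> (\<forall>f. f \<notin> F \<longrightarrow> D f = 0) \<and>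
           (\<forall>i\<in>I. sum D {f \<in> F. p f = i} = 0) \<and> (\<forall>j\<in>J. sum D {f \<in> F. q f = j} = 0)"
proof -
  define c :: "'a + 'b \<Rightarrow> 'f \<Rightarrow> real" where
    "c = (\<lambda>e f. case e of Inl i \<Rightarrow> if p f = i then 1 else 0 | Inr j \<Rightarrow> if q f = j then 1 else 0)"
  have c: "(\<Sum>f\<in>F. c (Inl i) f * D f) = sum D {f \<in> F. p f = i}"
          "(\<Sum>f\<in>F. c (Inr j) f * D f) = sum D {f \<in> F. q f = j}" for i j D
    using fin(1) by (auto simp: c_def sum.inter_filter intro!: sum.cong)
  note cI = fibres_card_ge_2[OF fin(1,2) I] and cJ = fibres_card_ge_2[OF fin(1,3) J]
  have cle: "card I + card J \<le> card F" using cI(1) cJ(1) by linarith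
  have cardE: "card (Inl ` I' \<union> Inr ` J :: ('a + 'b) set) = card I' + card J" if "finite I'" for I'
    using that fin by (subst card_Un_disjoint) (auto simp: card_image)
  show ?thesis
  proof (cases "card I + card J < card F")
    case True
    then obtain D where D: "\<exists>f\<in>F. D f \<noteq> 0" "\<forall>f. f \<notin> F \<longrightarrow> D f = 0"
        "\<forall>e\<in>Inl ` I \<union> Inr ` J. (\<Sum>f\<in>F. c e f * D f) = 0"
      using homogeneous_system_nontrivial[of "Inl ` I \<union> Inr ` J" F c] fin cardE[of I] by auto
    have "\<forall>i\<in>I. sum D {f \<in> F. p f = i} = 0" "\<forall>j\<in>J. sum D {f \<in> F. q f = j} = 0"
      using D(3) by (force simp flip: c)+
    with D(1,2) show ?thesis by blast
  next
    case False
    then have eq: "card I + card J = card F" using cle by simp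
    have sub: "p ` F \<subseteq> I" "q ` F \<subseteq> J" using cI cJ eq by linarith+
    obtain i0 where i0: "i0 \<in> I" using ne sub by auto
    \<comment> \<open>The equation of row \<open>i0\<close> is recovered below from the equality of the two totals.\<close>
    have "card (I - {i0}) + card J < card F" using eq i0 fin
      by (metis add_less_le_mono card_Diff1_less le_refl)
    then obtain D where D: "\<exists>f\<in>F. D f \<noteq> 0" "\<forall>f. f \<notin> F \<longrightarrow> D f = 0"
        and D0: "\<forall>e\<in>Inl ` (I - {i0}) \<union> Inr ` J. (\<Sum>f\<in>F. c e f * D f) = 0"
      using homogeneous_system_nontrivial[of "Inl ` (I - {i0}) \<union> Inr ` J" F c] fin cardE[of "I - {i0}"] by auto
    have DI: "\<forall>i\<in>I - {i0}. sum D {f \<in> F. p f = i} = 0" and DJ: "\<forall>j\<in>J. sum D {f \<in> F. q f = j} = 0"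
      using D0 by (force simp flip: c)+
    have "sum D F = (\<Sum>j\<in>J. sum D {f \<in> F. q f = j})" by (rule sum.group[OF fin(1,3) sub(2), symmetric])
    then have "sum D F = 0" using DJ by simp
    moreover have "sum D F = (\<Sum>i\<in>I. sum D {f \<in> F. p f = i})" by (rule sum.group[OF fin(1,2) sub(1), symmetric])
    moreover have "\<dots> = sum D {f \<in> F. p f = i0} + (\<Sum>i\<in>I - {i0}. sum D {f \<in> F. p f = i})"
      using fin i0 by (simp add: sum.remove)
    ultimately have "sum D {f \<in> F. p f = i0} = 0" using DI by simp
    with D DI DJ show ?thesis by blast
  qed
qed

text \<open>
The polytope whose vertices are the signed permutation matrices.
\<close>

definition abs_substochastic :: "(real, 'm::finite, 'm) matrix set" where
  "abs_substochastic = {R. (\<forall>i. (\<Sum>j\<in>UNIV. \<bar>R $ i $ j\<bar>) \<le> 1) \<and> (\<forall>j. (\<Sum>i\<in>UNIV. \<bar>R $ i $ j\<bar>) \<le> 1)}"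

lemma extreme_point_no_perturbation:
  assumes "x extreme_point_of S" "x + d \<in> S" "x - d \<in> S" shows "d = 0"
proof (rule ccontr)
  assume d: "d \<noteq> 0"
  have "x = midpoint (x + d) (x - d)" by (simp add: midpoint_def flip: scaleR_2)
  moreover have "x + d \<noteq> x - d"
  proof
    assume "x + d = x - d"
    then have "2 *\<^sub>R d = 0" by (simp add: scaleR_2 algebra_simps eq_neg_iff_add_eq_0)
    with d show False by simp
  qed
  ultimately have "x \<in> open_segment (x + d) (x - d)" by (metis midpoint_in_open_segment)
  with assms show False by (auto simp: extreme_point_of_def)
qed

text \<open>
Otherwise the fractional entries can be moved in both directions. Multiplying the kernel vector \<open>D\<close> by the signs of the
entries makes the absolute values change linearly by \<open>\<plusminus> e D\<close> as long as no entry passes through \<open>0\<close>; a small step also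
respects the lines whose absolute sum is less than \<open>1\<close>, and on the other lines \<open>D\<close> sums to \<open>0\<close>.
\<close>

lemma extreme_abs_substochastic_entries:
  fixes R :: "(real, 'm::finite, 'm) matrix"
  assumes ext: "R extreme_point_of abs_substochastic"
  shows "R $ i $ j \<in> {-1, 0, 1}"
proof (rule ccontr)
  assume ij: "R $ i $ j \<notin> {-1, 0, 1}"
  define F where "F = {(i, j). R $ i $ j \<notin> {-1, 0, 1}}"
  define I where "I = {i. (\<Sum>j\<in>UNIV. \<bar>R $ i $ j\<bar>) = 1 \<and> (\<exists>j. (i, j) \<in> F)}"
  define J where "J = {j. (\<Sum>i\<in>UNIV. \<bar>R $ i $ j\<bar>) = 1 \<and> (\<exists>i. (i, j) \<in> F)}"
  have R: "(\<Sum>j\<in>UNIV. \<bar>R $ i $ j\<bar>) \<le> 1" "(\<Sum>i\<in>UNIV. \<bar>R $ i $ j\<bar>) \<le> 1" for i j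
    using ext by (auto simp: extreme_point_of_def abs_substochastic_def)
  have "2 \<le> card {f \<in> F. fst f = i}" if "i \<in> I" for i
  proof -
    have "{f \<in> F. fst f = i} = Pair i ` {j. R $ i $ j \<notin> {-1, 0, 1}}" by (auto simp: F_def)
    then have "card {f \<in> F. fst f = i} = card {j. R $ i $ j \<notin> {-1, 0, 1}}"
      by (simp add: card_image inj_on_def)
    then show ?thesis using that tight_line_two_fractional[of "\<lambda>j. R $ i $ j"]
      by (auto simp: I_def F_def)
  qed
  moreover have "2 \<le> card {f \<in> F. snd f = j}" if "j \<in> J" for j
  proof -
    have "{f \<in> F. snd f = j} = (\<lambda>i. (i, j)) ` {i. R $ i $ j \<notin> {-1, 0, 1}}" by (auto simp: F_def)
    then have "card {f \<in> F. snd f = j} = card {i. R $ i $ j \<notin> {-1, 0, 1}}"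
      by (simp add: card_image inj_on_def)
    then show ?thesis using that tight_line_two_fractional[of "\<lambda>i. R $ i $ j"]
      by (auto simp: J_def F_def)
  qed
  moreover have "F \<noteq> {}" using ij by (auto simp: F_def)
  ultimately obtain D :: "'m \<times> 'm \<Rightarrow> real" where D: "\<exists>f\<in>F. D f \<noteq> 0" "\<forall>f. f \<notin> F \<longrightarrow> D f = 0"
      "\<forall>i\<in>I. sum D {f \<in> F. fst f = i} = 0" "\<forall>j\<in>J. sum D {f \<in> F. snd f = j} = 0"
    using fibre_sums_kernel[of F I J fst snd] by auto
  have row: "(\<Sum>j\<in>UNIV. D (i, j)) = sum D {f \<in> F. fst f = i}" for i
  proof -
    have "sum D {f \<in> F. fst f = i} = sum D (Pair i ` UNIV)"
      using D(2) by (intro sum.mono_neutral_left) auto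
    then show ?thesis by (simp add: sum.reindex inj_on_def)
  qed
  have col: "(\<Sum>i\<in>UNIV. D (i, j)) = sum D {f \<in> F. snd f = j}" for j
  proof -
    have "sum D {f \<in> F. snd f = j} = sum D ((\<lambda>i. (i, j)) ` UNIV)"
      using D(2) by (intro sum.mono_neutral_left) auto
    then show ?thesis by (simp add: sum.reindex inj_on_def)
  qed
  have row0: "(\<Sum>j\<in>UNIV. D (i, j)) = 0" if "(\<Sum>j\<in>UNIV. \<bar>R $ i $ j\<bar>) = 1" for i
  proof (cases "i \<in> I")
    case True then show ?thesis using D(3) row by simp
  next
    case False
    then have "\<forall>j. D (i, j) = 0" using that D(2) by (auto simp: I_def)
    then show ?thesis by simp
  qed
  have col0: "(\<Sum>i\<in>UNIV. D (i, j)) = 0" if "(\<Sum>i\<in>UNIV. \<bar>R $ i $ j\<bar>) = 1" for j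
  proof (cases "j \<in> J")
    case True then show ?thesis using D(4) col by simp
  next
    case False
    then have "\<forall>i. D (i, j) = 0" using that D(2) by (auto simp: J_def)
    then show ?thesis by simp
  qed
  obtain e1 where e1: "e1 > 0" "\<forall>f\<in>F. e1 * \<bar>D f\<bar> \<le> \<bar>R $ fst f $ snd f\<bar>"
    using small_scaling[of F "\<lambda>f. \<bar>R $ fst f $ snd f\<bar>" D] by (auto simp: F_def)
  obtain e2 where e2: "e2 > 0" "\<forall>i\<in>{i. (\<Sum>j\<in>UNIV. \<bar>R $ i $ j\<bar>) < 1}. e2 * \<bar>\<Sum>j\<in>UNIV. D (i, j)\<bar> \<le> 1 - (\<Sum>j\<in>UNIV. \<bar>R $ i $ j\<bar>)"
    using small_scaling[of "{i. (\<Sum>j\<in>UNIV. \<bar>R $ i $ j\<bar>) < 1}" "\<lambda>i. 1 - (\<Sum>j\<in>UNIV. \<bar>R $ i $ j\<bar>)" "\<lambda>i. \<Sum>j\<in>UNIV. D (i, j)"] by auto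
  obtain e3 where e3: "e3 > 0" "\<forall>j\<in>{j. (\<Sum>i\<in>UNIV. \<bar>R $ i $ j\<bar>) < 1}. e3 * \<bar>\<Sum>i\<in>UNIV. D (i, j)\<bar> \<le> 1 - (\<Sum>i\<in>UNIV. \<bar>R $ i $ j\<bar>)"
    using small_scaling[of "{j. (\<Sum>i\<in>UNIV. \<bar>R $ i $ j\<bar>) < 1}" "\<lambda>j. 1 - (\<Sum>i\<in>UNIV. \<bar>R $ i $ j\<bar>)" "\<lambda>j. \<Sum>i\<in>UNIV. D (i, j)"] by auto
  \<comment> \<open>Small enough for the signs of the entries, for the slack rows and for the slack columns.\<close>
  define e where "e = min e1 (min e2 e3)"
  have e: "e > 0" using e1 e2 e3 by (simp add: e_def)
  have mono: "e * \<bar>x\<bar> \<le> y" if "e' * \<bar>x\<bar> \<le> y" "e \<le> e'" for e' x y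
    using that mult_right_mono[of e e' "\<bar>x\<bar>"] by linarith
  define M :: "(real, 'm, 'm) matrix" where "M = (\<chi> i j. e * (sgn (R $ i $ j) * D (i, j)))"
  have entry: "\<bar>R $ i $ j + s * (e * (sgn (R $ i $ j) * D (i, j)))\<bar> = \<bar>R $ i $ j\<bar> + s * (e * D (i, j))"
    if "s = 1 \<or> s = -1" for s i j
  proof (cases "(i, j) \<in> F")
    case True
    have "e * \<bar>D (i, j)\<bar> \<le> \<bar>R $ i $ j\<bar>"
      using mono[of e1 "D (i, j)"] e1 True by (auto simp: e_def)
    then have "\<bar>e * D (i, j)\<bar> \<le> \<bar>R $ i $ j\<bar>" using e by (simp add: abs_mult)
    then show ?thesis using that by (cases "R $ i $ j" "0::real" rule: linorder_cases) auto
  next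
    case False then show ?thesis using D(2) by simp
  qed
  have mem: "R + s *\<^sub>R M \<in> abs_substochastic" if s: "s = 1 \<or> s = -1" for s
    unfolding abs_substochastic_def
  proof (intro CollectI conjI allI)
    fix i
    have "(\<Sum>j\<in>UNIV. \<bar>(R + s *\<^sub>R M) $ i $ j\<bar>) = (\<Sum>j\<in>UNIV. \<bar>R $ i $ j\<bar>) + s * (e * (\<Sum>j\<in>UNIV. D (i, j)))"
      by (simp add: M_def entry[OF s] sum.distrib sum_distrib_left)
    also have "\<dots> \<le> 1"
    proof (cases "(\<Sum>j\<in>UNIV. \<bar>R $ i $ j\<bar>) = 1")
      case True then show ?thesis using row0 by simp
    next
      case False
      then have "(\<Sum>j\<in>UNIV. \<bar>R $ i $ j\<bar>) < 1" using R(1)[of i] by simp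
      then have "e * \<bar>\<Sum>j\<in>UNIV. D (i, j)\<bar> \<le> 1 - (\<Sum>j\<in>UNIV. \<bar>R $ i $ j\<bar>)"
        using mono[of e2] e2 by (auto simp: e_def)
      moreover have "s * (e * (\<Sum>j\<in>UNIV. D (i, j))) \<le> e * \<bar>\<Sum>j\<in>UNIV. D (i, j)\<bar>"
        using s e by (auto simp: abs_if mult_le_0_iff zero_le_mult_iff)
      ultimately show ?thesis by linarith
    qed
    finally show "(\<Sum>j\<in>UNIV. \<bar>(R + s *\<^sub>R M) $ i $ j\<bar>) \<le> 1" .
  next
    fix j
    have "(\<Sum>i\<in>UNIV. \<bar>(R + s *\<^sub>R M) $ i $ j\<bar>) = (\<Sum>i\<in>UNIV. \<bar>R $ i $ j\<bar>) + s * (e * (\<Sum>i\<in>UNIV. D (i, j)))"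
      by (simp add: M_def entry[OF s] sum.distrib sum_distrib_left)
    also have "\<dots> \<le> 1"
    proof (cases "(\<Sum>i\<in>UNIV. \<bar>R $ i $ j\<bar>) = 1")
      case True then show ?thesis using col0 by simp
    next
      case False
      then have "(\<Sum>i\<in>UNIV. \<bar>R $ i $ j\<bar>) < 1" using R(2)[of j] by simp
      then have "e * \<bar>\<Sum>i\<in>UNIV. D (i, j)\<bar> \<le> 1 - (\<Sum>i\<in>UNIV. \<bar>R $ i $ j\<bar>)"
        using mono[of e3] e3 by (auto simp: e_def)
      moreover have "s * (e * (\<Sum>i\<in>UNIV. D (i, j))) \<le> e * \<bar>\<Sum>i\<in>UNIV. D (i, j)\<bar>"
        using s e by (auto simp: abs_if mult_le_0_iff zero_le_mult_iff)
      ultimately show ?thesis by linarith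
    qed
    finally show "(\<Sum>i\<in>UNIV. \<bar>(R + s *\<^sub>R M) $ i $ j\<bar>) \<le> 1" .
  qed
  have "M = 0" using extreme_point_no_perturbation[OF ext, of M] mem[of 1] mem[of "-1"] by simp
  moreover obtain i' j' where "(i', j') \<in> F" "D (i', j') \<noteq> 0" using D(1) by auto
  ultimately show False
    using e by (auto simp: M_def vec_eq_iff F_def sgn_if split: if_splits)
qed

text \<open>
If every column is met by \<open>P\<close> and no row is met twice, choosing a row for each column is injective, hence
surjective by finiteness.
\<close>

lemma at_most_one_per_line:
  fixes P :: "'m::finite \<Rightarrow> 'm \<Rightarrow> bool"
  assumes "\<And>i j j'. P i j \<Longrightarrow> P i j' \<Longrightarrow> j = j'" and "\<And>j. \<exists>i. P i j"
  shows "\<exists>j. P i j"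
proof -
  obtain h where h: "\<And>j. P (h j) j" using assms(2) by metis
  have "inj h" using h assms(1) by (metis injI)
  then have "surj h" by (simp add: finite_UNIV_inj_surj)
  then show ?thesis using h by (metis surj_def)
qed

text \<open>
Entries in \<open>{-1, 0, 1}\<close> with absolute line sums at most \<open>1\<close> leave at most one nonzero entry on each line. A zero row
forces a zero column and conversely, and the entry where they cross could be moved freely.
\<close>

lemma extreme_abs_substochastic:
  fixes R :: "(real, 'm::finite, 'm) matrix"
  assumes ext: "R extreme_point_of abs_substochastic"
  shows "signed_permutation_matrix R"
proof -
  have R: "(\<Sum>j\<in>UNIV. \<bar>R $ i $ j\<bar>) \<le> 1" "(\<Sum>i\<in>UNIV. \<bar>R $ i $ j\<bar>) \<le> 1" for i j
    using ext by (auto simp: extreme_point_of_def abs_substochastic_def)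
  have ent: "R $ i $ j = -1 \<or> R $ i $ j = 0 \<or> R $ i $ j = 1" for i j
    using extreme_abs_substochastic_entries[OF ext, of i j] by auto
  have row1: "j = j'" if "R $ i $ j \<noteq> 0" "R $ i $ j' \<noteq> 0" for i j j'
  proof (rule ccontr)
    assume "j \<noteq> j'"
    then have "\<bar>R $ i $ j\<bar> + \<bar>R $ i $ j'\<bar> = (\<Sum>k\<in>{j, j'}. \<bar>R $ i $ k\<bar>)" by simp
    also have "\<dots> \<le> (\<Sum>k\<in>UNIV. \<bar>R $ i $ k\<bar>)" by (rule sum_mono2) auto
    finally show False using that R(1)[of i] ent[of i j] ent[of i j'] by auto
  qed
  have col1: "i = i'" if "R $ i $ j \<noteq> 0" "R $ i' $ j \<noteq> 0" for i i' j
  proof (rule ccontr)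
    assume "i \<noteq> i'"
    then have "\<bar>R $ i $ j\<bar> + \<bar>R $ i' $ j\<bar> = (\<Sum>k\<in>{i, i'}. \<bar>R $ k $ j\<bar>)" by simp
    also have "\<dots> \<le> (\<Sum>k\<in>UNIV. \<bar>R $ k $ j\<bar>)" by (rule sum_mono2) auto
    finally show False using that R(2)[of j] ent[of i j] ent[of i' j] by auto
  qed
  have nz: "\<not> ((\<forall>j. R $ i0 $ j = 0) \<and> (\<forall>i. R $ i $ j0 = 0))" for i0 j0
  proof
    assume z: "(\<forall>j. R $ i0 $ j = 0) \<and> (\<forall>i. R $ i $ j0 = 0)"
    define M :: "(real, 'm, 'm) matrix" where "M = (\<chi> i j. if i = i0 \<and> j = j0 then 1 else 0)"
    have "R + s *\<^sub>R M \<in> abs_substochastic" if s: "s = 1 \<or> s = -1" for s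
    proof -
      have "(\<Sum>j\<in>UNIV. \<bar>(R + s *\<^sub>R M) $ i $ j\<bar>) \<le> 1" for i
      proof (cases "i = i0")
        case True
        then have "(\<Sum>j\<in>UNIV. \<bar>(R + s *\<^sub>R M) $ i $ j\<bar>) = (\<Sum>j\<in>UNIV. if j = j0 then 1 else 0)"
          using s z by (intro sum.cong) (auto simp: M_def)
        then show ?thesis by simp
      qed (use R(1)[of i] in \<open>simp add: M_def\<close>)
      moreover have "(\<Sum>i\<in>UNIV. \<bar>(R + s *\<^sub>R M) $ i $ j\<bar>) \<le> 1" for j
      proof (cases "j = j0")
        case True
        then have "(\<Sum>i\<in>UNIV. \<bar>(R + s *\<^sub>R M) $ i $ j\<bar>) = (\<Sum>i\<in>UNIV. if i = i0 then 1 else 0)"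
          using s z by (intro sum.cong) (auto simp: M_def)
        then show ?thesis by simp
      qed (use R(2)[of j] in \<open>simp add: M_def\<close>)
      ultimately show ?thesis by (simp add: abs_substochastic_def)
    qed
    from this[of 1] this[of "-1"] have "M = 0"
      using extreme_point_no_perturbation[OF ext, of M] by simp
    then have "M $ i0 $ j0 = 0" by simp
    then show False by (simp add: M_def)
  qed
  have "(\<forall>i. \<exists>j. R $ i $ j \<noteq> 0) \<longleftrightarrow> (\<forall>j. \<exists>i. R $ i $ j \<noteq> 0)"
    using at_most_one_per_line[of "\<lambda>i j. R $ i $ j \<noteq> 0"] at_most_one_per_line[of "\<lambda>j i. R $ i $ j \<noteq> 0"]
      row1 col1 by blast
  with nz have "\<forall>i. \<exists>j. R $ i $ j \<noteq> 0" "\<forall>j. \<exists>i. R $ i $ j \<noteq> 0" by metis+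
  then show ?thesis unfolding signed_permutation_matrix_def
    using row1 col1 ent by (intro conjI allI ex_ex1I) blast+
qed

lemma compact_abs_substochastic: "compact (abs_substochastic :: (real, 'm::finite, 'm) matrix set)"
proof -
  have "closed (abs_substochastic :: (real, 'm, 'm) matrix set)"
    unfolding abs_substochastic_def
    by (intro closed_Collect_conj closed_Collect_all closed_Collect_le continuous_intros)
  moreover have "bounded (abs_substochastic :: (real, 'm, 'm) matrix set)"
    unfolding bounded_iff
  proof (intro exI ballI)
    fix R :: "(real, 'm, 'm) matrix" assume "R \<in> abs_substochastic"
    have "norm R \<le> (\<Sum>i\<in>UNIV. norm (R $ i))" by (simp add: norm_vec_def L2_set_le_sum)
    also have "\<dots> \<le> (\<Sum>i\<in>(UNIV::'m set). 1)"
    proof (rule sum_mono)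
      fix i
      have "norm (R $ i) \<le> (\<Sum>j\<in>UNIV. \<bar>R $ i $ j\<bar>)" using L2_set_le_sum[of UNIV "\<lambda>j. norm (R $ i $ j)"] by (simp add: norm_vec_def)
      then show "norm (R $ i) \<le> 1" using \<open>R \<in> abs_substochastic\<close> order_trans by (fastforce simp: abs_substochastic_def)
    qed
    finally show "norm R \<le> (\<Sum>i\<in>(UNIV::'m set). 1)" .
  qed
  ultimately show ?thesis by (simp add: compact_eq_bounded_closed)
qed

lemma convex_abs_substochastic: "convex (abs_substochastic :: (real, 'm::finite, 'm) matrix set)"
proof (rule convexI)
  fix A B :: "(real, 'm, 'm) matrix" and u v :: real
  assume A: "A \<in> abs_substochastic" and B: "B \<in> abs_substochastic" and uv: "0 \<le> u" "0 \<le> v" "u + v = 1"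
  have line: "(\<Sum>k\<in>UNIV. \<bar>u * a k + v * b k\<bar>) \<le> 1"
    if "(\<Sum>k\<in>UNIV. \<bar>a k\<bar>) \<le> 1" "(\<Sum>k\<in>UNIV. \<bar>b k\<bar>) \<le> 1" for a b :: "'m \<Rightarrow> real"
  proof -
    have "(\<Sum>k\<in>UNIV. \<bar>u * a k + v * b k\<bar>) \<le> (\<Sum>k\<in>UNIV. u * \<bar>a k\<bar> + v * \<bar>b k\<bar>)"
      using uv by (intro sum_mono order_trans[OF abs_triangle_ineq]) (simp add: abs_mult)
    also have "\<dots> = u * (\<Sum>k\<in>UNIV. \<bar>a k\<bar>) + v * (\<Sum>k\<in>UNIV. \<bar>b k\<bar>)"
      by (simp add: sum.distrib sum_distrib_left)
    also have "\<dots> \<le> u * 1 + v * 1" using that uv by (intro add_mono mult_left_mono) auto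
    finally show ?thesis using uv by simp
  qed
  show "u *\<^sub>R A + v *\<^sub>R B \<in> abs_substochastic"
    using A B line by (simp add: abs_substochastic_def)
qed

text \<open>
Krein and Milman: a compact convex set is the hull of its extreme points.
\<close>

theorem abs_substochastic_in_hull:
  assumes "R \<in> abs_substochastic" shows "R \<in> convex hull {Q. signed_permutation_matrix Q}"
proof -
  have "R \<in> convex hull {R. R extreme_point_of abs_substochastic}"
    using Krein_Milman_Minkowski[OF compact_abs_substochastic convex_abs_substochastic] assms by blast
  also have "\<dots> \<subseteq> convex hull {Q. signed_permutation_matrix Q}"
    by (intro hull_mono) (auto intro: extreme_abs_substochastic)
  finally show ?thesis .
qed

section \<open>Signed permutations of coordinates\<close>

definition signed_perm :: "('m \<Rightarrow> 'm) \<Rightarrow> ('m \<Rightarrow> real) \<Rightarrow> (real, 'm::finite, 'm) matrix" where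
  "signed_perm \<pi> \<epsilon> = (\<chi> i j. if j = \<pi> i then \<epsilon> i else 0)"

lemma signed_perm_mult_vec [simp]: "(signed_perm \<pi> \<epsilon> *v x) $ i = \<epsilon> i * x $ \<pi> i"
proof -
  have "(signed_perm \<pi> \<epsilon> *v x) $ i = (\<Sum>j\<in>UNIV. if j = \<pi> i then \<epsilon> i * x $ j else 0)"
    by (simp only: signed_perm_def matrix_vector_mult_def vec_lambda_beta) (rule sum.cong, simp_all)
  then show ?thesis by simp
qed

lemma signed_permutation_matrix_signed_perm:
  fixes \<pi> :: "'m::finite \<Rightarrow> 'm"
  assumes "bij \<pi>" "\<And>i. \<epsilon> i = 1 \<or> \<epsilon> i = -1"
  shows "signed_permutation_matrix (signed_perm \<pi> \<epsilon>)"
proof -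
  have nz: "\<epsilon> i \<noteq> 0" for i using assms(2)[of i] by auto
  have "\<exists>!i. \<pi> i = j" for j using assms(1) by (simp add: bij_iff)
  with nz assms(2) show ?thesis
    unfolding signed_permutation_matrix_def signed_perm_def by (auto; metis)
qed

lemma signed_permutation_matrixE:
  fixes Q :: "(real, 'm::finite, 'm) matrix"
  assumes "signed_permutation_matrix Q"
  obtains \<pi> \<epsilon> where "bij \<pi>" "\<And>i. \<epsilon> i = 1 \<or> \<epsilon> i = -1" "Q = signed_perm \<pi> \<epsilon>"
proof -
  define \<pi> where "\<pi> i = (THE j. Q $ i $ j \<noteq> 0)" for i
  have row: "\<And>i. \<exists>!j. Q $ i $ j \<noteq> 0" and col: "\<And>j. \<exists>!i. Q $ i $ j \<noteq> 0"
    and val: "\<And>i j. Q $ i $ j \<noteq> 0 \<Longrightarrow> Q $ i $ j = 1 \<or> Q $ i $ j = - 1"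
    using assms unfolding signed_permutation_matrix_def by simp_all
  have \<pi>: "Q $ i $ \<pi> i \<noteq> 0" for i unfolding \<pi>_def using row[of i] by (rule theI')
  have \<pi>_iff: "Q $ i $ j \<noteq> 0 \<longleftrightarrow> j = \<pi> i" for i j using \<pi>[of i] row[of i] by blast
  have "bij \<pi>" unfolding bij_iff using col \<pi>_iff by metis
  moreover have "Q = signed_perm \<pi> (\<lambda>i. Q $ i $ \<pi> i)"
    using \<pi>_iff by (auto simp: signed_perm_def vec_eq_iff)
  ultimately show ?thesis using that[of \<pi> "\<lambda>i. Q $ i $ \<pi> i"] val \<pi> by blast
qed

lemma finite_signed_permutation_matrices:
  "finite {Q :: (real, 'm::finite, 'm) matrix. signed_permutation_matrix Q}"
proof -
  have "Q \<in> (\<lambda>(\<pi>, s). signed_perm \<pi> (\<lambda>i. if s i then 1 else -1)) ` (UNIV :: (('m \<Rightarrow> 'm) \<times> ('m \<Rightarrow> bool)) set)"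
    if "signed_permutation_matrix Q" for Q
    using that
  proof (rule signed_permutation_matrixE)
    fix \<pi> :: "'m \<Rightarrow> 'm" and \<epsilon> :: "'m \<Rightarrow> real"
    assume \<epsilon>: "\<And>i. \<epsilon> i = 1 \<or> \<epsilon> i = -1" and Q: "Q = signed_perm \<pi> \<epsilon>"
    have "\<epsilon> = (\<lambda>i. if \<epsilon> i = 1 then 1 else -1)" using \<epsilon> by (auto simp: fun_eq_iff)
    with Q show ?thesis by (intro image_eqI[of _ _ "(\<pi>, \<lambda>i. \<epsilon> i = 1)"]) auto
  qed
  then show ?thesis by (intro finite_subset[OF _ finite_imageI[OF finite]]) auto
qed

lemma norm_signed_permutation_mult:
  fixes Q :: "(real, 'm::finite, 'm) matrix"
  assumes "signed_permutation_matrix Q" shows "norm (Q *v x) = norm x"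
  using assms
proof (rule signed_permutation_matrixE)
  fix \<pi> :: "'m \<Rightarrow> 'm" and \<epsilon> :: "'m \<Rightarrow> real"
  assume \<pi>: "bij \<pi>" and \<epsilon>: "\<And>i. \<epsilon> i = 1 \<or> \<epsilon> i = -1" and Q: "Q = signed_perm \<pi> \<epsilon>"
  have "\<epsilon> i * y * (\<epsilon> i * y) = y * y" for i y using \<epsilon>[of i] by auto
  then have "inner (Q *v x) (Q *v x) = (\<Sum>i\<in>UNIV. x $ \<pi> i * x $ \<pi> i)"
    by (simp only: inner_vec_def Q signed_perm_mult_vec inner_real_def)
  also have "\<dots> = inner x x"
    using sum.reindex_bij_betw[OF \<pi>, of "\<lambda>i. x $ i * x $ i"] by (simp add: inner_vec_def)
  finally show ?thesis by (simp add: norm_eq_sqrt_inner)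
qed

lemma signed_permutation_matrix_inverse:
  fixes Q :: "(real, 'm::finite, 'm) matrix"
  assumes "signed_permutation_matrix Q"
  obtains Q' where "signed_permutation_matrix Q'" "\<And>x. Q' *v (Q *v x) = x" "\<And>x. Q *v (Q' *v x) = x"
  using assms
proof (rule signed_permutation_matrixE)
  fix \<pi> :: "'m \<Rightarrow> 'm" and \<epsilon> :: "'m \<Rightarrow> real"
  assume \<pi>: "bij \<pi>" and \<epsilon>: "\<And>i. \<epsilon> i = 1 \<or> \<epsilon> i = -1" and Q: "Q = signed_perm \<pi> \<epsilon>"
  have i: "\<pi> (inv \<pi> i) = i" "inv \<pi> (\<pi> i) = i" for i
    using \<pi> by (auto simp: bij_def surj_f_inv_f)
  have e: "\<epsilon> i * (\<epsilon> i * y) = y" for i y using \<epsilon>[of i] by auto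
  show ?thesis
  proof (rule that)
    show "signed_permutation_matrix (signed_perm (inv \<pi>) (\<lambda>i. \<epsilon> (inv \<pi> i)))"
      using \<pi> \<epsilon> by (intro signed_permutation_matrix_signed_perm) (auto intro: bij_imp_bij_inv)
    show "signed_perm (inv \<pi>) (\<lambda>i. \<epsilon> (inv \<pi> i)) *v (Q *v x) = x" for x
      by (simp add: vec_eq_iff Q i e)
    show "Q *v (signed_perm (inv \<pi>) (\<lambda>i. \<epsilon> (inv \<pi> i)) *v x) = x" for x
      by (simp add: vec_eq_iff Q i e)
  qed
qed

section \<open>Entries of unitary matrices\<close>

lemma unitary_row_norm:
  fixes U :: "('a::rc_field, 'm::finite, 'm) matrix"
  assumes "unitary_matrix U"
  shows "(\<Sum>j\<in>UNIV. (norm (U $ i $ j))\<^sup>2) = 1"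
proof -
  have "of_real (\<Sum>j\<in>UNIV. (norm (U $ i $ j))\<^sup>2) = (U ** conj_transpose U) $ i $ i"
    by (simp add: matrix_mult_nth mult.commute[of "U $ i $ _"] conjugate_mult_self)
  also have "\<dots> = of_real 1" using assms by (simp add: unitary_matrix_def mat_def)
  finally show ?thesis unfolding of_real_eq_iff .
qed

lemma unitary_col_norm:
  fixes U :: "('a::rc_field, 'm::finite, 'm) matrix"
  assumes "unitary_matrix U"
  shows "(\<Sum>i\<in>UNIV. (norm (U $ i $ j))\<^sup>2) = 1"
  using unitary_row_norm[of "conj_transpose U" j] assms by simp

lemma unitary_matrixI:
  assumes "\<And>i k. (\<Sum>j\<in>UNIV. U $ i $ j * conjugate (U $ k $ j)) = (if i = k then 1 else 0)"
  shows "unitary_matrix (U :: ('a::rc_field, 'm::finite, 'm) matrix)"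
proof -
  have "U ** conj_transpose U = mat 1"
    by (simp add: vec_eq_iff matrix_mult_nth mat_def assms)
  then show ?thesis unfolding unitary_matrix_def by (simp add: matrix_left_right_inverse)
qed

lemma unitary_monomial:
  fixes \<pi> :: "'m::finite \<Rightarrow> 'm" and \<epsilon> :: "'m \<Rightarrow> 'a::rc_field"
  assumes "inj \<pi>" "\<And>i. norm (\<epsilon> i) = 1"
  shows "unitary_matrix (\<chi> i j. if j = \<pi> i then \<epsilon> i else 0)"
proof (rule unitary_matrixI)
  fix i k
  have "(\<Sum>j\<in>UNIV. (if j = \<pi> i then \<epsilon> i else 0) * conjugate (if j = \<pi> k then \<epsilon> k else 0)) =
        (if \<pi> i = \<pi> k then \<epsilon> i * conjugate (\<epsilon> k) else 0)"
  proof -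
    have "(\<Sum>j\<in>UNIV. (if j = \<pi> i then \<epsilon> i else 0) * conjugate (if j = \<pi> k then \<epsilon> k else 0)) =
        (\<Sum>j\<in>UNIV. if j = \<pi> i then (if j = \<pi> k then \<epsilon> i * conjugate (\<epsilon> k) else 0) else 0)"
      by (intro sum.cong) auto
    then show ?thesis by simp
  qed
  also have "\<dots> = (if i = k then 1 else 0)"
    using assms conjugate_mult_self[of "\<epsilon> i"] by (auto simp: inj_eq mult.commute)
  finally show "(\<Sum>j\<in>UNIV. (\<chi> i j. if j = \<pi> i then \<epsilon> i else 0) $ i $ j *
      conjugate ((\<chi> i j. if j = \<pi> i then \<epsilon> i else 0) $ k $ j)) = (if i = k then 1 else 0)"
    by simp
qed

section \<open>Distances between diagonal decompositions\<close>

lemma index_pos_strict_mono: "i < j \<Longrightarrow> index_pos i < index_pos j" for i j :: "'i::{finite,linorder}"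
  unfolding index_pos_def by (rule psubset_card_mono) auto

lemma index_pos_eq_iff [simp]: "index_pos i = index_pos j \<longleftrightarrow> i = j" for i j :: "'i::{finite,linorder}"
  by (metis index_pos_strict_mono linorder_neqE less_irrefl)

lemma range_index_pos: "range (index_pos :: 'i::{finite,linorder} \<Rightarrow> nat) = {..<CARD('i)}"
proof (rule card_subset_eq)
  show "range (index_pos :: 'i \<Rightarrow> nat) \<subseteq> {..<CARD('i)}"
    unfolding index_pos_def by (auto intro!: psubset_card_mono)
  show "card (range (index_pos :: 'i \<Rightarrow> nat)) = card {..<CARD('i)}"
    by (simp add: card_image inj_def)
qed simp

text \<open>
The two type tokens give the locale access to the index types, which are all that its assumption speaks of.
\<close>

locale wide_shape =
  fixes rows :: "'m::{finite,linorder} itself" and cols :: "'n::{finite,linorder} itself"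
  assumes wide: "CARD('m) \<le> CARD('n)"
begin

definition diag_col :: "'m \<Rightarrow> 'n" where
  "diag_col i = (THE j. index_pos j = index_pos i)"

lemma index_pos_diag_col: "index_pos (diag_col i) = index_pos i"
proof -
  have "index_pos i \<in> range (index_pos :: 'n \<Rightarrow> nat)"
  proof -
    have "index_pos i \<in> {..<CARD('m)}" unfolding range_index_pos[symmetric] by (rule rangeI)
    then show ?thesis unfolding range_index_pos using wide by simp
  qed
  then obtain j :: 'n where j: "index_pos j = index_pos i" by auto
  have "\<exists>!j. index_pos (j :: 'n) = index_pos i" using j by (metis index_pos_eq_iff)
  then show ?thesis unfolding diag_col_def by (rule theI')
qed

lemma diag_col_eq_iff [simp]: "diag_col i = diag_col j \<longleftrightarrow> i = j"
  by (metis index_pos_diag_col index_pos_eq_iff)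

lemma inj_diag_col: "inj diag_col" by (simp add: inj_def)

lemma diag_zero_nth: "(diag_zero x :: ('a::real_normed_field, 'm, 'n) matrix) $ i $ j =
    (if j = diag_col i then of_real (x $ i) else 0)"
  by (simp add: diag_zero_def) (metis index_pos_diag_col index_pos_eq_iff)

abbreviation recompose ::
  "('a::rc_field, 'm, 'm) matrix \<Rightarrow> (real, 'm) vec \<Rightarrow> ('a, 'n, 'n) matrix \<Rightarrow> ('a, 'm, 'n) matrix" where
  "recompose U s V \<equiv> U ** diag_zero s ** conj_transpose V"

lemma recompose_nth:
  fixes U :: "('a::rc_field, 'm, 'm) matrix"
  shows "recompose U s V $ i $ k = (\<Sum>j\<in>UNIV. of_real (s $ j) * (U $ i $ j * conjugate (V $ k $ diag_col j)))"
proof -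
  have "recompose U s V $ i $ k = (\<Sum>l\<in>UNIV. \<Sum>j\<in>UNIV. U $ i $ j * (if l = diag_col j then of_real (s $ j) else 0) * conjugate (V $ k $ l))"
    by (simp add: matrix_mult_nth diag_zero_nth sum_distrib_right)
  also have "\<dots> = (\<Sum>j\<in>UNIV. \<Sum>l\<in>UNIV. U $ i $ j * (if l = diag_col j then of_real (s $ j) else 0) * conjugate (V $ k $ l))"
    by (rule sum.swap)
  also have "\<dots> = (\<Sum>j\<in>UNIV. \<Sum>l\<in>UNIV. if l = diag_col j then of_real (s $ j) * (U $ i $ j * conjugate (V $ k $ l)) else 0)"
    by (intro sum.cong) auto
  also have "\<dots> = (\<Sum>j\<in>UNIV. of_real (s $ j) * (U $ i $ j * conjugate (V $ k $ diag_col j)))" by simp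
  finally show ?thesis .
qed

lemma inner_diag_zero:
  fixes A :: "('a::rc_field, 'm, 'n) matrix"
  shows "inner (diag_zero a) A = (\<Sum>i\<in>UNIV. a $ i * inner 1 (A $ i $ diag_col i))"
proof -
  have "inner (diag_zero a) A = (\<Sum>i\<in>UNIV. \<Sum>j\<in>UNIV. if j = diag_col i then inner (of_real (a $ i)) (A $ i $ j) else 0)"
    unfolding inner_matrix_nth diag_zero_nth by (intro sum.cong) auto
  also have "\<dots> = (\<Sum>i\<in>UNIV. a $ i * inner 1 (A $ i $ diag_col i))"
    by (simp add: of_real_def)
  finally show ?thesis .
qed

lemma inner_diag_zero_diag_zero:
  "inner (diag_zero a :: ('a::rc_field, 'm, 'n) matrix) (diag_zero b) = inner a b"
proof -
  have "inner 1 (of_real r :: 'a) = r" for r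
    by (simp add: of_real_def flip: power2_norm_eq_inner)
  then show ?thesis unfolding inner_diag_zero diag_zero_nth by (simp add: inner_vec_def)
qed

lemma diag_zero_add: "diag_zero (a + b) = (diag_zero a + diag_zero b :: ('a::rc_field, 'm, 'n) matrix)"
  by (simp add: diag_zero_def vec_eq_iff)
lemma diag_zero_scaleR: "diag_zero (r *\<^sub>R a) = (r *\<^sub>R diag_zero a :: ('a::rc_field, 'm, 'n) matrix)"
  by (simp add: diag_zero_def vec_eq_iff of_real_def)

lemma linear_recompose: "linear (\<lambda>s. recompose U s V)" for U :: "('a::rc_field, 'm, 'm) matrix"
  by (rule linearI) (simp_all add: vec_eq_iff recompose_nth of_real_def scaleR_add_left distrib_right sum.distrib scaleR_sum_right)

lemmas recompose_add = linear_add[OF linear_recompose]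
lemmas recompose_diff = linear_diff[OF linear_recompose]
lemmas recompose_scaleR = linear_cmul[OF linear_recompose]

lemma inner_recompose:
  fixes U :: "('a::rc_field, 'm, 'm) matrix"
  assumes "unitary_matrix U" "unitary_matrix V"
  shows "inner (recompose U a V) (recompose U b V) = inner a b"
  using assms by (simp add: inner_unitary_left inner_unitary_right inner_diag_zero_diag_zero matrix_mul_assoc[symmetric])

lemma norm_recompose:
  fixes U :: "('a::rc_field, 'm, 'm) matrix"
  assumes "unitary_matrix U" "unitary_matrix V"
  shows "norm (recompose U a V) = norm a"
  using assms by (simp add: norm_eq_sqrt_inner inner_recompose)

text \<open>
The Gram matrix of the two families of diagonal positions: \<open>\<langle>U [a] V\<^sup>*, U' [b] V'\<^sup>*\<rangle> = \<langle>a, overlap (U\<^sup>* U') (V\<^sup>* V') b\<rangle>\<close>.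
\<close>

definition overlap :: "('a::rc_field, 'm, 'm) matrix \<Rightarrow> ('a, 'n, 'n) matrix \<Rightarrow> (real, 'm, 'm) matrix" where
  "overlap P Q = (\<chi> i j. inner 1 (P $ i $ j * conjugate (Q $ diag_col i $ diag_col j)))"

text \<open>
Each entry has absolute value at most \<open>(\<parallel>P $ i $ j\<parallel>\<^sup>2 + \<parallel>Q $ i' $ j'\<parallel>\<^sup>2) / 2\<close> with \<open>i'\<close>, \<open>j'\<close> the matching columns, and the lines of a
unitary matrix are unit vectors.
\<close>

lemma overlap_abs_substochastic:
  assumes P: "unitary_matrix P" and Q: "unitary_matrix Q"
  shows "overlap P Q \<in> abs_substochastic"
proof -
  have bd: "\<bar>overlap P Q $ i $ j\<bar> \<le> ((norm (P $ i $ j))\<^sup>2 + (norm (Q $ diag_col i $ diag_col j))\<^sup>2) / 2" for i j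
  proof -
    have "\<bar>overlap P Q $ i $ j\<bar> \<le> norm (P $ i $ j) * norm (Q $ diag_col i $ diag_col j)"
      unfolding overlap_def using Cauchy_Schwarz_ineq2[of 1 "P $ i $ j * conjugate (Q $ diag_col i $ diag_col j)"]
      by (simp add: norm_mult)
    also have "\<dots> \<le> ((norm (P $ i $ j))\<^sup>2 + (norm (Q $ diag_col i $ diag_col j))\<^sup>2) / 2"
      using sum_squares_bound[of "norm (P $ i $ j)" "norm (Q $ diag_col i $ diag_col j)"] by simp
    finally show ?thesis .
  qed
  have sub: "(\<Sum>j\<in>UNIV. f (diag_col j)) \<le> sum f UNIV" if "\<And>k. 0 \<le> f k" for f :: "'n \<Rightarrow> real"
  proof -
    have "(\<Sum>j\<in>UNIV. f (diag_col j)) = sum f (range diag_col)"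
      by (simp add: sum.reindex inj_diag_col)
    also have "\<dots> \<le> sum f UNIV" using that by (intro sum_mono2) auto
    finally show ?thesis .
  qed
  have half: "(\<Sum>j\<in>UNIV. x j) \<le> 1" if "\<And>j. x j \<le> (p j + q j) / 2" "sum p UNIV = 1" "sum q UNIV \<le> 1" for x p q :: "'m \<Rightarrow> real"
  proof -
    have "(\<Sum>j\<in>UNIV. x j) \<le> (\<Sum>j\<in>UNIV. (p j + q j) / 2)" using that(1) by (rule sum_mono)
    also have "\<dots> = (sum p UNIV + sum q UNIV) / 2" by (simp add: sum.distrib flip: sum_divide_distrib)
    finally show ?thesis using that by simp
  qed
  show ?thesis
    unfolding abs_substochastic_def
  proof (intro CollectI conjI allI)
    fix i
    show "(\<Sum>j\<in>UNIV. \<bar>overlap P Q $ i $ j\<bar>) \<le> 1"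
    proof (rule half)
      show "(\<Sum>j\<in>UNIV. (norm (Q $ diag_col i $ diag_col j))\<^sup>2) \<le> 1"
        using sub[of "\<lambda>k. (norm (Q $ diag_col i $ k))\<^sup>2"] unitary_row_norm[OF Q, of "diag_col i"] by simp
    qed (rule bd unitary_row_norm[OF P])+
  next
    fix j
    show "(\<Sum>i\<in>UNIV. \<bar>overlap P Q $ i $ j\<bar>) \<le> 1"
    proof (rule half)
      show "(\<Sum>i\<in>UNIV. (norm (Q $ diag_col i $ diag_col j))\<^sup>2) \<le> 1"
        using sub[of "\<lambda>k. (norm (Q $ k $ diag_col j))\<^sup>2"] unitary_col_norm[OF Q, of "diag_col j"] by simp
    qed (rule bd unitary_col_norm[OF P])+
  qed
qed

lemma inner_recompose_overlap:
  fixes U U' :: "('a::rc_field, 'm, 'm) matrix"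
  shows "inner (recompose U a V) (recompose U' b V') =
    inner a (overlap (conj_transpose U ** U') (conj_transpose V ** V') *v b)"
proof -
  have "inner (recompose U a V) X = inner (diag_zero a) (conj_transpose U ** X ** V)" for X
    using inner_mult_left[of U "diag_zero a ** conj_transpose V" X]
      inner_mult_right[of "diag_zero a" "conj_transpose V" "conj_transpose U ** X"]
    by (simp add: matrix_mul_assoc)
  then have "inner (recompose U a V) (recompose U' b V') =
     inner (diag_zero a) (recompose (conj_transpose U ** U') b (conj_transpose V ** V'))"
    by (simp add: conj_transpose_mult matrix_mul_assoc)
  also have "\<dots> = inner a (overlap (conj_transpose U ** U') (conj_transpose V ** V') *v b)"
    unfolding inner_diag_zero recompose_nth
    by (simp add: overlap_def inner_vec_def matrix_vector_mult_def inner_sum_right mult.commute flip: scaleR_conv_of_real)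
  finally show ?thesis .
qed

text \<open>
Both sides equal \<open>\<parallel>a\<parallel>\<^sup>2 + \<parallel>b\<parallel>\<^sup>2 - 2 \<langle>a, R b\<rangle>\<close>, where \<open>R\<close> is the overlap matrix written as a mixture of signed
permutation matrices. What makes the identity useful is that the weights depend on the unitary factors only: it compares
singular values, their increments, and the images of both under a vector map with the same weights.
\<close>

theorem recompose_distance_mixture:
  fixes U U' :: "('a::rc_field, 'm, 'm) matrix" and V V' :: "('a, 'n, 'n) matrix"
  assumes U: "unitary_matrix U" "unitary_matrix U'" and V: "unitary_matrix V" "unitary_matrix V'"
  obtains w where "\<And>Q. 0 \<le> w Q" "sum w {Q. signed_permutation_matrix Q} = 1"
    "\<And>a b. (norm (recompose U a V - recompose U' b V'))\<^sup>2 =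
       (\<Sum>Q | signed_permutation_matrix Q. w Q * (norm (a - Q *v b))\<^sup>2)"
proof -
  define R where "R = overlap (conj_transpose U ** U') (conj_transpose V ** V')"
  have "R \<in> convex hull {Q. signed_permutation_matrix Q}"
    unfolding R_def using U V
    by (intro abs_substochastic_in_hull overlap_abs_substochastic unitary_matrix_mult) auto
  then obtain u where u: "\<And>Q. signed_permutation_matrix Q \<Longrightarrow> 0 \<le> u Q" "sum u {Q. signed_permutation_matrix Q} = 1"
      "(\<Sum>Q | signed_permutation_matrix Q. u Q *\<^sub>R Q) = R"
    by (auto simp: convex_hull_finite[OF finite_signed_permutation_matrices])
  define w where "w Q = (if signed_permutation_matrix Q then u Q else 0)" for Q
  have wu: "(\<Sum>Q | signed_permutation_matrix Q. w Q * h Q) = (\<Sum>Q | signed_permutation_matrix Q. u Q * h Q)" for h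
    by (intro sum.cong) (auto simp: w_def)
  have w1: "sum w {Q. signed_permutation_matrix Q} = 1" using u(2) wu[of "\<lambda>_. 1"] by simp
  have "(norm (recompose U a V - recompose U' b V'))\<^sup>2 =
       (\<Sum>Q | signed_permutation_matrix Q. w Q * (norm (a - Q *v b))\<^sup>2)" for a b
  proof -
    have "inner a (R *v b) = (\<Sum>Q | signed_permutation_matrix Q. u Q * inner a (Q *v b))"
    proof -
      have lin: "linear (\<lambda>R :: (real, 'm, 'm) matrix. inner a (R *v b))"
        by (rule linearI) (simp_all add: matrix_vector_mult_add_rdistrib inner_add_right
              inner_vec_def matrix_vector_mult_def sum_distrib_left mult_ac distrib_left sum.distrib)
      have "inner a (R *v b) = inner a ((\<Sum>Q | signed_permutation_matrix Q. u Q *\<^sub>R Q) *v b)"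
        by (simp add: u(3))
      also have "\<dots> = (\<Sum>Q | signed_permutation_matrix Q. inner a ((u Q *\<^sub>R Q) *v b))"
        by (rule linear_sum[OF lin])
      also have "\<dots> = (\<Sum>Q | signed_permutation_matrix Q. u Q * inner a (Q *v b))"
        using linear_cmul[OF lin] by simp
      finally show ?thesis .
    qed
    then have cross: "inner a (R *v b) = (\<Sum>Q | signed_permutation_matrix Q. w Q * inner a (Q *v b))"
      by (simp add: wu)
    have "(norm (recompose U a V - recompose U' b V'))\<^sup>2 = (norm a)\<^sup>2 + (norm b)\<^sup>2 - 2 * inner a (R *v b)"
      unfolding power2_norm_eq_inner inner_diff_left inner_diff_right
      using inner_recompose[OF U(1) V(1), of a a] inner_recompose[OF U(2) V(2), of b b]
        inner_recompose_overlap[of U a V U' b V']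
      by (simp add: R_def inner_commute)
    also have "\<dots> = (\<Sum>Q | signed_permutation_matrix Q. w Q * ((norm a)\<^sup>2 + (norm b)\<^sup>2 - 2 * inner a (Q *v b)))"
      unfolding cross
      by (simp add: right_diff_distrib sum_subtractf sum_distrib_left mult_ac flip: sum_distrib_right)
         (simp add: w1 flip: sum_distrib_left)
    also have "\<dots> = (\<Sum>Q | signed_permutation_matrix Q. w Q * (norm (a - Q *v b))\<^sup>2)"
    proof (intro sum.cong refl)
      fix Q :: "(real, 'm, 'm) matrix" assume "Q \<in> {Q. signed_permutation_matrix Q}"
      then have "norm (Q *v b) = norm b" by (simp add: norm_signed_permutation_mult)
      then have "(norm (a - Q *v b))\<^sup>2 = (norm a)\<^sup>2 + (norm b)\<^sup>2 - 2 * inner a (Q *v b)"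
        using dot_norm_neg[of a "Q *v b"] by simp
      then show "w Q * ((norm a)\<^sup>2 + (norm b)\<^sup>2 - 2 * inner a (Q *v b)) = w Q * (norm (a - Q *v b))\<^sup>2" by simp
    qed
    finally show ?thesis .
  qed
  then show ?thesis using that[of w] w1 u(1) by (auto simp: w_def)
qed

end

section \<open>Singular value decomposition\<close>

text \<open>
Test with \<open>z = x / \<bar>x\<bar>\<close>; this is the case of equality in the Cauchy--Schwarz inequality.
\<close>

lemma phase_maximiser_real:
  fixes x :: "'a::rc_field"
  assumes "\<And>z. norm z = 1 \<Longrightarrow> inner z x \<le> inner 1 x"
  shows "x = of_real (norm x)"
proof (cases "x = 0")
  case False
  have "norm x = inner (sgn x) x" using False
    by (simp add: sgn_div_norm power2_norm_eq_inner[symmetric] power2_eq_square)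
  also have "\<dots> \<le> inner 1 x" using assms[of "sgn x"] False by (simp add: norm_sgn)
  finally have "inner 1 x = norm (1::'a) * norm x"
    using norm_cauchy_schwarz[of 1 x] by simp
  then have "norm (1::'a) *\<^sub>R x = norm x *\<^sub>R 1" using norm_cauchy_schwarz_eq by blast
  then show ?thesis by (simp add: of_real_def)
qed simp

text \<open>
Test with \<open>(c, s)\<close> proportional to \<open>(\<alpha>, \<beta>)\<close>.
\<close>

lemma rotation_maximiser:
  fixes \<alpha> \<beta> :: real
  assumes "\<And>c s. c\<^sup>2 + s\<^sup>2 = 1 \<Longrightarrow> c * \<alpha> + s * \<beta> \<le> \<alpha>"
  shows "\<beta> = 0"
proof (rule ccontr)
  assume "\<beta> \<noteq> 0"
  define r where "r = sqrt (\<alpha>\<^sup>2 + \<beta>\<^sup>2)"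
  have pos: "\<alpha>\<^sup>2 + \<beta>\<^sup>2 > 0" using \<open>\<beta> \<noteq> 0\<close> by (simp add: add_nonneg_pos)
  then have r: "r > 0" "r * r = \<alpha>\<^sup>2 + \<beta>\<^sup>2" by (auto simp: r_def)
  have "(\<alpha> / r)\<^sup>2 + (\<beta> / r)\<^sup>2 = (\<alpha>\<^sup>2 + \<beta>\<^sup>2) / (r * r)"
    by (simp add: power2_eq_square add_divide_distrib)
  also have "\<dots> = 1" unfolding r(2) using pos by (metis divide_self less_irrefl)
  finally have "(\<alpha> / r)\<^sup>2 + (\<beta> / r)\<^sup>2 = 1" .
  then have "\<alpha> / r * \<alpha> + \<beta> / r * \<beta> \<le> \<alpha>" by (rule assms)
  moreover have "\<alpha> / r * \<alpha> + \<beta> / r * \<beta> = r"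
    using r by (simp add: power2_eq_square field_simps)
  ultimately have "r \<le> \<alpha>" by simp
  then have "r * r \<le> \<alpha> * \<alpha>" using r by (intro mult_mono) auto
  moreover have "0 < \<beta> * \<beta>" using \<open>\<beta> \<noteq> 0\<close> by (metis power2_eq_square zero_less_power2)
  ultimately show False using r(2) by (simp add: power2_eq_square)
qed

lemma sum_two:
  assumes "finite A" "i \<in> A" "j \<in> A" "i \<noteq> j" "\<And>b. b \<in> A \<Longrightarrow> b \<noteq> i \<Longrightarrow> b \<noteq> j \<Longrightarrow> f b = 0"
  shows "sum f A = f i + f j"
proof -
  have "sum f A = sum f {i, j}" by (rule sum.mono_neutral_right) (use assms in auto)
  then show ?thesis using assms(4) by simp
qed

definition plane_rotation :: "'n \<Rightarrow> 'n \<Rightarrow> real \<Rightarrow> real \<Rightarrow> 'a::rc_field \<Rightarrow> ('a, 'n::finite, 'n) matrix" where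
  "plane_rotation i j c s \<omega> = (\<chi> a b.
     if a = i then (if b = i then of_real c else if b = j then of_real s * \<omega> else 0)
     else if a = j then (if b = i then - (of_real s * conjugate \<omega>) else if b = j then of_real c else 0)
     else if a = b then 1 else 0)"

lemma unitary_plane_rotation:
  fixes \<omega> :: "'a::rc_field"
  assumes ij: "i \<noteq> j" and cs: "c\<^sup>2 + s\<^sup>2 = 1" and \<omega>: "norm \<omega> = 1"
  shows "unitary_matrix (plane_rotation i j c s \<omega>)"
proof (rule unitary_matrixI)
  fix a k
  let ?T = "plane_rotation i j c s \<omega>"
  have w: "conjugate \<omega> * \<omega> = 1" using conjugate_mult_self[of \<omega>] \<omega> by simp
  have cs': "of_real c * of_real c + of_real s * of_real s = (1::'a)"
    using cs by (metis of_real_1 of_real_add of_real_mult power2_eq_square)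
  have row_ij: "(\<Sum>b\<in>UNIV. ?T $ a $ b * conjugate (?T $ k $ b)) =
      ?T $ a $ i * conjugate (?T $ k $ i) + ?T $ a $ j * conjugate (?T $ k $ j)"
    if "a \<in> {i, j} \<or> k \<in> {i, j}"
    using that ij by (intro sum_two) (auto simp: plane_rotation_def)
  show "(\<Sum>b\<in>UNIV. ?T $ a $ b * conjugate (?T $ k $ b)) = (if a = k then 1 else 0)"
  proof (cases "a \<in> {i, j} \<or> k \<in> {i, j}")
    case True
    have e1: "of_real s * \<omega> * (of_real s * conjugate \<omega>) = of_real s * of_real s"
      using w by (metis mult.assoc mult.commute mult.left_neutral)
    have e2: "of_real s * conjugate \<omega> * (of_real s * \<omega>) = of_real s * of_real s"
      using w by (metis mult.assoc mult.commute mult.left_neutral)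
    have e3: "\<omega> * of_real s * (conjugate \<omega> * of_real s) = of_real s * of_real s"
      using e1 by (simp add: mult.commute)
    show ?thesis
      unfolding row_ij[OF True] using ij True cs'
      by (auto simp: plane_rotation_def conjugate_dist_mul conjugate_neg e1 e2 e3 mult.commute add.commute)
  next
    case False
    then have "(\<Sum>b\<in>UNIV. ?T $ a $ b * conjugate (?T $ k $ b)) = (\<Sum>b\<in>UNIV. if b = a then (if a = k then 1 else 0) else 0)"
      by (intro sum.cong) (auto simp: plane_rotation_def)
    then show ?thesis by simp
  qed
qed

lemma inner_plane_rotation:
  fixes W :: "('a::rc_field, 'n::finite, 'n) matrix"
  assumes ij: "i \<noteq> j"
  shows "inner (plane_rotation i j c s \<omega>) W - inner (mat 1) W =
    (c - 1) * (inner 1 (W $ i $ i) + inner 1 (W $ j $ j)) + s * inner \<omega> (W $ i $ j - conjugate (W $ j $ i))"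
proof -
  let ?D = "plane_rotation i j c s \<omega> - mat 1 :: ('a, 'n, 'n) matrix"
  have D: "?D $ a $ b = (if a = i then (if b = i then (c - 1) *\<^sub>R 1 else if b = j then s *\<^sub>R \<omega> else 0)
     else if a = j then (if b = i then - (s *\<^sub>R conjugate \<omega>) else if b = j then (c - 1) *\<^sub>R 1 else 0) else 0)" for a b
    using ij by (simp add: plane_rotation_def mat_def of_real_def scaleR_diff_left)
  have "inner ?D W = (\<Sum>b\<in>UNIV. inner (?D $ i $ b) (W $ i $ b)) + (\<Sum>b\<in>UNIV. inner (?D $ j $ b) (W $ j $ b))"
    unfolding inner_matrix_nth using ij by (intro sum_two) (simp_all add: D del: vector_minus_component)
  also have "(\<Sum>b\<in>UNIV. inner (?D $ i $ b) (W $ i $ b)) = inner (?D $ i $ i) (W $ i $ i) + inner (?D $ i $ j) (W $ i $ j)"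
    using ij by (intro sum_two) (simp_all add: D del: vector_minus_component)
  also have "(\<Sum>b\<in>UNIV. inner (?D $ j $ b) (W $ j $ b)) = inner (?D $ j $ i) (W $ j $ i) + inner (?D $ j $ j) (W $ j $ j)"
    using ij by (intro sum_two) (simp_all add: D del: vector_minus_component)
  also have "inner (?D $ i $ i) (W $ i $ i) + inner (?D $ i $ j) (W $ i $ j) + (inner (?D $ j $ i) (W $ j $ i) + inner (?D $ j $ j) (W $ j $ j))
    = (c - 1) * inner 1 (W $ i $ i) + s * inner \<omega> (W $ i $ j) + (- (s * inner (conjugate \<omega>) (W $ j $ i)) + (c - 1) * inner 1 (W $ j $ j))"
    using ij unfolding D by simp
  finally show ?thesis
    by (simp add: inner_diff_left inner_diff_right inner_conjugate_left algebra_simps)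
qed

text \<open>
The conditions for the identity to maximise \<open>T \<mapsto> \<langle>T, W\<rangle>\<close> over the unitary group, as seen by changing one phase
and by rotating one coordinate plane.
\<close>

lemma unitary_maximiser_hermitian:
  fixes W :: "('a::rc_field, 'n::finite, 'n) matrix"
  assumes max: "\<And>T. unitary_matrix T \<Longrightarrow> inner T W \<le> inner (mat 1) W"
  shows "W $ j $ i = conjugate (W $ i $ j)" "W $ i $ i = of_real (norm (W $ i $ i))"
proof -
  show diag: "W $ i $ i = of_real (norm (W $ i $ i))" for i
  proof (rule phase_maximiser_real)
    fix z :: 'a assume z: "norm z = 1"
    define T :: "('a, 'n, 'n) matrix" where "T = (\<chi> a b. if b = id a then (if a = i then z else 1) else 0)"
    have "unitary_matrix T" unfolding T_def by (rule unitary_monomial) (auto simp: z)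
    then have "inner (T - mat 1) W \<le> 0" using max by (simp add: inner_diff_left)
    moreover have "inner (T - mat 1) W = (\<Sum>a\<in>UNIV. if a = i then inner (z - 1) (W $ i $ i) else 0)"
      unfolding inner_matrix_nth
    proof (rule sum.cong)
      fix a
      have "(\<Sum>b\<in>UNIV. inner ((T - mat 1) $ a $ b) (W $ a $ b)) =
            (\<Sum>b\<in>UNIV. if b = a then (if a = i then inner (z - 1) (W $ i $ i) else 0) else 0)"
        by (intro sum.cong) (auto simp: T_def mat_def)
      then show "(\<Sum>b\<in>UNIV. inner ((T - mat 1) $ a $ b) (W $ a $ b)) = (if a = i then inner (z - 1) (W $ i $ i) else 0)"
        by simp
    qed simp
    ultimately show "inner z (W $ i $ i) \<le> inner 1 (W $ i $ i)" by (simp add: inner_diff_left)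
  qed
  show "W $ j $ i = conjugate (W $ i $ j)"
  proof (cases "i = j")
    case True
    then show ?thesis using diag[of j] by (metis conjugate_of_real)
  next
    case False
    define d where "d = W $ i $ j - conjugate (W $ j $ i)"
    have "inner \<omega> d = 0" if \<omega>: "norm \<omega> = 1" for \<omega>
    proof (rule rotation_maximiser)
      fix c s :: real assume cs: "c\<^sup>2 + s\<^sup>2 = 1"
      show "c * (inner 1 (W $ i $ i) + inner 1 (W $ j $ j)) + s * inner \<omega> d \<le> inner 1 (W $ i $ i) + inner 1 (W $ j $ j)"
        using inner_plane_rotation[OF False, of c s \<omega> W] max[OF unitary_plane_rotation[OF False cs \<omega>]]
        by (simp add: d_def algebra_simps)
    qed
    from this[of "sgn d"] have "d = 0" by (cases "d = 0") (auto simp: norm_sgn sgn_div_norm)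
    then have "conjugate (W $ i $ j) = conjugate (conjugate (W $ j $ i))" by (simp add: d_def)
    then show ?thesis by simp
  qed
qed

context wide_shape begin

text \<open>
The left factor permutes the rows and carries the signs; the right factor permutes the columns that hold diagonal
positions accordingly and fixes the others.
\<close>

lemma signed_permutation_diag_zero:
  assumes "signed_permutation_matrix (Q :: (real, 'm, 'm) matrix)"
  obtains P :: "('a::rc_field, 'm, 'm) matrix" and R :: "('a, 'n, 'n) matrix"
  where "unitary_matrix P" "unitary_matrix R" "\<And>y. diag_zero (Q *v y) = recompose P y R"
  using assms
proof (rule signed_permutation_matrixE)
  fix \<pi> :: "'m \<Rightarrow> 'm" and \<epsilon> :: "'m \<Rightarrow> real"
  assume \<pi>: "bij \<pi>" and \<epsilon>: "\<And>i. \<epsilon> i = 1 \<or> \<epsilon> i = -1" and Q: "Q = signed_perm \<pi> \<epsilon>"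
  define \<tau> where "\<tau> k = (if k \<in> range diag_col then diag_col (\<pi> (inv diag_col k)) else k)" for k
  have \<tau>_col: "\<tau> (diag_col i) = diag_col (\<pi> i)" for i
    by (simp add: \<tau>_def inv_f_f[OF inj_diag_col])
  have "inj \<tau>"
  proof (rule injI)
    fix k l assume kl: "\<tau> k = \<tau> l"
    have out: "\<tau> k = k" if "k \<notin> range diag_col" for k using that by (simp add: \<tau>_def)
    have ran: "\<tau> k \<in> range diag_col \<longleftrightarrow> k \<in> range diag_col" for k
      by (cases "k \<in> range diag_col") (auto simp: \<tau>_col out)
    show "k = l"
    proof (cases "k \<in> range diag_col")
      case True
      moreover from this have "l \<in> range diag_col" using ran[of k] ran[of l] kl by simp
      ultimately show ?thesis using kl \<pi> by (auto simp: \<tau>_col bij_def inj_eq)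
    next
      case False
      moreover from this have "l \<notin> range diag_col" using ran[of k] ran[of l] kl by simp
      ultimately show ?thesis using kl out by metis
    qed
  qed
  define P :: "('a, 'm, 'm) matrix" where "P = (\<chi> i j. if j = \<pi> i then of_real (\<epsilon> i) else 0)"
  define R :: "('a, 'n, 'n) matrix" where "R = (\<chi> k l. if l = \<tau> k then 1 else 0)"
  have "norm (of_real (\<epsilon> i) :: 'a) = 1" for i using \<epsilon>[of i] by auto
  then have 1: "unitary_matrix P" unfolding P_def using \<pi> by (intro unitary_monomial) (auto simp: bij_def)
  have 2: "unitary_matrix R" unfolding R_def using \<open>inj \<tau>\<close> by (intro unitary_monomial) auto
  have "diag_zero (Q *v y) $ i $ k = recompose P y R $ i $ k" for y i k
  proof -
    have "recompose P y R $ i $ k =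
      (\<Sum>j\<in>UNIV. if j = \<pi> i then (if diag_col (\<pi> i) = \<tau> k then of_real (\<epsilon> i * y $ \<pi> i) else 0) else 0)"
      unfolding recompose_nth by (intro sum.cong) (auto simp: P_def R_def)
    also have "\<dots> = (if diag_col (\<pi> i) = \<tau> k then of_real (\<epsilon> i * y $ \<pi> i) else 0)" by simp
    also have "diag_col (\<pi> i) = \<tau> k \<longleftrightarrow> k = diag_col i"
      unfolding \<tau>_col[symmetric] using \<open>inj \<tau>\<close> by (auto simp: inj_eq)
    finally show ?thesis by (simp add: diag_zero_nth Q)
  qed
  then have "diag_zero (Q *v y) = recompose P y R" for y by (simp add: vec_eq_iff)
  with 1 2 that show ?thesis by blast
qed

lemma recompose_recompose:
  fixes U :: "('a::rc_field, 'm, 'm) matrix"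
  shows "U ** recompose P y R ** conj_transpose V = recompose (U ** P) y (V ** R)"
  by (simp add: conj_transpose_mult matrix_mul_assoc)

text \<open>
A variational argument in the spirit of von Neumann. For a strictly decreasing positive vector \<open>d\<close> with diagonal matrix
\<open>D\<close>, let \<open>(U, V)\<close> maximise \<open>\<langle>U [d] V\<^sup>*, Z\<rangle>\<close> and put \<open>W = U\<^sup>* Z V\<close>. Optimality of \<open>U\<close> and of \<open>V\<close> makes \<open>W D\<^sup>*\<close> and
\<open>D\<^sup>* W\<close> hermitian, which for \<open>i \<noteq> j\<close> gives \<open>(d $ i)\<^sup>2 x = (d $ j)\<^sup>2 x\<close> for an off-diagonal entry \<open>x\<close> of \<open>W\<close> and hence
\<open>x = 0\<close>. Optimality with respect to phases makes the diagonal nonnegative, and optimality with respect to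
transpositions sorts it in the order of \<open>d\<close>.
\<close>

lemma svd_exists:
  fixes Z :: "('a::rc_field, 'm, 'n) matrix"
  obtains U V s where "unitary_matrix U" "unitary_matrix V" "Z = recompose U s V"
    "\<And>i j. i \<le> j \<Longrightarrow> s $ j \<le> s $ i" "\<And>i. 0 \<le> s $ i"
proof -
  define d :: "(real, 'm) vec" where "d = (\<chi> i. real (CARD('m) - index_pos i))"
  have "index_pos i \<in> {..<CARD('m)}" for i :: 'm unfolding range_index_pos[symmetric] by (rule rangeI)
  then have lt: "index_pos i < CARD('m)" for i :: 'm by simp
  have dpos: "0 < d $ i" for i using lt[of i] by (simp add: d_def)
  have dmono: "d $ j < d $ i" if "i < j" for i j
    using index_pos_strict_mono[OF that] lt[of i] lt[of j] by (simp add: d_def)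
  let ?O = "{U :: ('a, 'm, 'm) matrix. unitary_matrix U} \<times> {V :: ('a, 'n, 'n) matrix. unitary_matrix V}"
  have "compact ?O" by (intro compact_Times compact_unitary_matrices)
  moreover have "(mat 1, mat 1) \<in> ?O" by simp
  then have "?O \<noteq> {}" by blast
  moreover have "continuous_on ?O (\<lambda>(U, V). inner (recompose U d V) Z)"
    unfolding case_prod_beta
    by (intro continuous_on_inner continuous_on_const continuous_on_fst continuous_on_snd continuous_on_id
        bounded_bilinear.continuous_on[OF bounded_bilinear_matrix_mult]
        bounded_linear.continuous_on[OF bounded_linear_conj_transpose])
  ultimately obtain UV where "UV \<in> ?O"
      "\<forall>y\<in>?O. (case y of (U, V) \<Rightarrow> inner (recompose U d V) Z) \<le> (case UV of (U, V) \<Rightarrow> inner (recompose U d V) Z)"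
    using continuous_attains_sup by blast
  then obtain U V where U: "unitary_matrix U" and V: "unitary_matrix V"
    and max: "\<And>U' V'. unitary_matrix U' \<Longrightarrow> unitary_matrix V' \<Longrightarrow> inner (recompose U' d V') Z \<le> inner (recompose U d V) Z"
    by (cases UV) auto
  define D :: "('a, 'm, 'n) matrix" where "D = diag_zero d"
  define W where "W = conj_transpose U ** Z ** V"
  have ZW: "Z = U ** W ** conj_transpose V"
    using V by (simp add: W_def unitary_cancel[OF U] unitary_matrix_def matrix_mul_assoc[symmetric])
  have left: "inner T (W ** conj_transpose D) \<le> inner (mat 1) (W ** conj_transpose D)" if T: "unitary_matrix T" for T
  proof -
    have "inner (recompose (U ** T) d V) Z = inner T (W ** conj_transpose D)" for T
      using inner_mult_left[of U "T ** (D ** conj_transpose V)" Z] inner_mult_right[of T "D ** conj_transpose V" "conj_transpose U ** Z"]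
      by (simp add: D_def W_def conj_transpose_mult matrix_mul_assoc)
    from this[of T] this[of "mat 1"] max[OF unitary_matrix_mult[OF U T] V]
    show ?thesis by simp
  qed
  have right: "inner T (conj_transpose D ** W) \<le> inner (mat 1) (conj_transpose D ** W)" if T: "unitary_matrix T" for T
  proof -
    have "inner (recompose U d (V ** conj_transpose T)) Z = inner T (conj_transpose D ** W)" for T
      using inner_mult_left[of "U ** D" "T ** conj_transpose V" Z]
        inner_mult_right[of T "conj_transpose V" "conj_transpose (U ** D) ** Z"]
      by (simp add: D_def W_def conj_transpose_mult matrix_mul_assoc)
    from this[of T] this[of "mat 1"] max[OF U unitary_matrix_mult[OF V, of "conj_transpose T"]] T
    show ?thesis by simp
  qed
  have A: "(W ** conj_transpose D) $ i $ j = d $ j *\<^sub>R (W $ i $ diag_col j)" for i j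
  proof -
    have "(W ** conj_transpose D) $ i $ j = (\<Sum>k\<in>UNIV. if k = diag_col j then d $ j *\<^sub>R (W $ i $ diag_col j) else 0)"
      unfolding matrix_mult_nth by (intro sum.cong) (auto simp: D_def diag_zero_nth of_real_def)
    then show ?thesis by simp
  qed
  have B: "(conj_transpose D ** W) $ diag_col i $ l = d $ i *\<^sub>R (W $ i $ l)" for i l
  proof -
    have "(conj_transpose D ** W) $ diag_col i $ l = (\<Sum>k\<in>UNIV. if k = i then d $ i *\<^sub>R (W $ i $ l) else 0)"
      unfolding matrix_mult_nth by (intro sum.cong) (auto simp: D_def diag_zero_nth of_real_def)
    then show ?thesis by simp
  qed
  have B0: "(conj_transpose D ** W) $ k $ l = 0" if "k \<notin> range diag_col" for k l
    unfolding matrix_mult_nth using that by (intro sum.neutral) (auto simp: D_def diag_zero_nth)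
  \<comment> \<open>Symmetry of \<open>W D\<^sup>*\<close> and of \<open>D\<^sup>* W\<close>, read off at the diagonal columns and at the remaining columns.\<close>
  have hA: "d $ i *\<^sub>R (W $ j $ diag_col i) = d $ j *\<^sub>R conjugate (W $ i $ diag_col j)" for i j
    using unitary_maximiser_hermitian(1)[of "W ** conj_transpose D" j i] left by (simp add: A)
  have hB: "d $ j *\<^sub>R (W $ j $ diag_col i) = d $ i *\<^sub>R conjugate (W $ i $ diag_col j)" for i j
    using unitary_maximiser_hermitian(1)[of "conj_transpose D ** W" "diag_col j" "diag_col i"] right by (simp add: B)
  have hB0: "W $ i $ l = 0" if "l \<notin> range diag_col" for i l
    using unitary_maximiser_hermitian(1)[of "conj_transpose D ** W" "diag_col i" l] right B0[OF that, of "diag_col i"] dpos[of i]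
    by (simp add: B)
  have off: "W $ j $ diag_col i = 0" if "i \<noteq> j" for i j
  proof -
    let ?x = "W $ j $ diag_col i" and ?y = "conjugate (W $ i $ diag_col j)"
    have "(d $ i * d $ i) *\<^sub>R ?x = d $ i *\<^sub>R (d $ j *\<^sub>R ?y)" by (simp add: hA flip: scaleR_scaleR)
    also have "\<dots> = d $ j *\<^sub>R (d $ i *\<^sub>R ?y)" by simp
    also have "\<dots> = (d $ j * d $ j) *\<^sub>R ?x" by (simp add: hB[symmetric])
    finally have "(d $ i * d $ i = d $ j * d $ j) \<or> ?x = 0" by simp
    moreover have "d $ i \<noteq> d $ j" using that dmono by (metis less_irrefl linorder_neqE)
    then have "d $ i * d $ i \<noteq> d $ j * d $ j" using dpos[of i] dpos[of j]
      power2_eq_iff_nonneg[of "d $ i" "d $ j"] by (simp add: power2_eq_square)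
    ultimately show ?thesis by simp
  qed
  define s :: "(real, 'm) vec" where "s = (\<chi> i. norm (W $ i $ diag_col i))"
  have dia: "W $ i $ diag_col i = of_real (s $ i)" for i
  proof -
    have "d $ i *\<^sub>R (W $ i $ diag_col i) = of_real (norm (d $ i *\<^sub>R (W $ i $ diag_col i)))"
      by (rule unitary_maximiser_hermitian(2)[OF left, of i, unfolded A])
    also have "\<dots> = d $ i *\<^sub>R of_real (s $ i)" using dpos[of i] by (simp add: s_def of_real_def)
    finally show ?thesis using dpos[of i] by simp
  qed
  have "W $ i $ l = diag_zero s $ i $ l" for i l
    by (cases "l \<in> range diag_col") (auto simp: diag_zero_nth hB0 dia off)
  then have "W = diag_zero s" by (simp add: vec_eq_iff)
  then have Z: "Z = recompose U s V" using ZW by simp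
  have "s $ j \<le> s $ i" if ij: "i < j" for i j
  proof -
    define \<pi> where "\<pi> = Transposition.transpose i j"
    have Q: "signed_permutation_matrix (signed_perm \<pi> (\<lambda>_. 1))"
      unfolding \<pi>_def by (rule signed_permutation_matrix_signed_perm) auto
    let ?Q = "signed_perm \<pi> (\<lambda>_. 1)"
    obtain P :: "('a, 'm, 'm) matrix" and R :: "('a, 'n, 'n) matrix"
      where PR: "unitary_matrix P" "unitary_matrix R" "\<And>y. diag_zero (?Q *v y) = recompose P y R"
      using signed_permutation_diag_zero[OF Q] by blast
    have "recompose U (?Q *v d) V = recompose (U ** P) d (V ** R)"
      by (simp add: PR(3) recompose_recompose)
    then have "inner (recompose U (?Q *v d) V) Z \<le> inner (recompose U d V) Z"
      using max[OF unitary_matrix_mult[OF U PR(1)] unitary_matrix_mult[OF V PR(2)]] by simp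
    then have "inner (?Q *v d) s \<le> inner d s" unfolding Z by (simp add: inner_recompose U V)
    moreover have "inner (?Q *v d - d) s = (d $ j - d $ i) * s $ i + (d $ i - d $ j) * s $ j"
      unfolding inner_vec_def using ij
      by (subst sum_two[of _ i j]) (auto simp: \<pi>_def Transposition.transpose_def algebra_simps)
    ultimately have "(d $ i - d $ j) * (s $ j - s $ i) \<le> 0" by (simp add: inner_diff_left algebra_simps)
    then show ?thesis using dmono[OF ij] by (simp add: mult_le_0_iff)
  qed
  then have "i \<le> j \<Longrightarrow> s $ j \<le> s $ i" for i j by (cases "i = j") auto
  moreover have "0 \<le> s $ i" for i by (simp add: s_def)
  ultimately show ?thesis using that U V Z by blast
qed

text \<open>
A mixture of squares that vanishes has vanishing terms wherever the weight is positive.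
\<close>

lemma recompose_eq_signed_permutation:
  fixes U U' :: "('a::rc_field, 'm, 'm) matrix"
  assumes "unitary_matrix U" "unitary_matrix U'" "unitary_matrix V" "unitary_matrix V'"
    and "recompose U a V = recompose U' b V'"
  obtains Q where "signed_permutation_matrix Q" "a = Q *v b"
proof -
  obtain w where w: "\<And>Q. 0 \<le> w Q" "sum w {Q. signed_permutation_matrix Q} = 1"
    "\<And>a b. (norm (recompose U a V - recompose U' b V'))\<^sup>2 =
       (\<Sum>Q | signed_permutation_matrix Q. w Q * (norm (a - Q *v b))\<^sup>2)"
    using recompose_distance_mixture[OF assms(1-4)] by blast
  have "(\<Sum>Q | signed_permutation_matrix Q. w Q * (norm (a - Q *v b))\<^sup>2) = 0"
    using w(3)[of a b] assms(5) by simp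
  then have z: "\<forall>Q\<in>{Q. signed_permutation_matrix Q}. w Q * (norm (a - Q *v b))\<^sup>2 = 0"
    using w(1) by (subst (asm) sum_nonneg_eq_0_iff[OF finite_signed_permutation_matrices]) auto
  have "\<exists>Q. signed_permutation_matrix Q \<and> w Q \<noteq> 0"
    using w(2) by (metis (mono_tags, lifting) mem_Collect_eq sum.neutral zero_neq_one)
  then show ?thesis using z that by auto
qed

text \<open>
The superlevel sets of an antitone vector are initial segments, which are determined by their cardinality.
\<close>

lemma antitone_permutation_eq:
  fixes s t :: "(real, 'm) vec"
  assumes s: "\<And>i j. i \<le> j \<Longrightarrow> s $ j \<le> s $ i" and t: "\<And>i j. i \<le> j \<Longrightarrow> t $ j \<le> t $ i"
    and \<pi>: "bij \<pi>" "\<And>i. s $ i = t $ \<pi> i"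
  shows "s = t"
proof -
  have count: "card {j. c \<le> s $ j} = card {j. c \<le> t $ j}" for c
  proof -
    have "\<pi> ` {j. c \<le> s $ j} = {j. c \<le> t $ j}"
      using \<pi> by (auto simp: bij_def surj_def image_iff)
    then show ?thesis using \<pi>(1) by (metis bij_def card_image inj_on_subset subset_UNIV)
  qed
  have le: "b $ i \<le> a $ i" if a: "\<And>i j. i \<le> j \<Longrightarrow> a $ j \<le> a $ i" and b: "\<And>i j. i \<le> j \<Longrightarrow> b $ j \<le> b $ i"
     and cnt: "\<And>c. card {j. c \<le> a $ j} = card {j. c \<le> b $ j}" for a b :: "(real, 'm) vec" and i
  proof (rule ccontr)
    assume "\<not> b $ i \<le> a $ i"
    then have "{j. b $ i \<le> a $ j} \<subseteq> {..<i}" using a by (auto simp: not_le intro: order_less_le_trans)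
       (metis leI less_le_trans not_less)
    moreover have "{..<i} \<subset> {..i}" by auto
    moreover have "{..i} \<subseteq> {j. b $ i \<le> b $ j}" using b by auto
    ultimately have "{j. b $ i \<le> a $ j} \<subset> {..i}" "{..i} \<subseteq> {j. b $ i \<le> b $ j}" by auto
    then have "card {j. b $ i \<le> a $ j} < card {j. b $ i \<le> b $ j}"
      by (meson finite psubset_card_mono psubset_subset_trans)
    with cnt show False by simp
  qed
  have "t $ i \<le> s $ i" "s $ i \<le> t $ i" for i
    using le[of s t i] le[of t s i] s t count by auto
  then show ?thesis by (simp add: vec_eq_iff order_antisym)
qed

lemma singular_values_unique:
  fixes U U' :: "('a::rc_field, 'm, 'm) matrix"
  assumes "unitary_matrix U" "unitary_matrix U'" "unitary_matrix V" "unitary_matrix V'"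
    and "recompose U s V = recompose U' t V'"
    and s: "\<And>i j. i \<le> j \<Longrightarrow> s $ j \<le> s $ i" "\<And>i. 0 \<le> s $ i"
    and t: "\<And>i j. i \<le> j \<Longrightarrow> t $ j \<le> t $ i" "\<And>i. 0 \<le> t $ i"
  shows "s = t"
proof -
  obtain Q where "signed_permutation_matrix Q" and st: "s = Q *v t"
    using recompose_eq_signed_permutation[OF assms(1-5)] by blast
  then obtain \<pi> \<epsilon> where Q: "bij \<pi>" "\<And>i. \<epsilon> i = 1 \<or> \<epsilon> i = -1" "Q = signed_perm \<pi> \<epsilon>"
    using signed_permutation_matrixE by blast
  have "s $ i = t $ \<pi> i" for i
    using st Q(2)[of i] s(2)[of i] t(2)[of "\<pi> i"] by (auto simp: Q(3))
  then show ?thesis using antitone_permutation_eq[OF s(1) t(1) Q(1)] by blast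
qed

lemma singular_values_decomposition:
  fixes Z :: "('a::rc_field, 'm, 'n) matrix"
  obtains U V where "unitary_matrix U" "unitary_matrix V" "Z = recompose U (singular_values Z) V"
    "\<And>i. 0 \<le> singular_values Z $ i"
proof -
  obtain U V s where *: "unitary_matrix U" "unitary_matrix V" "Z = recompose U s V"
    "\<And>i j. i \<le> j \<Longrightarrow> s $ j \<le> s $ i" "\<And>i. 0 \<le> s $ i"
    using svd_exists by blast
  have sv: "singular_values Z = s"
    unfolding singular_values_def
  proof (rule the_equality)
    show "(\<forall>i j. i \<le> j \<longrightarrow> s $ j \<le> s $ i) \<and> (\<forall>i. 0 \<le> s $ i) \<and>
      (\<exists>U V. unitary_matrix U \<and> unitary_matrix V \<and> Z = recompose U s V)"
      using * by blast
  next
    fix t :: "(real, 'm) vec"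
    assume "(\<forall>i j. i \<le> j \<longrightarrow> t $ j \<le> t $ i) \<and> (\<forall>i. 0 \<le> t $ i) \<and>
      (\<exists>U V. unitary_matrix U \<and> unitary_matrix V \<and> Z = recompose U t V)"
    then obtain U' V' where "unitary_matrix U'" "unitary_matrix V'" "Z = recompose U' t V'"
      and t: "\<forall>i j. i \<le> j \<longrightarrow> t $ j \<le> t $ i" "\<forall>i. 0 \<le> t $ i" by blast
    with * show "t = s" using singular_values_unique[of U' U V' V t s] by auto
  qed
  show ?thesis
    using that[of U V] *(1-3,5) unfolding sv by blast
qed

section \<open>Spectral operators on arbitrary decompositions\<close>

text \<open>
The signed permutations \<open>Q\<close> with positive weight satisfy \<open>s = Q x\<close> for the singular values \<open>s\<close>, because the
two decompositions describe the same matrix. Symmetry of \<open>g\<close> turns this into \<open>g s = Q (g x)\<close>, so that the mixture for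
the values of \<open>g\<close> vanishes as well.
\<close>

lemma spectral_operator_recompose:
  fixes G :: "('a::rc_field, 'm, 'n) matrix \<Rightarrow> ('a, 'm, 'n) matrix"
  assumes sym: "absolutely_symmetric_on S g" and S: "singular_values ` N \<subseteq> S"
    and G: "spectral_operator_on N g G"
    and UV: "unitary_matrix U" "unitary_matrix V" and N: "recompose U x V \<in> N"
  shows "G (recompose U x V) = recompose U (g x) V"
proof -
  define X where "X = recompose U x V"
  define s where "s = singular_values X"
  obtain U0 V0 where 0: "unitary_matrix U0" "unitary_matrix V0" "X = recompose U0 s V0"
    using singular_values_decomposition[of X] unfolding s_def by blast
  have sS: "s \<in> S" using S N by (auto simp: s_def X_def)
  have "(U0, V0) \<in> svd_pairs X" using 0 by (auto simp: svd_pairs_def s_def)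
  then have GX: "G X = recompose U0 (g s) V0"
    using G N unfolding spectral_operator_on_def by (auto simp: X_def s_def)
  obtain w where w: "\<And>Q. 0 \<le> w Q" "sum w {Q. signed_permutation_matrix Q} = 1"
    "\<And>a b. (norm (recompose U0 a V0 - recompose U b V))\<^sup>2 =
       (\<Sum>Q | signed_permutation_matrix Q. w Q * (norm (a - Q *v b))\<^sup>2)"
    using recompose_distance_mixture[OF 0(1) UV(1) 0(2) UV(2)] by blast
  have "(\<Sum>Q | signed_permutation_matrix Q. w Q * (norm (s - Q *v x))\<^sup>2) = 0"
    using w(3)[of s x] 0(3) by (simp add: X_def)
  then have z: "\<forall>Q\<in>{Q. signed_permutation_matrix Q}. w Q * (norm (s - Q *v x))\<^sup>2 = 0"
    using w(1) by (subst (asm) sum_nonneg_eq_0_iff[OF finite_signed_permutation_matrices]) auto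
  have "w Q * (norm (g s - Q *v g x))\<^sup>2 = 0" if Q: "signed_permutation_matrix Q" for Q
  proof (cases "w Q = 0")
    case False
    then have sx: "s = Q *v x" using z Q by auto
    obtain Q' where Q': "signed_permutation_matrix Q'" "\<And>x. Q' *v (Q *v x) = x" "\<And>x. Q *v (Q' *v x) = x"
      using signed_permutation_matrix_inverse[OF Q] by blast
    have "g x = g (Q' *v s)" by (simp add: sx Q')
    also have "\<dots> = Q' *v g s" using sym sS Q'(1) by (simp add: absolutely_symmetric_on_def)
    finally show ?thesis by (simp add: Q')
  qed simp
  then have "(norm (recompose U0 (g s) V0 - recompose U (g x) V))\<^sup>2 = 0"
    unfolding w(3) by (intro sum.neutral) auto
  then show ?thesis using GX by (simp add: X_def)
qed

end

section \<open>Decompositions of nearby matrices\<close>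

lemma exists_le_weighted_mean:
  fixes f :: "'x \<Rightarrow> real"
  assumes "finite A" and w: "\<And>x. 0 \<le> w x" "sum w A = 1"
  shows "\<exists>x\<in>A. f x \<le> (\<Sum>x\<in>A. w x * f x)"
proof (rule ccontr)
  let ?m = "\<Sum>x\<in>A. w x * f x"
  assume "\<not> ?thesis"
  then have lt: "?m < f x" if "x \<in> A" for x using that by force
  obtain x0 where x0: "x0 \<in> A" "w x0 \<noteq> 0" using w(2) by (metis sum.neutral zero_neq_one)
  have "?m = (\<Sum>x\<in>A. w x * ?m)" by (simp add: w(2) flip: sum_distrib_right)
  also have "\<dots> < (\<Sum>x\<in>A. w x * f x)"
  proof (rule sum_strict_mono_ex1[OF \<open>finite A\<close>])
    show "\<forall>x\<in>A. w x * ?m \<le> w x * f x" using lt w(1) by (meson less_imp_le mult_left_mono)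
    have "0 < w x0" using w(1)[of x0] x0(2) by simp
    then show "\<exists>x\<in>A. w x * ?m < w x * f x" using lt[OF x0(1)] x0(1) by (meson mult_strict_left_mono)
  qed
  finally show False by simp
qed

context wide_shape begin
text \<open>
This replaces the perturbation inequalities for singular values, at the price of an unsorted \<open>s\<close>. The squared distance of
the matrices is a mean of the numbers \<open>\<parallel>t - Q s0\<parallel>\<^sup>2\<close>, so one of them does not exceed it; this \<open>Q\<close> is moved
into the unitary factors.
\<close>

lemma nearby_decomposition:
  fixes X :: "('a::rc_field, 'm, 'n) matrix"
  assumes "unitary_matrix U0" "unitary_matrix V0"
  obtains U V s where "unitary_matrix U" "unitary_matrix V" "X = recompose U s V"
    "norm (s - s0) \<le> norm (X - recompose U0 s0 V0)"
proof -
  define t where "t = singular_values X"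
  obtain U V where *: "unitary_matrix U" "unitary_matrix V" "X = recompose U t V"
    unfolding t_def using singular_values_decomposition[of X] by blast
  obtain w where w: "\<And>Q. 0 \<le> w Q" "sum w {Q. signed_permutation_matrix Q} = 1"
    "\<And>a b. (norm (recompose U a V - recompose U0 b V0))\<^sup>2 =
       (\<Sum>Q | signed_permutation_matrix Q. w Q * (norm (a - Q *v b))\<^sup>2)"
    using recompose_distance_mixture[OF *(1) assms(1) *(2) assms(2)] by blast
  have "(\<Sum>Q | signed_permutation_matrix Q. w Q * (norm (t - Q *v s0))\<^sup>2) = (norm (X - recompose U0 s0 V0))\<^sup>2"
    by (subst *(3)) (rule w(3)[symmetric])
  then have "\<exists>Q\<in>{Q. signed_permutation_matrix Q}. (norm (t - Q *v s0))\<^sup>2 \<le> (norm (X - recompose U0 s0 V0))\<^sup>2"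
    using exists_le_weighted_mean[OF finite_signed_permutation_matrices w(1,2), of "\<lambda>Q. (norm (t - Q *v s0))\<^sup>2"] by simp
  then obtain Q where Q: "signed_permutation_matrix Q" "norm (t - Q *v s0) \<le> norm (X - recompose U0 s0 V0)"
    by auto
  obtain Q' where Q': "signed_permutation_matrix Q'" "\<And>x. Q' *v (Q *v x) = x" "\<And>x. Q *v (Q' *v x) = x"
    using signed_permutation_matrix_inverse[OF Q(1)] by blast
  obtain P :: "('a, 'm, 'm) matrix" and R :: "('a, 'n, 'n) matrix"
    where PR: "unitary_matrix P" "unitary_matrix R" "\<And>y. diag_zero (Q *v y) = recompose P y R"
    using signed_permutation_diag_zero[OF Q(1)] by blast
  have "X = recompose U (Q *v (Q' *v t)) V" using *(3) by (simp only: Q'(3))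
  also have "\<dots> = recompose (U ** P) (Q' *v t) (V ** R)" unfolding PR(3) by (rule recompose_recompose)
  finally have X: "X = recompose (U ** P) (Q' *v t) (V ** R)" .
  have "norm (Q' *v t - s0) = norm (Q *v (Q' *v t - s0))" by (rule norm_signed_permutation_mult[OF Q(1), symmetric])
  also have "\<dots> = norm (t - Q *v s0)" by (simp only: matrix_vector_mult_diff_distrib Q'(3))
  finally have "norm (Q' *v t - s0) \<le> norm (X - recompose U0 s0 V0)" using Q(2) by simp
  then show ?thesis
    using that[OF unitary_matrix_mult[OF *(1) PR(1)] unitary_matrix_mult[OF *(2) PR(2)] X] by blast
qed

end

section \<open>Second-order expansions at a point\<close>

text \<open>
A Taylor estimate at a single point. It passes to bilinear products, which is all that is needed for polynomials in a
matrix and its adjoint.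
\<close>

definition expands_quadratically ::
  "('x::real_normed_vector \<Rightarrow> 'y::real_normed_vector) \<Rightarrow> 'x \<Rightarrow> ('x \<Rightarrow> 'y) \<Rightarrow> bool" where
  "expands_quadratically f a L \<longleftrightarrow> bounded_linear L \<and>
     (\<exists>C. \<forall>\<^sub>F h in nhds 0. norm (f (a + h) - f a - L h) \<le> C * (norm h)\<^sup>2)"

lemma expands_quadratically_bounded_linear:
  assumes "bounded_linear f" shows "expands_quadratically f a f"
  using assms unfolding expands_quadratically_def
  by (auto intro!: exI[of _ 0] simp: linear_add[OF bounded_linear.linear])

lemma expands_quadratically_compose_linear:
  assumes T: "bounded_linear T" and f: "expands_quadratically f a L"
  shows "expands_quadratically (\<lambda>x. T (f x)) a (\<lambda>h. T (L h))"
proof -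
  obtain C where C: "\<forall>\<^sub>F h in nhds 0. norm (f (a + h) - f a - L h) \<le> C * (norm h)\<^sup>2" and L: "bounded_linear L"
    using f by (auto simp: expands_quadratically_def)
  obtain K where K: "K > 0" "\<And>x. norm (T x) \<le> norm x * K"
    using bounded_linear.pos_bounded[OF T] by blast
  have "\<forall>\<^sub>F h in nhds 0. norm (T (f (a + h)) - T (f a) - T (L h)) \<le> (C * K) * (norm h)\<^sup>2"
    using C
  proof (eventually_elim)
    case (elim h)
    have "norm (T (f (a + h)) - T (f a) - T (L h)) = norm (T (f (a + h) - f a - L h))"
      by (simp add: linear_diff[OF bounded_linear.linear[OF T]])
    also have "\<dots> \<le> norm (f (a + h) - f a - L h) * K" by (rule K)
    also have "\<dots> \<le> C * (norm h)\<^sup>2 * K" using elim K(1) by (intro mult_right_mono) auto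
    finally show ?case by (simp add: mult_ac)
  qed
  then show ?thesis using bounded_linear_compose[OF T L] unfolding expands_quadratically_def by blast
qed

lemma expands_quadratically_add:
  assumes "expands_quadratically f a L" "expands_quadratically g a M"
  shows "expands_quadratically (\<lambda>x. f x + g x) a (\<lambda>h. L h + M h)"
proof -
  obtain C D where C: "\<forall>\<^sub>F h in nhds 0. norm (f (a + h) - f a - L h) \<le> C * (norm h)\<^sup>2" and L: "bounded_linear L"
    and D: "\<forall>\<^sub>F h in nhds 0. norm (g (a + h) - g a - M h) \<le> D * (norm h)\<^sup>2" and M: "bounded_linear M"
    using assms by (auto simp: expands_quadratically_def)
  have "\<forall>\<^sub>F h in nhds 0. norm (f (a + h) + g (a + h) - (f a + g a) - (L h + M h)) \<le> (C + D) * (norm h)\<^sup>2"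
    using C D
  proof (eventually_elim)
    case (elim h)
    have eq: "f (a + h) + g (a + h) - (f a + g a) - (L h + M h) = (f (a + h) - f a - L h) + (g (a + h) - g a - M h)" by simp
    show ?case unfolding eq distrib_right using elim by (intro order_trans[OF norm_triangle_ineq] add_mono)
  qed
  then show ?thesis using bounded_linear_add[OF L M] unfolding expands_quadratically_def by blast
qed

lemma eventually_norm_less_1: "\<forall>\<^sub>F h in nhds (0::'x::real_normed_vector). norm h < 1"
  by (rule order_tendstoD(2)[where y=0]) (auto intro!: tendsto_eq_intros filterlim_ident)

lemma expands_quadratically_lipschitz:
  assumes "expands_quadratically f a L"
  obtains K where "K > 0" "\<forall>\<^sub>F h in nhds 0. norm (f (a + h) - f a) \<le> K * norm h"
proof -
  obtain C where C: "\<forall>\<^sub>F h in nhds 0. norm (f (a + h) - f a - L h) \<le> C * (norm h)\<^sup>2" and L: "bounded_linear L"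
    using assms by (auto simp: expands_quadratically_def)
  obtain K where K: "K > 0" "\<And>x. norm (L x) \<le> norm x * K"
    using bounded_linear.pos_bounded[OF L] by blast
  from C eventually_norm_less_1 have "\<forall>\<^sub>F h in nhds 0. norm (f (a + h) - f a) \<le> (\<bar>C\<bar> + K) * norm h"
  proof eventually_elim
    case (elim h)
    have "norm (f (a + h) - f a) \<le> norm (f (a + h) - f a - L h) + norm (L h)"
      by (metis diff_add_cancel norm_triangle_ineq)
    also have "\<dots> \<le> C * (norm h)\<^sup>2 + norm h * K" using elim(1) K(2)[of h] by linarith
    also have "C * (norm h)\<^sup>2 \<le> \<bar>C\<bar> * (norm h * 1)"
      unfolding power2_eq_square using elim(2) by (intro mult_mono) auto
    finally show ?case by (simp add: algebra_simps)
  qed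
  then show ?thesis using that[of "\<bar>C\<bar> + K"] K(1) by auto
qed

lemma expands_quadratically_bilinear:
  assumes b: "bounded_bilinear b" and f: "expands_quadratically f a L" and g: "expands_quadratically g a M"
  shows "expands_quadratically (\<lambda>x. b (f x) (g x)) a (\<lambda>h. b (L h) (g a) + b (f a) (M h))"
proof -
  interpret b: bounded_bilinear b by (rule b)
  obtain C D where C: "\<forall>\<^sub>F h in nhds 0. norm (f (a + h) - f a - L h) \<le> C * (norm h)\<^sup>2" and L: "bounded_linear L"
    and D: "\<forall>\<^sub>F h in nhds 0. norm (g (a + h) - g a - M h) \<le> D * (norm h)\<^sup>2" and M: "bounded_linear M"
    using f g by (auto simp: expands_quadratically_def)
  obtain K where K: "K > 0" "\<And>x y. norm (b x y) \<le> norm x * norm y * K"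
    using b.pos_bounded by blast
  obtain KL where KL: "KL > 0" "\<And>x. norm (L x) \<le> norm x * KL"
    using bounded_linear.pos_bounded[OF L] by blast
  obtain Kg where Kg: "Kg > 0" "\<forall>\<^sub>F h in nhds 0. norm (g (a + h) - g a) \<le> Kg * norm h"
    using expands_quadratically_lipschitz[OF g] by blast
  let ?E = "\<bar>C\<bar> * (norm (g a) + Kg) * K + KL * Kg * K + norm (f a) * D * K"
  have "\<forall>\<^sub>F h in nhds 0. norm (b (f (a + h)) (g (a + h)) - b (f a) (g a) - (b (L h) (g a) + b (f a) (M h))) \<le> ?E * (norm h)\<^sup>2"
    using C D Kg(2) eventually_norm_less_1
  proof eventually_elim
    case (elim h)
    let ?r = "f (a + h) - f a - L h" and ?s = "g (a + h) - g a - M h"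
    have eq: "b (f (a + h)) (g (a + h)) - b (f a) (g a) - (b (L h) (g a) + b (f a) (M h)) =
        b ?r (g (a + h)) + b (L h) (g (a + h) - g a) + b (f a) ?s"
      by (simp add: b.diff_left b.diff_right)
    have ga: "norm (g (a + h)) \<le> norm (g a) + Kg"
    proof -
      have "norm (g (a + h)) \<le> norm (g a) + norm (g (a + h) - g a)" by (metis add.commute diff_add_cancel norm_triangle_ineq)
      also have "norm (g (a + h) - g a) \<le> Kg * 1"
        using elim(3,4) Kg(1) by (meson less_imp_le mult_left_mono order_trans)
      finally show ?thesis by simp
    qed
    have 1: "norm (b ?r (g (a + h))) \<le> (\<bar>C\<bar> * (norm h)\<^sup>2) * (norm (g a) + Kg) * K"
    proof -
      have "norm ?r \<le> \<bar>C\<bar> * (norm h)\<^sup>2" using elim(1) by (meson abs_ge_self mult_right_mono order_trans zero_le_power2)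
      then show ?thesis using ga K(1)
        by (intro order_trans[OF K(2)] mult_right_mono mult_mono) auto
    qed
    have 2: "norm (b (L h) (g (a + h) - g a)) \<le> (norm h * KL) * (Kg * norm h) * K"
      using elim(3) K(1) KL by (intro order_trans[OF K(2)] mult_right_mono mult_mono) auto
    have 3: "norm (b (f a) ?s) \<le> norm (f a) * (D * (norm h)\<^sup>2) * K"
      using elim(2) K(1) by (intro order_trans[OF K(2)] mult_right_mono mult_left_mono) auto
    have "norm (b ?r (g (a + h)) + b (L h) (g (a + h) - g a) + b (f a) ?s) \<le>
        (\<bar>C\<bar> * (norm h)\<^sup>2) * (norm (g a) + Kg) * K + (norm h * KL) * (Kg * norm h) * K + norm (f a) * (D * (norm h)\<^sup>2) * K"
      using 1 2 3 by (intro order_trans[OF norm_triangle_ineq] add_mono)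
    also have "\<dots> = ?E * (norm h)\<^sup>2" by (simp add: power2_eq_square algebra_simps)
    finally show ?case unfolding eq .
  qed
  moreover have "bounded_linear (\<lambda>h. b (L h) (g a) + b (f a) (M h))"
    by (intro bounded_linear_add bounded_linear_compose[OF b.bounded_linear_left L] bounded_linear_compose[OF b.bounded_linear_right M])
  ultimately show ?thesis unfolding expands_quadratically_def by blast
qed

section \<open>Odd polynomials with prescribed flat values\<close>

text \<open>
Odd polynomials, generated by the operations that have a counterpart for rectangular matrices: the product of three
factors corresponds to \<open>P X ** (Q X)\<^sup>* ** R X\<close>.
\<close>

inductive odd_map :: "(real \<Rightarrow> real) \<Rightarrow> bool" where
  ident: "odd_map (\<lambda>t. t)"
| add: "odd_map p \<Longrightarrow> odd_map q \<Longrightarrow> odd_map (\<lambda>t. p t + q t)"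
| scale: "odd_map p \<Longrightarrow> odd_map (\<lambda>t. c * p t)"
| triple: "odd_map p \<Longrightarrow> odd_map q \<Longrightarrow> odd_map r \<Longrightarrow> odd_map (\<lambda>t. p t * q t * r t)"

lemma odd_map_differentiable: "odd_map p \<Longrightarrow> p differentiable (at t)" for t :: real
  by (induction rule: odd_map.induct) (auto intro!: derivative_intros)

definition touches :: "(real \<Rightarrow> real) \<Rightarrow> real \<Rightarrow> real \<Rightarrow> bool" where
  "touches p \<mu> c \<longleftrightarrow> (\<exists>C. \<forall>\<^sub>F t in nhds \<mu>. \<bar>p t - c\<bar> \<le> C * (t - \<mu>)\<^sup>2)"

lemma touches_add: "touches p \<mu> c \<Longrightarrow> touches q \<mu> d \<Longrightarrow> touches (\<lambda>t. p t + q t) \<mu> (c + d)"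
  unfolding touches_def
proof (elim exE)
  fix C D assume "\<forall>\<^sub>F t in nhds \<mu>. \<bar>p t - c\<bar> \<le> C * (t - \<mu>)\<^sup>2" "\<forall>\<^sub>F t in nhds \<mu>. \<bar>q t - d\<bar> \<le> D * (t - \<mu>)\<^sup>2"
  then show "\<exists>E. \<forall>\<^sub>F t in nhds \<mu>. \<bar>p t + q t - (c + d)\<bar> \<le> E * (t - \<mu>)\<^sup>2"
  proof (intro exI[of _ "C + D"], eventually_elim)
    case (elim t) then show ?case by (simp add: distrib_right)
  qed
qed

lemma touches_zero_mult:
  assumes "touches p \<mu> 0" "isCont f \<mu>" shows "touches (\<lambda>t. p t * f t) \<mu> 0"
proof -
  obtain C where C: "\<forall>\<^sub>F t in nhds \<mu>. \<bar>p t - 0\<bar> \<le> C * (t - \<mu>)\<^sup>2" using assms(1) by (auto simp: touches_def)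
  have "((\<lambda>t. \<bar>f t\<bar>) \<longlongrightarrow> \<bar>f \<mu>\<bar>) (nhds \<mu>)"
    using assms(2) by (intro tendsto_rabs) (simp add: isCont_def tendsto_at_iff_tendsto_nhds)
  then have "\<forall>\<^sub>F t in nhds \<mu>. \<bar>f t\<bar> < \<bar>f \<mu>\<bar> + 1" by (rule order_tendstoD) simp
  with C have "\<forall>\<^sub>F t in nhds \<mu>. \<bar>p t * f t - 0\<bar> \<le> (C * (\<bar>f \<mu>\<bar> + 1)) * (t - \<mu>)\<^sup>2"
  proof eventually_elim
    case (elim t)
    have "\<bar>p t * f t\<bar> \<le> (C * (t - \<mu>)\<^sup>2) * (\<bar>f \<mu>\<bar> + 1)"
      unfolding abs_mult using elim by (intro mult_mono) auto
    then show ?case by (simp add: mult_ac)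
  qed
  then show ?thesis unfolding touches_def by blast
qed

lemma touches_square: "isCont f \<mu> \<Longrightarrow> touches (\<lambda>t. (t - \<mu>)\<^sup>2 * f t) \<mu> 0"
  by (rule touches_zero_mult) (auto simp: touches_def intro!: exI[of _ 1])

text \<open>
Start with \<open>t / \<nu>\<close> and multiply, for each \<open>\<mu>\<close>, by the square of \<open>(t\<^sup>2 - \<mu>\<^sup>2) / (\<nu>\<^sup>2 - \<mu>\<^sup>2)\<close>. These factors are even and
take the value \<open>1\<close> at \<open>\<nu>\<close>.
\<close>

lemma odd_bump:
  assumes "finite M" "\<nu> \<noteq> 0" "\<And>\<mu>. \<mu> \<in> M \<Longrightarrow> \<mu>\<^sup>2 \<noteq> \<nu>\<^sup>2"
  shows "\<exists>w. odd_map w \<and> w \<nu> = 1 \<and> (\<forall>\<mu>\<in>M. touches w \<mu> 0)"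
  using assms(1,3)
proof (induction M rule: finite_induct)
  case empty
  have "odd_map (\<lambda>t. (1 / \<nu>) * t)" by (intro odd_map.intros)
  then show ?case using \<open>\<nu> \<noteq> 0\<close> by force
next
  case (insert \<mu> M)
  then obtain w where w: "odd_map w" "w \<nu> = 1" "\<forall>\<mu>\<in>M. touches w \<mu> 0" by auto
  define d where "d = \<nu>\<^sup>2 - \<mu>\<^sup>2"
  have d: "d \<noteq> 0" using insert.prems[of \<mu>] by (simp add: d_def)
  have step: "odd_map (\<lambda>t. p t * ((t\<^sup>2 - \<mu>\<^sup>2) / d))" if "odd_map p" for p
  proof -
    have "odd_map (\<lambda>t. (1 / d) * (p t * t * t) + (- \<mu>\<^sup>2 / d) * p t)"
      by (intro odd_map.intros that)
    also have "(\<lambda>t. (1 / d) * (p t * t * t) + (- \<mu>\<^sup>2 / d) * p t) = (\<lambda>t. p t * ((t\<^sup>2 - \<mu>\<^sup>2) / d))"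
      by (simp add: fun_eq_iff power2_eq_square algebra_simps diff_divide_distrib)
    finally show ?thesis .
  qed
  define w' where "w' = (\<lambda>t. w t * ((t\<^sup>2 - \<mu>\<^sup>2) / d) * ((t\<^sup>2 - \<mu>\<^sup>2) / d))"
  have "odd_map w'" unfolding w'_def by (intro step w)
  moreover have "w' \<nu> = 1" using d w(2) by (simp add: w'_def d_def)
  moreover have "touches w' \<mu>' 0" if "\<mu>' \<in> M" for \<mu>'
  proof -
    have "touches (\<lambda>t. w t * (((t\<^sup>2 - \<mu>\<^sup>2) / d) * ((t\<^sup>2 - \<mu>\<^sup>2) / d))) \<mu>' 0"
      using w(3) that d by (intro touches_zero_mult) (auto intro!: continuous_intros)
    then show ?thesis by (simp add: w'_def mult.assoc)
  qed
  moreover have "touches w' \<mu> 0"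
  proof -
    have "isCont w \<mu>" using odd_map_differentiable[OF w(1)] by (rule differentiable_imp_continuous_within)
    then have "touches (\<lambda>t. (t - \<mu>)\<^sup>2 * (w t * ((t + \<mu>) / d) * ((t + \<mu>) / d))) \<mu> 0"
      using d by (intro touches_square continuous_intros) auto
    also have "(\<lambda>t. (t - \<mu>)\<^sup>2 * (w t * ((t + \<mu>) / d) * ((t + \<mu>) / d))) = w'"
      using d by (simp add: w'_def fun_eq_iff power2_eq_square field_simps)
    finally show ?thesis .
  qed
  ultimately show ?case by (intro exI[of _ w']) auto
qed

text \<open>
The odd polynomial \<open>(3 w - w\<^sup>3) / 2\<close> in the previous bump \<open>w\<close> keeps the double zeros of \<open>w\<close>, and it is flat where \<open>w = 1\<close>,
since it differs from \<open>1\<close> by \<open>- (w - 1)\<^sup>2 (w + 2) / 2\<close>.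
\<close>

lemma odd_step:
  assumes "finite M" "\<nu> \<noteq> 0" "\<And>\<mu>. \<mu> \<in> M \<Longrightarrow> \<mu>\<^sup>2 \<noteq> \<nu>\<^sup>2"
  shows "\<exists>p. odd_map p \<and> touches p \<nu> 1 \<and> (\<forall>\<mu>\<in>M. touches p \<mu> 0)"
proof -
  obtain w where w: "odd_map w" "w \<nu> = 1" "\<forall>\<mu>\<in>M. touches w \<mu> 0" using odd_bump[OF assms] by blast
  have cont: "isCont w \<mu>" for \<mu> using odd_map_differentiable[OF w(1)] by (rule differentiable_imp_continuous_within)
  define p where "p = (\<lambda>t. (3/2) * w t + (- 1/2) * (w t * w t * w t))"
  have "odd_map p" unfolding p_def by (intro odd_map.intros w)
  moreover have "touches p \<mu> 0" if "\<mu> \<in> M" for \<mu>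
  proof -
    have "touches (\<lambda>t. w t * (3/2 - (w t)\<^sup>2/2)) \<mu> 0"
      using w(3) that cont by (intro touches_zero_mult continuous_intros) auto
    also have "(\<lambda>t. w t * (3/2 - (w t)\<^sup>2/2)) = p" by (simp add: p_def fun_eq_iff power2_eq_square algebra_simps)
    finally show ?thesis .
  qed
  moreover have "touches p \<nu> 1"
  proof -
    obtain D where "(w has_real_derivative D) (at \<nu>)"
      using odd_map_differentiable[OF w(1)] by (auto simp: real_differentiable_def)
    then have "((\<lambda>t. \<bar>(w t - w \<nu>) / (t - \<nu>)\<bar>) \<longlongrightarrow> \<bar>D\<bar>) (at \<nu>)"
      by (intro tendsto_rabs) (simp add: has_field_derivative_iff)
    then have "\<forall>\<^sub>F t in at \<nu>. \<bar>(w t - w \<nu>) / (t - \<nu>)\<bar> < \<bar>D\<bar> + 1" by (rule order_tendstoD) simp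
    then have "\<forall>\<^sub>F t in at \<nu>. \<bar>w t - 1\<bar> \<le> (\<bar>D\<bar> + 1) * \<bar>t - \<nu>\<bar>"
      unfolding eventually_at_filter
      by eventually_elim (auto simp: w(2) abs_divide divide_less_eq)
    then have lip: "\<forall>\<^sub>F t in nhds \<nu>. \<bar>w t - 1\<bar> \<le> (\<bar>D\<bar> + 1) * \<bar>t - \<nu>\<bar>"
      unfolding eventually_at_filter by eventually_elim (use w(2) in auto)
    have "\<forall>\<^sub>F t in nhds \<nu>. \<bar>(w t - 1)\<^sup>2 - 0\<bar> \<le> (\<bar>D\<bar> + 1)\<^sup>2 * (t - \<nu>)\<^sup>2"
      using lip
    proof eventually_elim
      case (elim t)
      then have "\<bar>w t - 1\<bar>\<^sup>2 \<le> ((\<bar>D\<bar> + 1) * \<bar>t - \<nu>\<bar>)\<^sup>2" by (intro power_mono) auto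
      then show ?case by (simp add: power_mult_distrib)
    qed
    then have "touches (\<lambda>t. (w t - 1)\<^sup>2) \<nu> 0" unfolding touches_def by blast
    then have "touches (\<lambda>t. (w t - 1)\<^sup>2 * (- (w t + 2) / 2)) \<nu> 0"
      using cont by (intro touches_zero_mult continuous_intros) auto
    moreover have "touches (\<lambda>t. 1) \<nu> 1" unfolding touches_def by (intro exI[of _ 0]) simp
    ultimately have "touches (\<lambda>t. (w t - 1)\<^sup>2 * (- (w t + 2) / 2) + 1) \<nu> (0 + 1)" by (rule touches_add)
    also have "(\<lambda>t. (w t - 1)\<^sup>2 * (- (w t + 2) / 2) + 1) = p"
      by (simp add: p_def fun_eq_iff power2_eq_square field_simps)
    finally show ?thesis by simp
  qed
  ultimately show ?thesis by blast
qed

lemma odd_interpolation: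
  assumes "finite A" "\<And>\<nu>. \<nu> \<in> A \<Longrightarrow> 0 \<le> \<nu>" "c 0 = (0::real)"
  obtains p where "odd_map p" "\<And>\<nu>. \<nu> \<in> A \<Longrightarrow> touches p \<nu> (c \<nu>)"
proof -
  have "\<exists>p. odd_map p \<and> (\<forall>\<nu>\<in>A. touches p \<nu> (if \<nu> \<in> B then c \<nu> else 0))" if "finite B" "B \<subseteq> A - {0}" for B
    using that
  proof (induction B rule: finite_induct)
    case empty
    have "odd_map (\<lambda>t. 0 * t)" by (intro odd_map.intros)
    then show ?case by (intro exI[of _ "\<lambda>t. 0 * t"]) (auto simp: touches_def intro!: exI[of _ 0])
  next
    case (insert \<nu> B)
    then obtain p where p: "odd_map p" "\<forall>\<mu>\<in>A. touches p \<mu> (if \<mu> \<in> B then c \<mu> else 0)" by auto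
    have "\<mu>\<^sup>2 \<noteq> \<nu>\<^sup>2" if "\<mu> \<in> A - {\<nu>}" for \<mu>
      using that insert.prems assms(2)[of \<mu>] assms(2)[of \<nu>] by (auto simp: power2_eq_iff_nonneg)
    then obtain q where q: "odd_map q" "touches q \<nu> 1" "\<forall>\<mu>\<in>A - {\<nu>}. touches q \<mu> 0"
      using odd_step[of "A - {\<nu>}" \<nu>] assms(1) insert.prems by auto
    have scale: "touches (\<lambda>t. c \<nu> * q t) \<mu> (c \<nu> * d)" if d: "touches q \<mu> d" for \<mu> d
    proof -
      obtain C where "\<forall>\<^sub>F t in nhds \<mu>. \<bar>q t - d\<bar> \<le> C * (t - \<mu>)\<^sup>2" using d by (auto simp: touches_def)
      then have "\<forall>\<^sub>F t in nhds \<mu>. \<bar>c \<nu> * q t - c \<nu> * d\<bar> \<le> (\<bar>c \<nu>\<bar> * C) * (t - \<mu>)\<^sup>2"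
        by eventually_elim (simp add: abs_mult mult_left_mono mult.assoc flip: right_diff_distrib)
      then show ?thesis unfolding touches_def by blast
    qed
    have "touches (\<lambda>t. p t + c \<nu> * q t) \<mu> (if \<mu> \<in> insert \<nu> B then c \<mu> else 0)" if "\<mu> \<in> A" for \<mu>
    proof (cases "\<mu> = \<nu>")
      case True
      then have "touches p \<mu> 0" using p(2) that insert.hyps by auto
      from touches_add[OF this scale[of \<mu> 1]] show ?thesis using True q(2) by simp
    next
      case False
      from touches_add[OF p(2)[rule_format, OF that] scale[of \<mu> 0]] show ?thesis using False q(3) that by simp
    qed
    moreover have "odd_map (\<lambda>t. p t + c \<nu> * q t)" by (intro odd_map.intros p q)
    ultimately show ?case by (intro exI[of _ "\<lambda>t. p t + c \<nu> * q t"]) auto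
  qed
  from this[of "A - {0}"] assms(1) obtain p where p: "odd_map p" "\<forall>\<nu>\<in>A. touches p \<nu> (if \<nu> \<in> A - {0} then c \<nu> else 0)"
    by auto
  have "touches p \<nu> (c \<nu>)" if "\<nu> \<in> A" for \<nu>
    using p(2)[rule_format, OF that] that assms(3) by (cases "\<nu> = 0") auto
  with p(1) that show ?thesis by blast
qed

context wide_shape begin

text \<open>
The inner unitary factors cancel, and the product of the three diagonal matrices is diagonal.
\<close>

lemma recompose_triple:
  fixes U :: "('a::rc_field, 'm, 'm) matrix"
  assumes U: "unitary_matrix U" and V: "unitary_matrix V"
  shows "recompose U a V ** conj_transpose (recompose U b V) ** recompose U c V = recompose U (\<chi> i. a $ i * b $ i * c $ i) V"
proof -
  have VV: "conj_transpose V ** V = mat 1" and UU: "conj_transpose U ** U = mat 1"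
    using U V by (auto simp: unitary_matrix_def)
  have D2: "((diag_zero a :: ('a, 'm, 'n) matrix) ** conj_transpose (diag_zero b)) $ i $ j = (if i = j then of_real (a $ i * b $ i) else 0)" for i j
  proof -
    have "((diag_zero a :: ('a, 'm, 'n) matrix) ** conj_transpose (diag_zero b)) $ i $ j =
      (\<Sum>l\<in>UNIV. if l = diag_col i then (if i = j then of_real (a $ i * b $ i) else 0) else 0)"
      unfolding matrix_mult_nth by (intro sum.cong) (auto simp: diag_zero_nth)
    then show ?thesis by simp
  qed
  have D3: "(diag_zero a :: ('a, 'm, 'n) matrix) ** conj_transpose (diag_zero b) ** diag_zero c = (diag_zero (\<chi> i. a $ i * b $ i * c $ i) :: ('a, 'm, 'n) matrix)"
  proof -
    have "((diag_zero a :: ('a, 'm, 'n) matrix) ** conj_transpose (diag_zero b) ** (diag_zero c :: ('a, 'm, 'n) matrix)) $ i $ k =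
      (\<Sum>j\<in>UNIV. if j = i then of_real (a $ i * b $ i) * diag_zero c $ i $ k else 0)" for i k
      unfolding matrix_mult_nth[of _ "diag_zero c"] D2 by (intro sum.cong) auto
    then show ?thesis by (simp add: vec_eq_iff diag_zero_nth)
  qed
  have "recompose U a V ** conj_transpose (recompose U b V) ** recompose U c V =
    U ** diag_zero a ** (conj_transpose V ** V) ** conj_transpose (diag_zero b) ** (conj_transpose U ** U) ** diag_zero c ** conj_transpose V"
    by (simp add: conj_transpose_mult matrix_mul_assoc)
  also have "\<dots> = U ** ((diag_zero a :: ('a, 'm, 'n) matrix) ** conj_transpose (diag_zero b) ** diag_zero c) ** conj_transpose V"
    by (simp only: VV UU matrix_mul_rid matrix_mul_assoc)
  finally show ?thesis by (simp only: D3)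
qed

lemma odd_map_matrix_lift:
  assumes "odd_map p"
  shows "\<exists>P :: ('a::rc_field, 'm, 'n) matrix \<Rightarrow> _. (\<forall>a. \<exists>L. expands_quadratically P a L) \<and>
    (\<forall>U V s. unitary_matrix U \<longrightarrow> unitary_matrix V \<longrightarrow> P (recompose U s V) = recompose U (\<chi> i. p (s $ i)) V)"
  using assms
proof (induction rule: odd_map.induct)
  case ident
  have "\<exists>L. expands_quadratically (\<lambda>X :: ('a, 'm, 'n) matrix. X) a L" for a
    using expands_quadratically_bounded_linear[OF bounded_linear_ident] by blast
  then show ?case by (intro exI[of _ "\<lambda>X. X"]) auto
next
  case (add p q)
  then obtain P Q :: "('a, 'm, 'n) matrix \<Rightarrow> ('a, 'm, 'n) matrix"
    where P: "\<forall>a. \<exists>L. expands_quadratically P a L"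
        "\<forall>U V s. unitary_matrix U \<longrightarrow> unitary_matrix V \<longrightarrow> P (recompose U s V) = recompose U (\<chi> i. p (s $ i)) V"
      and Q: "\<forall>a. \<exists>L. expands_quadratically Q a L"
        "\<forall>U V s. unitary_matrix U \<longrightarrow> unitary_matrix V \<longrightarrow> Q (recompose U s V) = recompose U (\<chi> i. q (s $ i)) V"
    by blast
  have "\<exists>L. expands_quadratically (\<lambda>X. P X + Q X) a L" for a
    using P(1) Q(1) expands_quadratically_add by blast
  moreover have "(\<chi> i. p (s $ i) + q (s $ i)) = (\<chi> i. p (s $ i)) + (\<chi> i. q (s $ i))" for s :: "(real, 'm) vec"
    by (simp add: vec_eq_iff)
  ultimately show ?case using P(2) Q(2) by (intro exI[of _ "\<lambda>X. P X + Q X"]) (simp add: recompose_add)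
next
  case (scale p c)
  then obtain P :: "('a, 'm, 'n) matrix \<Rightarrow> ('a, 'm, 'n) matrix"
    where P: "\<forall>a. \<exists>L. expands_quadratically P a L"
        "\<forall>U V s. unitary_matrix U \<longrightarrow> unitary_matrix V \<longrightarrow> P (recompose U s V) = recompose U (\<chi> i. p (s $ i)) V"
    by blast
  have "\<exists>L. expands_quadratically (\<lambda>X. c *\<^sub>R P X) a L" for a
    using P(1) expands_quadratically_compose_linear[OF bounded_linear_scaleR_right[of c]] by blast
  moreover have "(\<chi> i. c * p (s $ i)) = c *\<^sub>R (\<chi> i. p (s $ i))" for s :: "(real, 'm) vec"
    by (simp add: vec_eq_iff)
  ultimately show ?case using P(2) by (intro exI[of _ "\<lambda>X. c *\<^sub>R P X"]) (simp add: recompose_scaleR)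
next
  case (triple p q r)
  then obtain P Q R :: "('a, 'm, 'n) matrix \<Rightarrow> ('a, 'm, 'n) matrix"
    where P: "\<forall>a. \<exists>L. expands_quadratically P a L"
        "\<forall>U V s. unitary_matrix U \<longrightarrow> unitary_matrix V \<longrightarrow> P (recompose U s V) = recompose U (\<chi> i. p (s $ i)) V"
      and Q: "\<forall>a. \<exists>L. expands_quadratically Q a L"
        "\<forall>U V s. unitary_matrix U \<longrightarrow> unitary_matrix V \<longrightarrow> Q (recompose U s V) = recompose U (\<chi> i. q (s $ i)) V"
      and R: "\<forall>a. \<exists>L. expands_quadratically R a L"
        "\<forall>U V s. unitary_matrix U \<longrightarrow> unitary_matrix V \<longrightarrow> R (recompose U s V) = recompose U (\<chi> i. r (s $ i)) V"
    by blast
  have "\<exists>L. expands_quadratically (\<lambda>X. P X ** conj_transpose (Q X) ** R X) a L" for a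
  proof -
    obtain LP LQ LR where L: "expands_quadratically P a LP" "expands_quadratically Q a LQ" "expands_quadratically R a LR"
      using P(1) Q(1) R(1) by blast
    note expands_quadratically_bilinear[OF bounded_bilinear_matrix_mult
      expands_quadratically_bilinear[OF bounded_bilinear_matrix_mult L(1)
        expands_quadratically_compose_linear[OF bounded_linear_conj_transpose L(2)]] L(3)]
    then show ?thesis by blast
  qed
  then show ?case using P(2) Q(2) R(2)
    by (intro exI[of _ "\<lambda>X. P X ** conj_transpose (Q X) ** R X"]) (simp add: recompose_triple)
qed

text \<open>
The conditions on \<open>c\<close> say that \<open>c\<close> is a function of \<open>\<sigma>\<close> that vanishes at \<open>0\<close>. Such a function is touched to second
order by an odd polynomial at the values of \<open>\<sigma>\<close>.
\<close>

lemma frozen_values_lift: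
  fixes \<sigma> c :: "(real, 'm) vec"
  assumes nonneg: "\<And>i. 0 \<le> \<sigma> $ i" and eq: "\<And>i j. \<sigma> $ i = \<sigma> $ j \<Longrightarrow> c $ i = c $ j"
    and zero: "\<And>i. \<sigma> $ i = 0 \<Longrightarrow> c $ i = 0"
  shows "\<exists>(P :: ('a::rc_field, 'm, 'n) matrix \<Rightarrow> ('a, 'm, 'n) matrix) K.
    (\<forall>a. \<exists>L. expands_quadratically P a L) \<and>
    (\<forall>\<^sub>F s in nhds \<sigma>. \<forall>U V. unitary_matrix U \<longrightarrow> unitary_matrix V \<longrightarrow>
       norm (P (recompose U s V) - recompose U c V) \<le> K * (norm (s - \<sigma>))\<^sup>2)"
proof -
  \<comment> \<open>Independent of the choice, as \<open>c\<close> agrees wherever \<open>\<sigma>\<close> does; an odd polynomial can only take the value 0 at 0.\<close>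
  define c' where "c' \<nu> = (if \<nu> = 0 then 0 else c $ (SOME i. \<sigma> $ i = \<nu>))" for \<nu>
  have c': "c' (\<sigma> $ i) = c $ i" for i
  proof -
    have "\<sigma> $ (SOME j. \<sigma> $ j = \<sigma> $ i) = \<sigma> $ i" by (rule someI[of _ i]) simp
    then have "c $ (SOME j. \<sigma> $ j = \<sigma> $ i) = c $ i" by (rule eq)
    then show ?thesis using zero[of i] by (simp add: c'_def)
  qed
  obtain p where p: "odd_map p" "\<And>\<nu>. \<nu> \<in> range (\<lambda>i. \<sigma> $ i) \<Longrightarrow> touches p \<nu> (c' \<nu>)"
    using odd_interpolation[of "range (\<lambda>i. \<sigma> $ i)" c'] nonneg by (auto simp: c'_def)
  obtain P :: "('a, 'm, 'n) matrix \<Rightarrow> ('a, 'm, 'n) matrix"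
    where P: "\<forall>a. \<exists>L. expands_quadratically P a L"
        "\<And>U V s. unitary_matrix U \<Longrightarrow> unitary_matrix V \<Longrightarrow> P (recompose U s V) = recompose U (\<chi> i. p (s $ i)) V"
    using odd_map_matrix_lift[OF p(1)] by blast
  have "\<forall>i. \<exists>C. \<forall>\<^sub>F t in nhds (\<sigma> $ i). \<bar>p t - c $ i\<bar> \<le> C * (t - \<sigma> $ i)\<^sup>2"
  proof
    fix i
    show "\<exists>C. \<forall>\<^sub>F t in nhds (\<sigma> $ i). \<bar>p t - c $ i\<bar> \<le> C * (t - \<sigma> $ i)\<^sup>2"
      using p(2)[of "\<sigma> $ i"] unfolding touches_def c' by simp
  qed
  from choice[OF this] obtain C where C: "\<forall>i. \<forall>\<^sub>F t in nhds (\<sigma> $ i). \<bar>p t - c $ i\<bar> \<le> C i * (t - \<sigma> $ i)\<^sup>2" ..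
  have "\<forall>\<^sub>F s in nhds \<sigma>. \<bar>p (s $ i) - c $ i\<bar> \<le> C i * (s $ i - \<sigma> $ i)\<^sup>2" for i
    by (rule eventually_compose_filterlim[OF C[rule_format, of i]]) (intro tendsto_vec_nth filterlim_ident)
  then have "\<forall>\<^sub>F s in nhds \<sigma>. \<forall>i. \<bar>p (s $ i) - c $ i\<bar> \<le> C i * (s $ i - \<sigma> $ i)\<^sup>2"
    by (intro eventually_all_finite) auto
  then have "\<forall>\<^sub>F s in nhds \<sigma>. \<forall>U V. unitary_matrix U \<longrightarrow> unitary_matrix V \<longrightarrow>
       norm (P (recompose U s V) - recompose U c V) \<le> (\<Sum>i\<in>UNIV. \<bar>C i\<bar>) * (norm (s - \<sigma>))\<^sup>2"
  proof eventually_elim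
    case (elim s)
    have "norm ((\<chi> i. p (s $ i)) - c) \<le> (\<Sum>i\<in>UNIV. \<bar>p (s $ i) - c $ i\<bar>)"
      using norm_le_l1_cart[of "(\<chi> i. p (s $ i)) - c"] by simp
    also have "\<dots> \<le> (\<Sum>i\<in>UNIV. \<bar>C i\<bar> * (norm (s - \<sigma>))\<^sup>2)"
    proof (rule sum_mono)
      fix i
      have "\<bar>s $ i - \<sigma> $ i\<bar> \<le> norm (s - \<sigma>)" using component_le_norm_cart[of "s - \<sigma>" i] by simp
      then have "(s $ i - \<sigma> $ i)\<^sup>2 \<le> (norm (s - \<sigma>))\<^sup>2" by (metis abs_ge_zero power2_abs power_mono)
      then have "C i * (s $ i - \<sigma> $ i)\<^sup>2 \<le> \<bar>C i\<bar> * (norm (s - \<sigma>))\<^sup>2" by (intro mult_mono) auto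
      then show "\<bar>p (s $ i) - c $ i\<bar> \<le> \<bar>C i\<bar> * (norm (s - \<sigma>))\<^sup>2" using elim[rule_format, of i] by linarith
    qed
    finally have le: "norm ((\<chi> i. p (s $ i)) - c) \<le> (\<Sum>i\<in>UNIV. \<bar>C i\<bar>) * (norm (s - \<sigma>))\<^sup>2"
      by (simp add: sum_distrib_right)
    show ?case
    proof (intro allI impI)
      fix U :: "('a, 'm, 'm) matrix" and V :: "('a, 'n, 'n) matrix"
      assume UV: "unitary_matrix U" "unitary_matrix V"
      have "norm (P (recompose U s V) - recompose U c V) = norm (recompose U ((\<chi> i. p (s $ i)) - c) V)"
        by (simp add: P(2)[OF UV] recompose_diff)
      then show "norm (P (recompose U s V) - recompose U c V) \<le> (\<Sum>i\<in>UNIV. \<bar>C i\<bar>) * (norm (s - \<sigma>))\<^sup>2"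
        using le by (simp add: norm_recompose[OF UV])
    qed
  qed
  with P(1) show ?thesis by blast
qed

end

section \<open>Directional derivatives\<close>

lemma has_directional_derivative_unique:
  assumes "has_directional_derivative F z h d" "has_directional_derivative F z h e" shows "d = e"
  using assms unfolding has_directional_derivative_def by (rule tendsto_unique[rotated]) simp

lemma has_directional_derivative_0: "has_directional_derivative F z 0 0"
  unfolding has_directional_derivative_def by simp

lemma has_directional_derivative_scaleR:
  assumes "has_directional_derivative F z h d" "0 < r"
  shows "has_directional_derivative F z (r *\<^sub>R h) (r *\<^sub>R d)"
proof -
  have "filterlim (\<lambda>t. r * t) (at_right 0) (at_right (0::real))"
  proof (rule filterlim_at_withinI)
    show "((\<lambda>t. r * t) \<longlongrightarrow> 0) (at_right 0)" by (auto intro!: tendsto_eq_intros)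
    show "\<forall>\<^sub>F t in at_right 0. r * t \<in> {0<..} - {0}"
      using \<open>0 < r\<close> by (auto simp: eventually_at_filter)
  qed
  from filterlim_compose[OF assms(1)[unfolded has_directional_derivative_def] this]
  have lim: "((\<lambda>t. r *\<^sub>R ((F (z + (r * t) *\<^sub>R h) - F z) /\<^sub>R (r * t))) \<longlongrightarrow> r *\<^sub>R d) (at_right 0)"
    by (intro tendsto_scaleR tendsto_const) 
  have cancel: "r *\<^sub>R (v /\<^sub>R (r * t)) = v /\<^sub>R t" for v :: 'b and t
  proof -
    have "r * inverse (r * t) = inverse t" using \<open>0 < r\<close> by (cases "t = 0") (auto simp: field_simps)
    then show ?thesis by (simp only: scaleR_scaleR)
  qed
  show ?thesis using lim unfolding cancel has_directional_derivative_def by (simp add: mult.commute)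
qed

lemma B_differentiable_order_atE:
  assumes "B_differentiable_order_at \<rho> F z"
  obtains F' C \<delta> where "\<And>h. has_directional_derivative F z h (F' h)" "0 \<le> C" "0 < \<delta>"
    "\<And>h. norm h < \<delta> \<Longrightarrow> norm (F (z + h) - F z - F' h) \<le> C * norm h powr (1 + \<rho>)"
proof -
  obtain F' where F': "\<And>h. has_directional_derivative F z h (F' h)"
    and O: "(\<lambda>h. norm (F (z + h) - F z - F' h)) \<in> O[at 0](\<lambda>h. norm h powr (1 + \<rho>))"
    using assms unfolding B_differentiable_order_at_def by blast
  obtain C where C: "C > 0" "\<forall>\<^sub>F h in at 0. norm (norm (F (z + h) - F z - F' h)) \<le> C * norm (norm h powr (1 + \<rho>))"
    using landau_o.bigE[OF O] by blast
  then obtain \<delta> where \<delta>: "\<delta> > 0" "\<And>h. h \<noteq> 0 \<Longrightarrow> norm h < \<delta> \<Longrightarrow> norm (F (z + h) - F z - F' h) \<le> C * norm h powr (1 + \<rho>)"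
    unfolding eventually_at by (auto simp: dist_norm)
  have "F' 0 = 0" using has_directional_derivative_unique[OF F' has_directional_derivative_0] .
  then have "norm (F (z + h) - F z - F' h) \<le> C * norm h powr (1 + \<rho>)" if "norm h < \<delta>" for h
    using \<delta>(2)[of h] that C(1) by (cases "h = 0") auto
  then show ?thesis using that[of F' C \<delta>] F' C(1) \<delta>(1) by auto
qed

text \<open>
For a positively homogeneous candidate the estimate alone suffices, because along a ray the error divided by \<open>t\<close> is of
order \<open>t powr \<rho>\<close>.
\<close>

lemma B_differentiable_order_atI:
  assumes \<rho>: "0 < \<rho>" and \<delta>: "0 < \<delta>"
    and hom: "\<And>t h. 0 < t \<Longrightarrow> F' (t *\<^sub>R h) = t *\<^sub>R F' h"
    and est: "\<And>h. h \<noteq> 0 \<Longrightarrow> norm h < \<delta> \<Longrightarrow> norm (F (z + h) - F z - F' h) \<le> C * norm h powr (1 + \<rho>)"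
  shows "B_differentiable_order_at \<rho> F z"
proof -
  have "F' 0 = 0" using hom[of 2 0] by (simp add: scaleR_2)
  have "has_directional_derivative F z h (F' h)" for h
  proof (cases "h = 0")
    case True
    then show ?thesis using has_directional_derivative_0 \<open>F' 0 = 0\<close> by simp
  next
    case False
    have small: "\<forall>\<^sub>F t in at_right 0. t * norm h < \<delta>"
      by (rule order_tendstoD(2)[where y=0]) (auto intro!: tendsto_eq_intros simp: \<delta>)
    have "\<forall>\<^sub>F t in at_right (0::real). 0 < t" by (simp add: eventually_at_filter)
    with small have "\<forall>\<^sub>F t in at_right 0. norm ((F (z + t *\<^sub>R h) - F z) /\<^sub>R t - F' h) \<le> (C * norm h powr (1 + \<rho>)) * t powr \<rho>"
    proof eventually_elim
      case (elim t)
      have "(F (z + t *\<^sub>R h) - F z) /\<^sub>R t - F' h = (F (z + t *\<^sub>R h) - F z - F' (t *\<^sub>R h)) /\<^sub>R t"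
        using elim by (simp add: hom scaleR_diff_right)
      then have "norm ((F (z + t *\<^sub>R h) - F z) /\<^sub>R t - F' h) = norm (F (z + t *\<^sub>R h) - F z - F' (t *\<^sub>R h)) / t"
        using elim by (simp add: divide_inverse mult.commute)
      also have "\<dots> \<le> C * norm (t *\<^sub>R h) powr (1 + \<rho>) / t"
        using est[of "t *\<^sub>R h"] elim False by (intro divide_right_mono) auto
      also have "\<dots> = (C * norm h powr (1 + \<rho>)) * t powr \<rho>"
        using elim by (simp add: powr_mult powr_add)
      finally show ?case .
    qed
    moreover have "((\<lambda>t. (C * norm h powr (1 + \<rho>)) * t powr \<rho>) \<longlongrightarrow> 0) (at_right 0)"
    proof -
      have "((\<lambda>t. t powr \<rho>) \<longlongrightarrow> 0 powr \<rho>) (at_right (0::real))"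
        using \<rho> by (intro tendsto_powr' tendsto_intros) (auto simp: eventually_at_filter)
      from tendsto_mult[OF tendsto_const this] show ?thesis by simp
    qed
    ultimately have "((\<lambda>t. (F (z + t *\<^sub>R h) - F z) /\<^sub>R t - F' h) \<longlongrightarrow> 0) (at_right 0)"
      by (rule Lim_null_comparison)
    then show ?thesis unfolding has_directional_derivative_def by (rule LIM_zero_cancel)
  qed
  moreover have "(\<lambda>h. norm (F (z + h) - F z - F' h)) \<in> O[at 0](\<lambda>h. norm h powr (1 + \<rho>))"
    using \<delta> est by (intro bigoI[where c=C]) (auto simp: eventually_at dist_norm)
  ultimately show ?thesis unfolding B_differentiable_order_at_def by blast
qed

lemma directional_derivative_lipschitz:
  assumes "locally_lipschitz_near g \<sigma>"
  obtains L where "0 \<le> L"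
    "\<And>h k d e. has_directional_derivative g \<sigma> h d \<Longrightarrow> has_directional_derivative g \<sigma> k e \<Longrightarrow> norm (d - e) \<le> L * norm (h - k)"
proof -
  obtain U L where U: "open U" "\<sigma> \<in> U" "L-lipschitz_on U g"
    using assms unfolding locally_lipschitz_near_def by blast
  have L: "0 \<le> L" using U(3) by (rule lipschitz_on_nonneg)
  have in_U: "\<forall>\<^sub>F t in at_right 0. \<sigma> + t *\<^sub>R h \<in> U" for h
    by (rule topological_tendstoD[OF _ U(1)]) (auto intro!: tendsto_eq_intros U(2))
  show ?thesis
  proof (rule that[OF L])
    fix h k d e assume d: "has_directional_derivative g \<sigma> h d" and e: "has_directional_derivative g \<sigma> k e"
    have lim: "((\<lambda>t. norm ((g (\<sigma> + t *\<^sub>R h) - g \<sigma>) /\<^sub>R t - (g (\<sigma> + t *\<^sub>R k) - g \<sigma>) /\<^sub>R t)) \<longlongrightarrow> norm (d - e)) (at_right 0)"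
      using d e unfolding has_directional_derivative_def by (intro tendsto_norm tendsto_diff)
    have "\<forall>\<^sub>F t in at_right (0::real). 0 < t" by (simp add: eventually_at_filter)
    with in_U[of h] in_U[of k]
    have "\<forall>\<^sub>F t in at_right 0. norm ((g (\<sigma> + t *\<^sub>R h) - g \<sigma>) /\<^sub>R t - (g (\<sigma> + t *\<^sub>R k) - g \<sigma>) /\<^sub>R t) \<le> L * norm (h - k)"
    proof eventually_elim
      case (elim t)
      have "norm ((g (\<sigma> + t *\<^sub>R h) - g \<sigma>) /\<^sub>R t - (g (\<sigma> + t *\<^sub>R k) - g \<sigma>) /\<^sub>R t) = norm (g (\<sigma> + t *\<^sub>R h) - g (\<sigma> + t *\<^sub>R k)) / t"
        using elim(3) by (simp add: divide_inverse mult.commute flip: scaleR_diff_right)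
      also have "\<dots> \<le> L * norm ((\<sigma> + t *\<^sub>R h) - (\<sigma> + t *\<^sub>R k)) / t"
        using lipschitz_onD[OF U(3) elim(1,2)] elim(3) by (intro divide_right_mono) (auto simp: dist_norm)
      also have "\<dots> = L * norm (h - k)"
        using elim(3) by (simp flip: scaleR_diff_right)
      finally show ?case .
    qed
    then show "norm (d - e) \<le> L * norm (h - k)" by (rule tendsto_upperbound[OF lim]) simp
  qed
qed

lemma directional_derivative_signed_permutation:
  assumes sym: "absolutely_symmetric_on S g" and S: "open S" "\<sigma> \<in> S"
    and Q: "signed_permutation_matrix Q" "Q *v \<sigma> = \<sigma>"
    and d: "has_directional_derivative g \<sigma> h d"
  shows "has_directional_derivative g \<sigma> (Q *v h) (Q *v d)"
proof -
  have in_S: "\<forall>\<^sub>F t in at_right 0. \<sigma> + t *\<^sub>R h \<in> S"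
    by (rule topological_tendstoD[OF _ S(1)]) (auto intro!: tendsto_eq_intros S(2))
  have lin: "bounded_linear (\<lambda>x. Q *v x)" by (rule matrix_vector_mul_bounded_linear)
  have g\<sigma>: "g \<sigma> = Q *v g \<sigma>" using sym S(2) Q unfolding absolutely_symmetric_on_def by metis
  have "((\<lambda>t. Q *v ((g (\<sigma> + t *\<^sub>R h) - g \<sigma>) /\<^sub>R t)) \<longlongrightarrow> Q *v d) (at_right 0)"
    using d unfolding has_directional_derivative_def by (rule bounded_linear.tendsto[OF lin])
  moreover have "\<forall>\<^sub>F t in at_right 0. Q *v ((g (\<sigma> + t *\<^sub>R h) - g \<sigma>) /\<^sub>R t) = (g (\<sigma> + t *\<^sub>R (Q *v h)) - g \<sigma>) /\<^sub>R t"
    using in_S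
  proof eventually_elim
    case (elim t)
    have "g (Q *v (\<sigma> + t *\<^sub>R h)) = Q *v g (\<sigma> + t *\<^sub>R h)"
      using sym elim Q(1) unfolding absolutely_symmetric_on_def by blast
    moreover have "Q *v (\<sigma> + t *\<^sub>R h) = \<sigma> + t *\<^sub>R (Q *v h)"
      by (simp add: matrix_vector_right_distrib Q(2) matrix_vector_mult_scaleR)
    ultimately show ?case
      using g\<sigma> by (simp add: matrix_vector_mult_scaleR matrix_vector_mult_diff_distrib)
  qed
  ultimately show ?thesis unfolding has_directional_derivative_def by (rule Lim_transform_eventually)
qed

text \<open>
The transposition of \<open>i\<close> and \<open>j\<close>, or the change of sign at \<open>i\<close>, fixes \<open>\<sigma>\<close> and therefore \<open>g \<sigma>\<close>.
\<close>

lemma absolutely_symmetric_values: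
  fixes g :: "(real, 'm::finite) vec \<Rightarrow> (real, 'm) vec"
  assumes sym: "absolutely_symmetric_on S g" and "\<sigma> \<in> S"
  shows "\<sigma> $ i = \<sigma> $ j \<Longrightarrow> g \<sigma> $ i = g \<sigma> $ j" "\<sigma> $ i = 0 \<Longrightarrow> g \<sigma> $ i = 0"
proof -
  have fix_g: "Q *v g \<sigma> = g \<sigma>" if "signed_permutation_matrix Q" "Q *v \<sigma> = \<sigma>" for Q
    using assms that unfolding absolutely_symmetric_on_def by metis
  show "g \<sigma> $ i = g \<sigma> $ j" if "\<sigma> $ i = \<sigma> $ j"
  proof -
    let ?Q = "signed_perm (Transposition.transpose i j) (\<lambda>_. 1)"
    have "signed_permutation_matrix ?Q" by (rule signed_permutation_matrix_signed_perm) auto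
    moreover have "?Q *v \<sigma> = \<sigma>" using that by (auto simp: vec_eq_iff Transposition.transpose_def)
    ultimately have "(?Q *v g \<sigma>) $ i = g \<sigma> $ i" using fix_g by metis
    then show ?thesis by simp
  qed
  show "g \<sigma> $ i = 0" if "\<sigma> $ i = 0"
  proof -
    let ?Q = "signed_perm id (\<lambda>k. if k = i then -1 else 1)"
    have "signed_permutation_matrix ?Q" by (rule signed_permutation_matrix_signed_perm) auto
    moreover have "?Q *v \<sigma> = \<sigma>" using that by (auto simp: vec_eq_iff)
    ultimately have "(?Q *v g \<sigma>) $ i = g \<sigma> $ i" using fix_g by metis
    then show ?thesis by simp
  qed
qed

lemma signed_permutation_gap:
  fixes \<sigma> :: "(real, 'm::finite) vec"
  obtains \<delta> where "0 < \<delta>" "\<And>Q. signed_permutation_matrix Q \<Longrightarrow> Q *v \<sigma> \<noteq> \<sigma> \<Longrightarrow> 2 * \<delta> \<le> norm (Q *v \<sigma> - \<sigma>)"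
proof -
  let ?A = "{Q. signed_permutation_matrix Q \<and> Q *v \<sigma> \<noteq> \<sigma>}"
  have "finite ?A" by (rule finite_subset[OF _ finite_signed_permutation_matrices]) auto
  then obtain \<epsilon> where "\<epsilon> > 0" "\<forall>Q\<in>?A. \<epsilon> * \<bar>1\<bar> \<le> norm (Q *v \<sigma> - \<sigma>)"
    using small_scaling[of ?A "\<lambda>Q. norm (Q *v \<sigma> - \<sigma>)" "\<lambda>_. 1"] by auto
  then show ?thesis using that[of "\<epsilon> / 2"] by auto
qed

context wide_shape begin

section \<open>Expansions along decompositions\<close>

text \<open>
At repeated singular values the factors \<open>U\<close> and \<open>V\<close> may jump, but \<open>U [c] V\<^sup>*\<close> has a Taylor expansion because it agrees
with a polynomial in the matrix up to second order.
\<close>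

lemma frozen_values_expansion:
  fixes \<sigma> c :: "(real, 'm) vec" and U0 :: "('a::rc_field, 'm, 'm) matrix"
  assumes nonneg: "\<And>i. 0 \<le> \<sigma> $ i" and eq: "\<And>i j. \<sigma> $ i = \<sigma> $ j \<Longrightarrow> c $ i = c $ j"
    and zero: "\<And>i. \<sigma> $ i = 0 \<Longrightarrow> c $ i = 0"
    and UV0: "unitary_matrix U0" "unitary_matrix V0"
  obtains L C \<delta> where "bounded_linear L" "0 < \<delta>"
    "\<And>H U V s. unitary_matrix U \<Longrightarrow> unitary_matrix V \<Longrightarrow> recompose U0 \<sigma> V0 + H = recompose U s V \<Longrightarrow>
       norm (s - \<sigma>) \<le> norm H \<Longrightarrow> norm H < \<delta> \<Longrightarrow>
       norm (recompose U c V - recompose U0 c V0 - L H) \<le> C * (norm H)\<^sup>2"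
proof -
  let ?X = "recompose U0 \<sigma> V0"
  obtain P :: "('a, 'm, 'n) matrix \<Rightarrow> ('a, 'm, 'n) matrix" and K where P: "\<forall>a. \<exists>L. expands_quadratically P a L"
    and K: "\<forall>\<^sub>F s in nhds \<sigma>. \<forall>U V. unitary_matrix U \<longrightarrow> unitary_matrix V \<longrightarrow>
       norm (P (recompose U s V) - recompose U c V) \<le> K * (norm (s - \<sigma>))\<^sup>2"
    using frozen_values_lift[OF nonneg eq zero] by blast
  obtain L C where L: "bounded_linear L" and C: "\<forall>\<^sub>F h in nhds 0. norm (P (?X + h) - P ?X - L h) \<le> C * (norm h)\<^sup>2"
    using P unfolding expands_quadratically_def by blast
  obtain d1 where d1: "d1 > 0" "\<And>s U V. dist s \<sigma> < d1 \<Longrightarrow> unitary_matrix U \<Longrightarrow> unitary_matrix V \<Longrightarrow>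
      norm (P (recompose U s V) - recompose U c V) \<le> K * (norm (s - \<sigma>))\<^sup>2"
    using K unfolding eventually_nhds_metric by blast
  obtain d2 where d2: "d2 > 0" "\<And>h. norm h < d2 \<Longrightarrow> norm (P (?X + h) - P ?X - L h) \<le> C * (norm h)\<^sup>2"
    using C unfolding eventually_nhds_metric by (auto simp: dist_norm)
  have PX: "P ?X = recompose U0 c V0" using d1(2)[of \<sigma> U0 V0] d1(1) UV0 by simp
  show ?thesis
  proof (rule that[of L "min d1 d2" "\<bar>K\<bar> + C"])
    fix H U V s assume UV: "unitary_matrix U" "unitary_matrix V" and X: "?X + H = recompose U s V"
      and s: "norm (s - \<sigma>) \<le> norm H" and H: "norm H < min d1 d2"
    have "norm (P (?X + H) - recompose U c V) \<le> K * (norm (s - \<sigma>))\<^sup>2"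
      unfolding X using UV s H by (intro d1(2)) (auto simp: dist_norm)
    also have "\<dots> \<le> \<bar>K\<bar> * (norm H)\<^sup>2" using s by (intro mult_mono power_mono) auto
    finally have 1: "norm (P (?X + H) - recompose U c V) \<le> \<bar>K\<bar> * (norm H)\<^sup>2" .
    have 2: "norm (P (?X + H) - P ?X - L H) \<le> C * (norm H)\<^sup>2" using H by (intro d2(2)) auto
    have eq: "recompose U c V - recompose U0 c V0 - L H = (P (?X + H) - P ?X - L H) - (P (?X + H) - recompose U c V)"
      by (simp add: PX)
    have "norm (P (?X + H) - P ?X - L H) + norm (P (?X + H) - recompose U c V) \<le> (\<bar>K\<bar> + C) * (norm H)\<^sup>2"
      using 1 2 by (simp add: distrib_right)
    then show "norm (recompose U c V - recompose U0 c V0 - L H) \<le> (\<bar>K\<bar> + C) * (norm H)\<^sup>2"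
      unfolding eq by (rule order_trans[OF norm_triangle_ineq4])
  qed (use L d1(1) d2(1) in auto)
qed

lemma bounded_linear_diag_zero: "bounded_linear (diag_zero :: (real, 'm) vec \<Rightarrow> ('a::rc_field, 'm, 'n) matrix)"
  unfolding linear_conv_bounded_linear[symmetric]
  by (rule linearI) (simp_all add: diag_zero_add diag_zero_scaleR)

lemma tendsto_recompose:
  fixes U :: "'x \<Rightarrow> ('a::rc_field, 'm, 'm) matrix"
  assumes "(U \<longlongrightarrow> U0) F" "(s \<longlongrightarrow> s0) F" "(V \<longlongrightarrow> V0) F"
  shows "((\<lambda>x. recompose (U x) (s x) (V x)) \<longlongrightarrow> recompose U0 s0 V0) F"
  by (intro bounded_bilinear.tendsto[OF bounded_bilinear_matrix_mult] assms
      bounded_linear.tendsto[OF bounded_linear_diag_zero] bounded_linear.tendsto[OF bounded_linear_conj_transpose])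

text \<open>
The map \<open>N\<close> picks the part of \<open>H\<close> that moves the singular values. Dividing the estimate for \<open>t H\<close> by \<open>t\<close> shows that
\<open>N H\<close> is the limit of matrices \<open>U\<^sub>t [y\<^sub>t] V\<^sub>t\<^sup>*\<close> with \<open>\<parallel>y\<^sub>t\<parallel> \<le> \<parallel>H\<parallel>\<close>. By compactness the factors converge along a sequence
\<open>t \<rightarrow> 0\<close>, and their limit decomposes both the base point and \<open>N H\<close>.
\<close>

lemma normal_part_decomposition:
  fixes U0 :: "('a::rc_field, 'm, 'm) matrix"
  assumes UV0: "unitary_matrix U0" "unitary_matrix V0" and N: "bounded_linear N" and \<delta>: "0 < \<delta>"
    and est: "\<And>H U V s. unitary_matrix U \<Longrightarrow> unitary_matrix V \<Longrightarrow> recompose U0 \<sigma> V0 + H = recompose U s V \<Longrightarrow>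
       norm (s - \<sigma>) \<le> norm H \<Longrightarrow> norm H < \<delta> \<Longrightarrow>
       norm (recompose U (s - \<sigma>) V - N H) \<le> C * (norm H)\<^sup>2"
  obtains U V x where "unitary_matrix U" "unitary_matrix V" "recompose U \<sigma> V = recompose U0 \<sigma> V0"
    "recompose U x V = N H"
proof -
  let ?X = "recompose U0 \<sigma> V0"
  define t where "t n = inverse (real (Suc n))" for n
  have t: "0 < t n" for n by (simp add: t_def)
  have t0: "t \<longlonglongrightarrow> 0" unfolding t_def by (rule LIMSEQ_inverse_real_of_nat)
  have "\<exists>T. case T of (U, V, y) \<Rightarrow> unitary_matrix U \<and> unitary_matrix V \<and> norm y \<le> norm H \<and>
      ?X + t n *\<^sub>R H = recompose U (\<sigma> + t n *\<^sub>R y) V" for n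
  proof -
    obtain U V s where *: "unitary_matrix U" "unitary_matrix V" "?X + t n *\<^sub>R H = recompose U s V"
        "norm (s - \<sigma>) \<le> norm (?X + t n *\<^sub>R H - ?X)"
      using nearby_decomposition[OF UV0] by metis
    have "norm ((1 / t n) *\<^sub>R (s - \<sigma>)) \<le> norm H"
      using *(4) t[of n] by (simp add: pos_divide_le_eq mult.commute)
    moreover have "\<sigma> + t n *\<^sub>R ((1 / t n) *\<^sub>R (s - \<sigma>)) = s" using t[of n] by simp
    ultimately show ?thesis using * by (intro exI[of _ "(U, V, (1 / t n) *\<^sub>R (s - \<sigma>))"]) auto
  qed
  then have "\<forall>n. \<exists>T. case T of (U, V, y) \<Rightarrow> unitary_matrix U \<and> unitary_matrix V \<and> norm y \<le> norm H \<and>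
      ?X + t n *\<^sub>R H = recompose U (\<sigma> + t n *\<^sub>R y) V" by (rule allI)
  from choice[OF this] obtain T where T: "\<forall>n. case T n of (U, V, y) \<Rightarrow> unitary_matrix U \<and> unitary_matrix V \<and>
      norm y \<le> norm H \<and> ?X + t n *\<^sub>R H = recompose U (\<sigma> + t n *\<^sub>R y) V" ..
  define A where "A n = fst (T n)" for n
  define B where "B n = fst (snd (T n))" for n
  define y where "y n = snd (snd (T n))" for n
  have A: "unitary_matrix (A n)" and B: "unitary_matrix (B n)" and y: "norm (y n) \<le> norm H"
    and X: "?X + t n *\<^sub>R H = recompose (A n) (\<sigma> + t n *\<^sub>R y n) (B n)" for n
    using T[rule_format, of n] by (auto simp: A_def B_def y_def split: prod.splits)
  have "compact ({U :: ('a, 'm, 'm) matrix. unitary_matrix U} \<times> {V :: ('a, 'n, 'n) matrix. unitary_matrix V} \<times> cball (0 :: (real, 'm) vec) (norm H))"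
    by (intro compact_Times compact_unitary_matrices compact_cball)
  then have "seq_compact ({U :: ('a, 'm, 'm) matrix. unitary_matrix U} \<times> {V :: ('a, 'n, 'n) matrix. unitary_matrix V} \<times> cball (0 :: (real, 'm) vec) (norm H))"
    by (rule compact_imp_seq_compact)
  moreover have "\<forall>n. (A n, B n, y n) \<in> {U. unitary_matrix U} \<times> {V. unitary_matrix V} \<times> cball 0 (norm H)"
    using A B y by simp
  ultimately obtain l r where l: "l \<in> {U. unitary_matrix U} \<times> {V. unitary_matrix V} \<times> cball 0 (norm H)"
      and r: "strict_mono r" and lim: "((\<lambda>n. (A n, B n, y n)) \<circ> r) \<longlonglongrightarrow> l"
    by (rule seq_compactE)
  obtain U V x where l_eq: "l = (U, V, x)" by (cases l)
  have UV: "unitary_matrix U" "unitary_matrix V" using l l_eq by auto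
  have limA: "(\<lambda>n. A (r n)) \<longlonglongrightarrow> U" and limB: "(\<lambda>n. B (r n)) \<longlonglongrightarrow> V" and limy: "(\<lambda>n. y (r n)) \<longlonglongrightarrow> x"
    using tendsto_fst[OF lim] tendsto_fst[OF tendsto_snd[OF lim]] tendsto_snd[OF tendsto_snd[OF lim]]
    by (simp_all add: l_eq o_def)
  have tr: "(\<lambda>n. t (r n)) \<longlonglongrightarrow> 0" using LIMSEQ_subseq_LIMSEQ[OF t0 r] by (simp add: o_def)
  have "(\<lambda>n. ?X + t (r n) *\<^sub>R H) \<longlonglongrightarrow> recompose U (\<sigma> + 0 *\<^sub>R x) V"
    unfolding X by (intro tendsto_recompose tendsto_add tendsto_scaleR tendsto_const limA limB limy tr)
  moreover have "(\<lambda>n. ?X + t (r n) *\<^sub>R H) \<longlonglongrightarrow> ?X + 0 *\<^sub>R H"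
    by (intro tendsto_add tendsto_scaleR tendsto_const tr)
  ultimately have "recompose U (\<sigma> + 0 *\<^sub>R x) V = ?X + 0 *\<^sub>R H" by (rule LIMSEQ_unique)
  then have UX: "recompose U \<sigma> V = ?X" by simp
  have "(\<lambda>n. recompose (A (r n)) (y (r n)) (B (r n)) - N H) \<longlonglongrightarrow> 0"
  proof (rule Lim_null_comparison)
    have "(\<lambda>n. t (r n) * norm H) \<longlonglongrightarrow> 0" using tendsto_mult[OF tr tendsto_const[of "norm H"]] by simp
    then have "\<forall>\<^sub>F n in sequentially. t (r n) * norm H < \<delta>" using \<delta> by (rule order_tendstoD)
    then show "\<forall>\<^sub>F n in sequentially. norm (recompose (A (r n)) (y (r n)) (B (r n)) - N H) \<le> t (r n) * (C * (norm H)\<^sup>2)"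
    proof eventually_elim
      case (elim n)
      let ?t = "t (r n)" and ?R = "recompose (A (r n)) (y (r n)) (B (r n))"
      have tp: "0 < ?t" by (rule t)
      have "norm (recompose (A (r n)) ((\<sigma> + ?t *\<^sub>R y (r n)) - \<sigma>) (B (r n)) - N (?t *\<^sub>R H)) \<le> C * (norm (?t *\<^sub>R H))\<^sup>2"
        using tp y[of "r n"] elim by (intro est A B X) auto
      moreover have "recompose (A (r n)) ((\<sigma> + ?t *\<^sub>R y (r n)) - \<sigma>) (B (r n)) - N (?t *\<^sub>R H) = ?t *\<^sub>R (?R - N H)"
        by (simp add: recompose_scaleR linear_cmul[OF bounded_linear.linear[OF N]] scaleR_diff_right)
      ultimately have "?t * norm (?R - N H) \<le> ?t * (?t * (C * (norm H)\<^sup>2))"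
        using tp by (simp add: power_mult_distrib power2_eq_square mult_ac)
      then show ?case using tp by simp
    qed
    show "(\<lambda>n. t (r n) * (C * (norm H)\<^sup>2)) \<longlonglongrightarrow> 0"
      using tendsto_mult[OF tr tendsto_const] by simp
  qed
  then have "(\<lambda>n. recompose (A (r n)) (y (r n)) (B (r n))) \<longlonglongrightarrow> N H" by (rule LIM_zero_cancel)
  then have "recompose U x V = N H"
    by (rule LIMSEQ_unique[OF tendsto_recompose[OF limA limy limB]])
  then show ?thesis using that UV UX by blast
qed

text \<open>
In the mixture, a signed permutation \<open>Q\<close> that fixes \<open>\<sigma>\<close> commutes with \<open>\<phi>\<close>, so its term is bounded by the Lipschitz
condition. Any other \<open>Q\<close> moves \<open>\<sigma>\<close> by at least \<open>2 \<delta>\<close>, hence \<open>\<parallel>\<sigma> + y - Q \<sigma>\<parallel> \<ge> \<delta>\<close>; its term is bounded crudely, and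
multiplying by \<open>\<parallel>\<sigma> + y - Q \<sigma>\<parallel>\<^sup>2 / \<delta>\<^sup>2 \<ge> 1\<close> brings in the distance of the two matrices with diagonals \<open>\<sigma> + y\<close> and \<open>\<sigma>\<close>.
\<close>

lemma equivariant_recompose_estimate:
  fixes U U' :: "('a::rc_field, 'm, 'm) matrix"
  assumes UV: "unitary_matrix U" "unitary_matrix V" "unitary_matrix U'" "unitary_matrix V'"
    and L: "0 \<le> L" and lip: "\<And>a b. norm (\<phi> a - \<phi> b) \<le> L * norm (a - b)" and \<phi>0: "\<phi> 0 = 0"
    and equi: "\<And>Q x. signed_permutation_matrix Q \<Longrightarrow> Q *v \<sigma> = \<sigma> \<Longrightarrow> \<phi> (Q *v x) = Q *v \<phi> x"
    and gap: "0 < \<delta>" "\<And>Q. signed_permutation_matrix Q \<Longrightarrow> Q *v \<sigma> \<noteq> \<sigma> \<Longrightarrow> 2 * \<delta> \<le> norm (Q *v \<sigma> - \<sigma>)"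
    and y: "norm y \<le> \<delta>" "norm y \<le> e" and x: "norm x \<le> M * e"
  shows "(norm (recompose U (\<phi> y) V - recompose U' (\<phi> x) V'))\<^sup>2 \<le>
    L\<^sup>2 * (norm (recompose U y V - recompose U' x V'))\<^sup>2 +
    (L * (1 + M) * e / \<delta>)\<^sup>2 * (norm (recompose U (\<sigma> + y) V - recompose U' \<sigma> V'))\<^sup>2"
proof -
  obtain w where w: "\<And>Q. 0 \<le> w Q" "sum w {Q. signed_permutation_matrix Q} = 1"
    "\<And>a b. (norm (recompose U a V - recompose U' b V'))\<^sup>2 =
       (\<Sum>Q | signed_permutation_matrix Q. w Q * (norm (a - Q *v b))\<^sup>2)"
    using recompose_distance_mixture[OF UV(1,3,2,4)] by blast
  have "w Q * (norm (\<phi> y - Q *v \<phi> x))\<^sup>2 \<le>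
      L\<^sup>2 * (w Q * (norm (y - Q *v x))\<^sup>2) + (L * (1 + M) * e / \<delta>)\<^sup>2 * (w Q * (norm (\<sigma> + y - Q *v \<sigma>))\<^sup>2)"
    if Q: "signed_permutation_matrix Q" for Q
  proof -
    have "(norm (\<phi> y - Q *v \<phi> x))\<^sup>2 \<le> L\<^sup>2 * (norm (y - Q *v x))\<^sup>2 + (L * (1 + M) * e / \<delta>)\<^sup>2 * (norm (\<sigma> + y - Q *v \<sigma>))\<^sup>2"
    proof (cases "Q *v \<sigma> = \<sigma>")
      case True
      have "norm (\<phi> y - Q *v \<phi> x) \<le> L * norm (y - Q *v x)" using lip[of y "Q *v x"] equi[OF Q True] by simp
      then have "(norm (\<phi> y - Q *v \<phi> x))\<^sup>2 \<le> (L * norm (y - Q *v x))\<^sup>2" by (intro power_mono) auto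
      then show ?thesis by (simp add: power_mult_distrib add_increasing2)
    next
      case False
      have "2 * \<delta> \<le> norm (Q *v \<sigma> - \<sigma>)" by (rule gap(2)[OF Q False])
      also have "Q *v \<sigma> - \<sigma> = y - (\<sigma> + y - Q *v \<sigma>)" by simp
      also have "norm \<dots> \<le> norm y + norm (\<sigma> + y - Q *v \<sigma>)" by (rule norm_triangle_ineq4)
      finally have far: "\<delta> \<le> norm (\<sigma> + y - Q *v \<sigma>)" using y(1) by simp
      have "norm (\<phi> y - Q *v \<phi> x) \<le> norm (\<phi> y) + norm (\<phi> x)"
        using norm_triangle_ineq4[of "\<phi> y" "Q *v \<phi> x"] by (simp add: norm_signed_permutation_mult[OF Q])
      also have "\<dots> \<le> L * norm y + L * norm x" using lip[of y 0] lip[of x 0] \<phi>0 by simp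
      also have "\<dots> \<le> L * e + L * (M * e)" using y(2) x L by (intro add_mono mult_left_mono)
      also have "\<dots> = L * (1 + M) * e" by (simp add: algebra_simps)
      finally have le: "norm (\<phi> y - Q *v \<phi> x) \<le> L * (1 + M) * e" .
      then have "0 \<le> L * (1 + M) * e" by (meson norm_ge_zero order_trans)
      then have "L * (1 + M) * e * \<delta> \<le> L * (1 + M) * e * norm (\<sigma> + y - Q *v \<sigma>)" using far by (intro mult_left_mono)
      then have "L * (1 + M) * e \<le> L * (1 + M) * e / \<delta> * norm (\<sigma> + y - Q *v \<sigma>)"
        using gap(1) by (simp add: field_simps)
      with le have "(norm (\<phi> y - Q *v \<phi> x))\<^sup>2 \<le> (L * (1 + M) * e / \<delta> * norm (\<sigma> + y - Q *v \<sigma>))\<^sup>2"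
        by (intro power_mono) auto
      then have "(norm (\<phi> y - Q *v \<phi> x))\<^sup>2 \<le> (L * (1 + M) * e / \<delta>)\<^sup>2 * (norm (\<sigma> + y - Q *v \<sigma>))\<^sup>2"
        by (simp only: power_mult_distrib)
      then show ?thesis by (intro add_increasing) auto
    qed
    from mult_left_mono[OF this w(1)[of Q]] show ?thesis by (simp add: algebra_simps)
  qed
  then show ?thesis
    unfolding w(3) sum_distrib_left sum.distrib[symmetric] by (intro sum_mono) auto
qed

section \<open>Transfer of B-differentiability\<close>

text \<open>
The directional derivative of \<open>G\<close> is \<open>Lg H + \<Psi> H\<close>: the linear part comes from the frozen values \<open>g \<sigma>\<close>, and \<open>\<Psi> H\<close> applies
\<open>\<phi>\<close> to the diagonal of the part of \<open>H\<close> that moves the singular values.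
\<close>

theorem spectral_operator_B_differentiable:
  fixes G :: "('a::rc_field, 'm, 'n) matrix \<Rightarrow> ('a, 'm, 'n) matrix"
  assumes N: "open N" "X \<in> N" and S: "open S" "singular_values ` N \<subseteq> S"
    and sym: "absolutely_symmetric_on S g" and G: "spectral_operator_on N g G"
    and \<rho>: "0 < \<rho>" "\<rho> \<le> 1"
    and lip: "locally_lipschitz_near g (singular_values X)"
    and B: "B_differentiable_order_at \<rho> g (singular_values X)"
  shows "B_differentiable_order_at \<rho> G X"
proof -
  define \<sigma> where "\<sigma> = singular_values X"
  obtain U0 V0 where UV0: "unitary_matrix U0" "unitary_matrix V0" and X: "X = recompose U0 \<sigma> V0"
      and nonneg: "\<And>i. 0 \<le> \<sigma> $ i"
    unfolding \<sigma>_def using singular_values_decomposition[of X] by blast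
  have \<sigma>S: "\<sigma> \<in> S" using N S by (auto simp: \<sigma>_def)
  obtain \<phi> C1 \<delta>1 where \<phi>: "\<And>h. has_directional_derivative g \<sigma> h (\<phi> h)" and C1: "0 \<le> C1" "0 < \<delta>1"
    and rem: "\<And>h. norm h < \<delta>1 \<Longrightarrow> norm (g (\<sigma> + h) - g \<sigma> - \<phi> h) \<le> C1 * norm h powr (1 + \<rho>)"
    using B_differentiable_order_atE[OF B[folded \<sigma>_def]] by blast
  obtain L where L: "0 \<le> L" "\<And>h k. norm (\<phi> h - \<phi> k) \<le> L * norm (h - k)"
    using directional_derivative_lipschitz[OF lip[folded \<sigma>_def]] \<phi> by metis
  have \<phi>0: "\<phi> 0 = 0" by (rule has_directional_derivative_unique[OF \<phi> has_directional_derivative_0])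
  have \<phi>_scale: "\<phi> (r *\<^sub>R h) = r *\<^sub>R \<phi> h" if "0 < r" for r h
    by (rule has_directional_derivative_unique[OF \<phi> has_directional_derivative_scaleR[OF \<phi> that]])
  have \<phi>_equi: "\<phi> (Q *v h) = Q *v \<phi> h" if "signed_permutation_matrix Q" "Q *v \<sigma> = \<sigma>" for Q h
    by (rule has_directional_derivative_unique[OF \<phi> directional_derivative_signed_permutation[OF sym S(1) \<sigma>S that \<phi>]])
  obtain \<delta>2 where gap: "0 < \<delta>2" "\<And>Q. signed_permutation_matrix Q \<Longrightarrow> Q *v \<sigma> \<noteq> \<sigma> \<Longrightarrow> 2 * \<delta>2 \<le> norm (Q *v \<sigma> - \<sigma>)"
    using signed_permutation_gap by blast
  obtain Lg Cg \<delta>g where Lg: "bounded_linear Lg" "0 < \<delta>g"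
    and estg: "\<And>H U V s. unitary_matrix U \<Longrightarrow> unitary_matrix V \<Longrightarrow> recompose U0 \<sigma> V0 + H = recompose U s V \<Longrightarrow>
       norm (s - \<sigma>) \<le> norm H \<Longrightarrow> norm H < \<delta>g \<Longrightarrow>
       norm (recompose U (g \<sigma>) V - recompose U0 (g \<sigma>) V0 - Lg H) \<le> Cg * (norm H)\<^sup>2"
  proof (rule frozen_values_expansion[OF nonneg _ _ UV0, where c="g \<sigma>"], goal_cases)
    case 1 show ?case by (rule absolutely_symmetric_values(1)[OF sym \<sigma>S 1(2)])
  next
    case 2 show ?case by (rule absolutely_symmetric_values(2)[OF sym \<sigma>S 2(2)])
  next
    case 3 show ?case by (rule 3(1)[OF 3(2-)])
  qed
  obtain Li Ci \<delta>i where Li: "bounded_linear Li" "0 < \<delta>i"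
    and esti: "\<And>H U V s. unitary_matrix U \<Longrightarrow> unitary_matrix V \<Longrightarrow> recompose U0 \<sigma> V0 + H = recompose U s V \<Longrightarrow>
       norm (s - \<sigma>) \<le> norm H \<Longrightarrow> norm H < \<delta>i \<Longrightarrow>
       norm (recompose U \<sigma> V - recompose U0 \<sigma> V0 - Li H) \<le> Ci * (norm H)\<^sup>2"
  proof (rule frozen_values_expansion[OF nonneg _ _ UV0, where c=\<sigma>], goal_cases)
    case 3 show ?case by (rule 3(1)[OF 3(2-)])
  qed
  \<comment> \<open>The part of \<open>H\<close> that moves the singular values.\<close>
  define proj where "proj H = H - Li H" for H
  have proj: "bounded_linear proj" unfolding proj_def by (intro bounded_linear_sub bounded_linear_ident Li)
  have est_proj: "norm (recompose U (s - \<sigma>) V - proj H) \<le> Ci * (norm H)\<^sup>2"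
    if "unitary_matrix U" "unitary_matrix V" "recompose U0 \<sigma> V0 + H = recompose U s V"
       "norm (s - \<sigma>) \<le> norm H" "norm H < \<delta>i" for H U V s
  proof -
    have "recompose U (s - \<sigma>) V - proj H = - (recompose U \<sigma> V - recompose U0 \<sigma> V0 - Li H)"
      using that(3) by (simp add: recompose_diff proj_def algebra_simps)
    then show ?thesis using esti[OF that] by (simp only: norm_minus_cancel)
  qed
  obtain M where M: "M > 0" "\<And>H. norm (proj H) \<le> norm H * M"
    using bounded_linear.pos_bounded[OF proj] by blast
  have "\<exists>Y. \<exists>U V x. unitary_matrix U \<and> unitary_matrix V \<and> recompose U \<sigma> V = X \<and>
      recompose U x V = proj H \<and> Y = recompose U (\<phi> x) V" for H
  proof -
    obtain U V x where "unitary_matrix U" "unitary_matrix V" "recompose U \<sigma> V = recompose U0 \<sigma> V0"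
        "recompose U x V = proj H"
    proof (rule normal_part_decomposition[OF UV0 proj Li(2), where \<sigma>=\<sigma> and C=Ci and H=H], goal_cases)
      case 1 show ?case by (rule est_proj[OF 1(2-)])
    next
      case 2 show ?case by (rule 2(1)[OF 2(2-)])
    qed
    then show ?thesis using X by blast
  qed
  then have "\<forall>H. \<exists>Y. \<exists>U V x. unitary_matrix U \<and> unitary_matrix V \<and> recompose U \<sigma> V = X \<and>
      recompose U x V = proj H \<and> Y = recompose U (\<phi> x) V" by (rule allI)
  from choice[OF this] obtain \<Psi>0 where \<Psi>0: "\<forall>H. \<exists>U V x. unitary_matrix U \<and> unitary_matrix V \<and> recompose U \<sigma> V = X \<and>
      recompose U x V = proj H \<and> \<Psi>0 H = recompose U (\<phi> x) V" ..
  \<comment> \<open>Any choice of decompositions on the unit sphere, made positively homogeneous.\<close>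
  define \<Psi> where "\<Psi> H = norm H *\<^sub>R \<Psi>0 (sgn H)" for H
  define E where "E = sqrt (L\<^sup>2 * Ci\<^sup>2 + (L * (1 + M) / \<delta>2)\<^sup>2)"
  define \<delta> where "\<delta> = Min {1, \<delta>1, \<delta>2, \<delta>g, \<delta>i}"
  have \<delta>: "0 < \<delta>" "\<delta> \<le> 1" "\<delta> \<le> \<delta>1" "\<delta> \<le> \<delta>2" "\<delta> \<le> \<delta>g" "\<delta> \<le> \<delta>i"
    using C1 gap(1) Lg(2) Li(2) by (auto simp: \<delta>_def)
  obtain \<delta>N where \<delta>N: "0 < \<delta>N" "\<And>H. norm H < \<delta>N \<Longrightarrow> X + H \<in> N"
  proof -
    obtain e where "e > 0" "ball X e \<subseteq> N" using N open_contains_ball by blast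
    moreover from this(2) have "X + H \<in> N" if "norm H < e" for H
      using that by (intro subsetD[of "ball X e" N]) (simp_all add: dist_norm)
    ultimately show ?thesis using that by blast
  qed
  show ?thesis
  proof (rule B_differentiable_order_atI[where \<delta>="min \<delta> \<delta>N" and F'="\<lambda>H. Lg H + \<Psi> H" and C="C1 + \<bar>Cg\<bar> + E"])
    show "0 < \<rho>" by (rule \<rho>)
    show "0 < min \<delta> \<delta>N" using \<delta> \<delta>N by simp
    show "Lg (t *\<^sub>R H) + \<Psi> (t *\<^sub>R H) = t *\<^sub>R (Lg H + \<Psi> H)" if "0 < t" for t H
      using that by (simp add: \<Psi>_def sgn_scaleR linear_cmul[OF bounded_linear.linear[OF Lg(1)]] scaleR_add_right)
  next
    fix H :: "('a, 'm, 'n) matrix" assume H0: "H \<noteq> 0" and H: "norm H < min \<delta> \<delta>N"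
    obtain U V s where UV: "unitary_matrix U" "unitary_matrix V" and XH: "X + H = recompose U s V"
      and s0: "norm (s - \<sigma>) \<le> norm (X + H - recompose U0 \<sigma> V0)"
    proof (rule nearby_decomposition[OF UV0, where X="X + H" and ?s0.0=\<sigma>], goal_cases)
      case 1 show ?case by (rule 1(1)[OF 1(2-)])
    qed
    have s: "norm (s - \<sigma>) \<le> norm H" using s0 by (simp only: X add_diff_cancel_left')
    define y where "y = s - \<sigma>"
    have sy: "s = \<sigma> + y" by (simp add: y_def)
    obtain U' V' x0 where UV': "unitary_matrix U'" "unitary_matrix V'" and X': "recompose U' \<sigma> V' = X"
      and x0: "recompose U' x0 V' = proj (sgn H)" "\<Psi>0 (sgn H) = recompose U' (\<phi> x0) V'"
      using \<Psi>0[rule_format, of "sgn H"] by blast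
    \<comment> \<open>Scaling the decomposition at \<open>sgn H\<close> gives one at \<open>H\<close>, as \<open>\<phi>\<close> is positively homogeneous.\<close>
    define x where "x = norm H *\<^sub>R x0"
    have "recompose U' x V' = norm H *\<^sub>R proj (sgn H)" by (simp add: x_def recompose_scaleR x0)
    also have "\<dots> = proj (norm H *\<^sub>R sgn H)" by (simp add: linear_cmul[OF bounded_linear.linear[OF proj]])
    also have "norm H *\<^sub>R sgn H = H" using H0 by (simp add: sgn_div_norm)
    finally have x: "recompose U' x V' = proj H" .
    have \<Psi>x: "\<Psi> H = recompose U' (\<phi> x) V'"
      using H0 by (simp add: \<Psi>_def x0 x_def \<phi>_scale recompose_scaleR)
    have xM: "norm x \<le> M * norm H"
      using M(2)[of H] norm_recompose[OF UV', of x] x by (simp add: mult.commute)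
    have XH': "recompose U0 \<sigma> V0 + H = recompose U s V" using XH X by simp
    have "G (X + H) = recompose U (g s) V"
      using spectral_operator_recompose[OF sym S(2) G UV, of s] \<delta>N(2)[of H] H XH by simp
    moreover have "G X = recompose U0 (g \<sigma>) V0"
      using spectral_operator_recompose[OF sym S(2) G UV0, of \<sigma>] N(2) X by simp
    ultimately have split: "G (X + H) - G X - (Lg H + \<Psi> H) =
        recompose U (g s - g \<sigma> - \<phi> y) V + (recompose U (g \<sigma>) V - recompose U0 (g \<sigma>) V0 - Lg H)
        + (recompose U (\<phi> y) V - recompose U' (\<phi> x) V')"
      by (simp add: recompose_diff \<Psi>x)
    have 1: "norm (recompose U (g s - g \<sigma> - \<phi> y) V) \<le> C1 * norm H powr (1 + \<rho>)"
    proof -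
      have "norm (g s - g \<sigma> - \<phi> y) \<le> C1 * norm y powr (1 + \<rho>)"
        unfolding sy using s H \<delta> by (intro rem) (simp add: y_def)
      also have "\<dots> \<le> C1 * norm H powr (1 + \<rho>)"
        using s C1 \<rho> by (intro mult_left_mono powr_mono2) (auto simp: y_def)
      finally show ?thesis by (simp add: norm_recompose UV)
    qed
    \<comment> \<open>This is where \<open>\<rho> \<le> 1\<close> enters: quadratic errors are absorbed.\<close>
    have sq: "(norm H)\<^sup>2 \<le> norm H powr (1 + \<rho>)"
    proof -
      have "(norm H)\<^sup>2 = norm H powr 2" using H0 by (simp add: powr_numeral)
      also have "\<dots> \<le> norm H powr (1 + \<rho>)" using H \<delta>(2) \<rho> by (intro powr_mono') auto
      finally show ?thesis .
    qed
    have 2: "norm (recompose U (g \<sigma>) V - recompose U0 (g \<sigma>) V0 - Lg H) \<le> \<bar>Cg\<bar> * norm H powr (1 + \<rho>)"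
    proof -
      have "norm (recompose U (g \<sigma>) V - recompose U0 (g \<sigma>) V0 - Lg H) \<le> Cg * (norm H)\<^sup>2"
        using H \<delta> by (intro estg[OF UV XH' s]) simp
      also have "\<dots> \<le> \<bar>Cg\<bar> * norm H powr (1 + \<rho>)" using sq by (intro mult_mono) auto
      finally show ?thesis .
    qed
    have 3: "norm (recompose U (\<phi> y) V - recompose U' (\<phi> x) V') \<le> E * norm H powr (1 + \<rho>)"
    proof -
      have d: "norm (recompose U y V - recompose U' x V') \<le> Ci * (norm H)\<^sup>2"
        unfolding x y_def using H \<delta> by (intro est_proj[OF UV XH' s]) simp
      have "(norm (recompose U (\<phi> y) V - recompose U' (\<phi> x) V'))\<^sup>2 \<le>
          L\<^sup>2 * (norm (recompose U y V - recompose U' x V'))\<^sup>2 +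
          (L * (1 + M) * norm H / \<delta>2)\<^sup>2 * (norm (recompose U (\<sigma> + y) V - recompose U' \<sigma> V'))\<^sup>2"
        using s H \<delta> xM by (intro equivariant_recompose_estimate UV UV' L \<phi>0 \<phi>_equi gap) (auto simp: y_def)
      also have "recompose U (\<sigma> + y) V - recompose U' \<sigma> V' = H" 
        by (simp only: sy[symmetric] XH[symmetric] X' add_diff_cancel_left')
      also have "L\<^sup>2 * (norm (recompose U y V - recompose U' x V'))\<^sup>2 + (L * (1 + M) * norm H / \<delta>2)\<^sup>2 * (norm H)\<^sup>2
          \<le> L\<^sup>2 * (Ci * (norm H)\<^sup>2)\<^sup>2 + (L * (1 + M) * norm H / \<delta>2)\<^sup>2 * (norm H)\<^sup>2"
        using d by (intro add_right_mono mult_left_mono power_mono) auto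
      also have "\<dots> = (E * (norm H)\<^sup>2)\<^sup>2"
      proof -
        define k where "k = L * (1 + M) / \<delta>2"
        have "E\<^sup>2 = L\<^sup>2 * Ci\<^sup>2 + k\<^sup>2" by (simp add: E_def k_def)
        moreover have "L * (1 + M) * norm H / \<delta>2 = k * norm H" by (simp add: k_def)
        ultimately show ?thesis by algebra
      qed
      finally have "norm (recompose U (\<phi> y) V - recompose U' (\<phi> x) V') \<le> E * (norm H)\<^sup>2"
        by (rule power2_le_imp_le) (simp add: E_def)
      also have "\<dots> \<le> E * norm H powr (1 + \<rho>)" using sq by (intro mult_left_mono) (auto simp: E_def)
      finally show ?thesis .
    qed
    show "norm (G (X + H) - G X - (Lg H + \<Psi> H)) \<le> (C1 + \<bar>Cg\<bar> + E) * norm H powr (1 + \<rho>)"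
      unfolding split distrib_right
      by (intro order_trans[OF norm_triangle_ineq] add_mono 1 2 3)
  qed
qed

text \<open>
The isometric embedding \<open>J h = U [h] V\<^sup>*\<close> satisfies \<open>G (X + J h) = J (g (\<sigma> + h))\<close>, and its adjoint is a left inverse.
\<close>

theorem B_differentiable_of_spectral_operator:
  fixes G :: "('a::rc_field, 'm, 'n) matrix \<Rightarrow> ('a, 'm, 'n) matrix"
  assumes N: "open N" "X \<in> N" and S: "singular_values ` N \<subseteq> S"
    and sym: "absolutely_symmetric_on S g" and G: "spectral_operator_on N g G"
    and \<rho>: "0 < \<rho>"
    and B: "B_differentiable_order_at \<rho> G X"
  shows "B_differentiable_order_at \<rho> g (singular_values X)"
proof -
  define \<sigma> where "\<sigma> = singular_values X"
  obtain U V where UV: "unitary_matrix U" "unitary_matrix V" and X: "X = recompose U \<sigma> V"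
    unfolding \<sigma>_def using singular_values_decomposition[of X] by blast
  define J where "J h = recompose U h V" for h
  have J: "linear J" unfolding J_def by (rule linear_recompose)
  define K where "K = adjoint J"
  have KJ: "K (J h) = h" for h
  proof -
    have "inner x (K (J h)) = inner x h" for x
      unfolding K_def using adjoint_works[OF J, of x "J h"] by (simp add: J_def inner_recompose[OF UV])
    from this[of "K (J h) - h"] show ?thesis by (metis inner_diff_right inner_eq_zero_iff right_minus_eq)
  qed
  have K: "bounded_linear K" unfolding K_def using adjoint_linear[OF J] by (simp add: linear_conv_bounded_linear)
  then obtain M where M: "M > 0" "\<And>Y. norm (K Y) \<le> norm Y * M" using bounded_linear.pos_bounded by blast
  obtain \<delta>N where \<delta>N: "0 < \<delta>N" "\<And>H. norm H < \<delta>N \<Longrightarrow> X + H \<in> N"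
  proof -
    obtain e where "e > 0" "ball X e \<subseteq> N" using N open_contains_ball by blast
    moreover from this(2) have "X + H \<in> N" if "norm H < e" for H
      using that by (intro subsetD[of "ball X e" N]) (simp_all add: dist_norm)
    ultimately show ?thesis using that by blast
  qed
  have norm_J: "norm (J h) = norm h" for h by (simp add: J_def norm_recompose[OF UV])
  have GJ: "G (X + J h) = J (g (\<sigma> + h))" if "norm h < \<delta>N" for h
  proof -
    have XJ: "X + J h = recompose U (\<sigma> + h) V" by (simp add: X J_def recompose_add)
    then have "recompose U (\<sigma> + h) V \<in> N" using \<delta>N(2)[of "J h"] that norm_J by simp
    then have "G (recompose U (\<sigma> + h) V) = J (g (\<sigma> + h))"
      unfolding J_def by (rule spectral_operator_recompose[OF sym S G UV])
    then show ?thesis by (simp only: XJ)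
  qed
  have gK: "g (\<sigma> + h) = K (G (X + J h))" if "norm h < \<delta>N" for h using GJ[OF that] KJ by simp
  have g0: "g \<sigma> = K (G X)" using gK[of 0] \<delta>N(1) linear_0[OF J] by simp
  obtain F' C \<delta> where F': "\<And>h. has_directional_derivative G X h (F' h)" and C: "0 \<le> C" "0 < \<delta>"
    and rem: "\<And>h. norm h < \<delta> \<Longrightarrow> norm (G (X + h) - G X - F' h) \<le> C * norm h powr (1 + \<rho>)"
    using B_differentiable_order_atE[OF B] by blast
  have "B_differentiable_order_at \<rho> g \<sigma>"
  proof (rule B_differentiable_order_atI[where F'="\<lambda>h. K (F' (J h))" and \<delta>="min \<delta> \<delta>N" and C="C * M"])
    show "0 < \<rho>" by (rule \<rho>)
    show "0 < min \<delta> \<delta>N" using C \<delta>N by simp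
    fix t :: real and h :: "(real, 'm) vec" assume "0 < t"
    then have "F' (t *\<^sub>R J h) = t *\<^sub>R F' (J h)"
      using has_directional_derivative_unique[OF F' has_directional_derivative_scaleR[OF F']] by blast
    then show "K (F' (J (t *\<^sub>R h))) = t *\<^sub>R K (F' (J h))"
      by (simp add: linear_cmul[OF J] linear_cmul[OF bounded_linear.linear[OF K]])
  next
    fix h :: "(real, 'm) vec" assume h: "norm h < min \<delta> \<delta>N"
    have "g (\<sigma> + h) - g \<sigma> - K (F' (J h)) = K (G (X + J h) - G X - F' (J h))"
      using h by (simp add: gK g0 linear_diff[OF bounded_linear.linear[OF K]])
    then have "norm (g (\<sigma> + h) - g \<sigma> - K (F' (J h))) \<le> norm (G (X + J h) - G X - F' (J h)) * M"
      by (simp add: M(2))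
    also have "\<dots> \<le> C * norm h powr (1 + \<rho>) * M"
      using rem[of "J h"] h M(1) by (intro mult_right_mono) (auto simp: norm_J)
    finally show "norm (g (\<sigma> + h) - g \<sigma> - K (F' (J h))) \<le> C * M * norm h powr (1 + \<rho>)" by (simp add: mult_ac)
  qed
  then show ?thesis by (simp add: \<sigma>_def)
qed

end

theorem theorem4p2:
  fixes g :: "(real, 'm::{finite,linorder}) vec \<Rightarrow> (real, 'm) vec"
    and S :: "(real, 'm) vec set"
    and \<rho> :: real
  assumes "CARD('m) \<le> CARD('n::{finite,linorder})"
    and "open S" and "absolutely_symmetric_on S g"
    and "0 < \<rho>" and "\<rho> \<le> 1"
  shows
    "(\<forall>(N :: (real, 'm, 'n) matrix set) G X.
        open N \<and> N \<noteq> {} \<and> singular_values ` N \<subseteq> S \<and> spectral_operator_on N g G \<and> X \<in> N \<longrightarrow>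
          (locally_lipschitz_near g (singular_values X) \<and>
           B_differentiable_order_at \<rho> g (singular_values X) \<longrightarrow>
             B_differentiable_order_at \<rho> G X) \<and>
          (B_differentiable_order_at \<rho> G X \<longrightarrow>
             B_differentiable_order_at \<rho> g (singular_values X)))
     \<and>
     (\<forall>(N :: (complex, 'm, 'n) matrix set) G X.
        open N \<and> N \<noteq> {} \<and> singular_values ` N \<subseteq> S \<and> spectral_operator_on N g G \<and> X \<in> N \<longrightarrow>
          (locally_lipschitz_near g (singular_values X) \<and>
           B_differentiable_order_at \<rho> g (singular_values X) \<longrightarrow>
             B_differentiable_order_at \<rho> G X) \<and>
          (B_differentiable_order_at \<rho> G X \<longrightarrow>
             B_differentiable_order_at \<rho> g (singular_values X)))"
proof -
  interpret wide_shape "TYPE('m)" "TYPE('n)" by unfold_locales (rule assms(1))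
  note G = spectral_operator_B_differentiable[OF _ _ assms(2) _ assms(3) _ assms(4,5)]
  note g = B_differentiable_of_spectral_operator[OF _ _ _ assms(3) _ assms(4)]
  show ?thesis
    by (intro conjI allI impI; elim conjE) (rule G g; assumption)+
qed

end
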